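(* For every integer $d \geq 2$ and every convex body $K \subseteq \mathbb{R}^d$ of unit volume, we have \[ \lim_{n \to \infty} n^{-d}EH_{d,d+1}^K(n) \ge \frac{2}{(d-1)!\,p_{d-1}}. \]
   Context: A convex body in $\mathbb{R}^d$ is a compact convex subset of $\mathbb{R}^d$ with nonempty interior; volume means $d$-dimensional Lebesgue measure. A finite point set is in convex position if none of its points lies in the convex hull of the remaining points. A finite set $S\subseteq\mathbb{R}^d$ is in general position if for every $j\in\{1,\dots,d-1\}$ no $j+2$ points of $S$ lie on a $j$-dimensional affine subspace of $\mathbb{R}^d$. For an integer $k\ge d+1$, a $k$-hole in a finite set $S\subseteq\mathbb{R}^d$ in general position is a set of $k$ points of $S$ in convex position whose convex hull contains no point of $S$ in its interior. For a convex body $K\subseteq\mathbb{R}^d$ of unit volume, $EH^K_{d,k}(n)$ denotes the expected number of $k$-holes in a set of $n$ points chosen uniformly and independently at random from $K$ (such a set is in general position with probability $1$). The limit $\lim_{n\to\infty} n^{-d}EH^K_{d,d+1}(n)$ is known to exist (Reitzner and Temesvari). For an integer $m\ge 1$ and a convex body $L\subseteq\mathbb{R}^m$ (of not necessarily unit volume), $p^L_m$ denotes the probability that the convex hull of $m+2$ points chosen uniformly and independently at random from $L$ is an $m$-simplex, that is, that one of the $m+2$ points falls in the convex hull of the remaining $m+1$ points. Further, $p_m=\max_L p^L_m$, where the maximum is taken over all convex bodies $L\subseteq\mathbb{R}^m$ (the maximum is attained). *)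

theory Defs
  imports "HOL-Probability.Probability"
begin

definition convex_body :: "'a::euclidean_space set \<Rightarrow> bool" where
  "convex_body K \<longleftrightarrow> compact K \<and> convex K \<and> interior K \<noteq> {}"

definition convex_position :: "'a::euclidean_space set \<Rightarrow> bool" where
  "convex_position T \<longleftrightarrow> finite T \<and> (\<forall>x\<in>T. x \<notin> convex hull (T - {x}))"

definition general_position :: "'a::euclidean_space set \<Rightarrow> bool" where
  "general_position S \<longleftrightarrow> finite S \<and>
     (\<forall>j\<in>{1..DIM('a) - 1}. \<forall>T\<subseteq>S. card T = j + 2 \<longrightarrow>
        \<not> (\<exists>A. affine A \<and> aff_dim A = int j \<and> T \<subseteq> A))"

text \<open>Holes exist only in sets in general position, so a degenerate set has none. For random
  points this convention only concerns an event of probability zero.\<close>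

definition is_hole :: "nat \<Rightarrow> 'a::euclidean_space set \<Rightarrow> 'a set \<Rightarrow> bool" where
  "is_hole k S H \<longleftrightarrow> general_position S \<and> H \<subseteq> S \<and> card H = k \<and> convex_position H \<and>
     S \<inter> interior (convex hull H) = {}"

text \<open>The law of \<open>n\<close> independent points \<open>x 0, \<dots>, x (n - 1)\<close>, each uniformly distributed in \<open>K\<close>.\<close>

definition random_points :: "'a::euclidean_space set \<Rightarrow> nat \<Rightarrow> (nat \<Rightarrow> 'a) measure" where
  "random_points K n = PiM {..<n} (\<lambda>_. uniform_measure lborel K)"

definition expected_holes :: "'a::euclidean_space set \<Rightarrow> nat \<Rightarrow> nat \<Rightarrow> real" where
  "expected_holes K k n = (LINT x|random_points K n. real (card {H. is_hole k (x ` {..<n}) H}))"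

definition simplex_prob :: "'a::euclidean_space set \<Rightarrow> real" where
  "simplex_prob L = measure (random_points L (DIM('a) + 2))
     {x \<in> space (random_points L (DIM('a) + 2)).
        \<exists>i<DIM('a) + 2. x i \<in> convex hull (x ` ({..<DIM('a) + 2} - {i}))}"

text \<open>The maximum over all convex bodies is written as a supremum; the two agree because
  the maximum is attained. The dimension is that of the type argument.\<close>

definition max_simplex_prob :: "'a::euclidean_space itself \<Rightarrow> real" where
  "max_simplex_prob _ = (SUP L\<in>{L :: 'a set. convex_body L}. simplex_prob L)"

end

theory Submission
  imports Defs "HOL-Analysis.Simplex_Content" "HOL-Real_Asymp.Real_Asymp"
begin

text \<open>The substitution of hyperplane parameters for heights is the affine
  Blaschke-Petkantschin formula in graph coordinates: once the base points are fixed, it is linear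
  with a square matrix, so a determinant replaces any measure on a Grassmannian. The vertical
  distance suffices because a shear makes the hyperplane horizontal without changing volumes. The
  limit depends only on sections because of a cancellation. After rescaling, the probability of an
  empty simplex tends to \<open>exp (- D * \<bar>s\<bar> / d!)\<close>, whose integral over
  \<open>s\<close>, on both sides of the hyperplane, is \<open>2 * d! / D\<close>, and the Jacobian
  is \<open>D\<close>. The binomial coefficient contributes \<open>1 / (d + 1)!\<close>, which
  leaves \<open>2 / (d + 1)\<close>. The factor \<open>1 / (d + 1)\<close> in the moment bound has
  another origin: any one of \<open>d + 1\<close> points of the section may be the one inside the
  simplex of the others, and these events are almost surely disjoint. The obstacle is a dominating
  function valid for all slopes. A bound on \<open>\<bar>L\<bar>\<close> by the slope alone is not
  integrable over \<open>t\<close>, so one factor \<open>\<bar>L\<bar>\<close> is kept: its integral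
  over \<open>t\<close> is the volume of the body, whatever the slope.\<close>

text \<open>
  Almost surely the points are in general position, so the expected number of holes is
  \<open>n choose (d + 1)\<close> times the integral of \<open>(1 - V) ^ (n - d - 1)\<close>, where \<open>V\<close> is the volume of a
  simplex with \<open>d + 1\<close> random vertices. Almost every hyperplane is a graph \<open>z = a \<bullet> x + t\<close> over the
  first \<open>d - 1\<close> coordinates. Replacing the heights of \<open>d\<close> points by the parameters \<open>(a, t)\<close> of the
  hyperplane through them has Jacobian \<open>D\<close>, which is \<open>(d - 1)!\<close> times the volume of the projected
  simplex, while \<open>V = D * h / d!\<close> with \<open>h\<close> the vertical distance of the last point to the hyperplane.
  Rescaling \<open>h\<close> by \<open>n\<close>, dominated convergence identifies the limit as \<open>2 / (d + 1)\<close> times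
  \<open>J = \<integral> |L| ^ (d + 1) d(a, t)\<close>, where \<open>L\<close> is the projected section of \<open>K\<close>. The same substitution
  applied to \<open>1 = |K| ^ d\<close> gives \<open>1 = \<integral> d(a, t)\<close> of the integral of \<open>D\<close> over \<open>L ^ d\<close>, and the
  inner integral is at most \<open>(d - 1)! * p * |L| ^ (d + 1) / (d + 1)\<close> with \<open>p\<close> the maximal simplex
  probability in dimension \<open>d - 1\<close>. Hence \<open>J \<ge> (d + 1) / ((d - 1)! * p)\<close>.

  The integral \<open>J\<close> is finite because sections with steep slope \<open>a\<close> have small projections.
\<close>

subsection \<open>Volume-preserving changes of coordinates\<close>

lemma borel_measurable_fst_snd [measurable (raw)]:
  fixes f :: "'w \<Rightarrow> 'a::second_countable_topology \<times> 'b::second_countable_topology"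
  assumes "f \<in> borel_measurable M"
  shows "(\<lambda>w. fst (f w)) \<in> borel_measurable M" and "(\<lambda>w. snd (f w)) \<in> borel_measurable M"
  by (rule measurable_compose[OF assms borel_measurable_continuous_onI], intro continuous_intros)+

lemma borel_measurable_vec_lambda [measurable (raw)]:
  fixes f :: "'w \<Rightarrow> 'o::finite \<Rightarrow> 'a::euclidean_space"
  assumes "\<And>i. (\<lambda>w. f w i) \<in> borel_measurable M"
  shows "(\<lambda>w. \<chi> i. f w i) \<in> borel_measurable M"
proof (subst borel_measurable_euclidean_space, intro ballI)
  fix b :: "'a^'o" assume "b \<in> Basis"
  then obtain i u where b: "b = axis i u" by (auto simp: Basis_vec_def)
  show "(\<lambda>w. (\<chi> i. f w i) \<bullet> b) \<in> borel_measurable M"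
    unfolding b using assms[of i] by (simp add: inner_axis)
qed

lemma borel_measurable_vec_nth' [measurable]:
  "(\<lambda>x::'a::euclidean_space^'o::finite. x $ i) \<in> borel_measurable borel"
  by (intro borel_measurable_continuous_onI continuous_intros)

lemma linear_borel_measurable:
  fixes f :: "'a::euclidean_space \<Rightarrow> 'b::euclidean_space"
  shows "linear f \<Longrightarrow> f \<in> borel_measurable borel"
  by (intro borel_measurable_continuous_onI linear_continuous_on) (simp add: linear_conv_bounded_linear)

text \<open>Both bases are orthonormal, so only diagonal terms survive the expansion. Such maps
  identify Euclidean spaces of equal dimension but different type: \<open>'b \<times> real\<close>
  with the ambient space, and with the vectors on which the determinant is formed.\<close>

lemma inner_Basis_bij:
  fixes T :: "'a::euclidean_space \<Rightarrow> 'b::euclidean_space"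
  assumes T: "linear T" and bij: "bij_betw T Basis Basis"
  shows "T x \<bullet> T z = x \<bullet> z"
proof -
  have inj: "inj_on T Basis" and im: "T ` Basis = Basis" using bij by (auto simp: bij_betw_def)
  have rep: "T x = (\<Sum>c\<in>Basis. (x \<bullet> c) *\<^sub>R T c)" for x
  proof -
    have "T (\<Sum>c\<in>Basis. (x \<bullet> c) *\<^sub>R c) = (\<Sum>c\<in>Basis. (x \<bullet> c) *\<^sub>R T c)"
      by (simp only: linear_sum[OF T] linear_cmul[OF T])
    then show ?thesis by (simp add: euclidean_representation)
  qed
  have "T x \<bullet> T z = (\<Sum>c\<in>Basis. \<Sum>b\<in>Basis. (x \<bullet> c) * (z \<bullet> b) * (T c \<bullet> T b))"
    unfolding rep[of x] rep[of z]
    by (subst sum.swap) (simp add: inner_sum_left inner_sum_right sum_distrib_left mult_ac)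
  also have "\<dots> = (\<Sum>c\<in>Basis. \<Sum>b\<in>Basis. if b = c then (x \<bullet> c) * (z \<bullet> b) else 0)"
  proof (intro sum.cong refl)
    fix b c :: 'a assume c: "c \<in> Basis" "b \<in> Basis"
    then have "T c \<in> Basis" "T b \<in> Basis" using im by auto
    moreover have "T c = T b \<longleftrightarrow> c = b" using inj c by (auto simp: inj_on_def)
    ultimately show "(x \<bullet> c) * (z \<bullet> b) * (T c \<bullet> T b) = (if b = c then (x \<bullet> c) * (z \<bullet> b) else 0)"
      by (simp add: inner_Basis)
  qed
  also have "\<dots> = x \<bullet> z" by (simp add: euclidean_inner[of x z])
  finally show ?thesis .
qed

text \<open>The preimage of a box is a box with the same side lengths in another order, and boxes
  determine Lebesgue measure.\<close>

lemma lborel_distr_Basis_bij: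
  fixes T :: "'a::euclidean_space \<Rightarrow> 'b::euclidean_space"
  assumes T: "linear T" and bij: "bij_betw T Basis Basis"
  shows "distr lborel borel T = lborel"
proof (rule lborel_eqI[symmetric])
  have Tm[measurable]: "T \<in> borel_measurable borel"
    by (rule linear_borel_measurable[OF T])
  have inj: "inj_on T Basis" and im: "T ` Basis = Basis" using bij by (auto simp: bij_betw_def)
  have inn: "T x \<bullet> T b = x \<bullet> b" for x b by (rule inner_Basis_bij[OF T bij])
  fix l u :: 'b assume lu: "\<And>b. b \<in> Basis \<Longrightarrow> l \<bullet> b \<le> u \<bullet> b"
  \<comment> \<open>\<open>P\<close> is the transpose of \<open>T\<close>, hence its inverse; it
    supplies the corners of the preimage box.\<close>
  define P where "P v = (\<Sum>b\<in>Basis. (v \<bullet> T b) *\<^sub>R b)" for v :: 'b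
  have P: "P v \<bullet> b = v \<bullet> T b" if "b \<in> Basis" for v b
    using that by (simp add: P_def inner_sum_left inner_Basis if_distrib cong: if_cong)
  have "T -` box l u = box (P l) (P u)"
    unfolding box_def im[symmetric] by (auto simp: P inn)
  then have "emeasure (distr lborel borel T) (box l u) = emeasure lborel (box (P l) (P u))"
    by (subst emeasure_distr) auto
  also have "\<dots> = (\<Prod>b\<in>Basis. (P u - P l) \<bullet> b)"
    using im lu by (subst emeasure_lborel_box) (auto simp: P)
  also have "\<dots> = (\<Prod>b\<in>Basis. (u - l) \<bullet> T b)" by (simp add: P inner_diff_left)
  also have "\<dots> = (\<Prod>b\<in>Basis. (u - l) \<bullet> b)"
    using prod.reindex_bij_betw[OF bij, of "\<lambda>b. (u - l) \<bullet> b"] by simp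
  finally show "emeasure (distr lborel borel T) (box l u) = ennreal (\<Prod>b\<in>Basis. (u - l) \<bullet> b)" .
qed simp

lemma nn_integral_lborel_Basis_bij:
  fixes T :: "'a::euclidean_space \<Rightarrow> 'b::euclidean_space"
  assumes T: "linear T" and bij: "bij_betw T Basis Basis" and [measurable]: "f \<in> borel_measurable borel"
  shows "(\<integral>\<^sup>+x. f x \<partial>lborel) = (\<integral>\<^sup>+x. f (T x) \<partial>lborel)"
proof -
  have [measurable]: "T \<in> borel_measurable borel"
    by (rule linear_borel_measurable[OF T])
  show ?thesis
    by (subst lborel_distr_Basis_bij[OF T bij, symmetric]) (simp add: nn_integral_distr)
qed

lemma measure_lborel_Basis_bij_image:
  fixes T :: "'a::euclidean_space \<Rightarrow> 'b::euclidean_space"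
  assumes T: "linear T" and bij: "bij_betw T Basis Basis" and C: "compact C"
  shows "measure lborel (T ` C) = measure lborel C"
proof -
  have bl: "bounded_linear T" using T by (simp add: linear_conv_bounded_linear)
  then have [measurable]: "T \<in> borel_measurable borel"
    by (intro borel_measurable_continuous_onI linear_continuous_on)
  have inj: "inj T"
  proof (rule injI)
    fix x y assume "T x = T y"
    then have "T (x - y) \<bullet> T (x - y) = 0" by (simp add: linear_diff[OF T])
    then show "x = y" by (simp add: inner_Basis_bij[OF T bij])
  qed
  have "compact (T ` C)" using C bl by (intro compact_continuous_image linear_continuous_on)
  then have [measurable]: "T ` C \<in> sets borel" by (simp add: borel_compact)
  have "measure lborel (T ` C) = measure (distr lborel borel T) (T ` C)"
    by (simp add: lborel_distr_Basis_bij[OF T bij])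
  also have "\<dots> = measure lborel (T -` (T ` C))" by (subst measure_distr) auto
  finally show ?thesis using inj by (simp add: inj_vimage_image_eq)
qed

lemma ex_linear_Basis_bij:
  assumes "DIM('a) = DIM('b)"
  obtains T :: "'a::euclidean_space \<Rightarrow> 'b::euclidean_space" where "linear T" "bij_betw T Basis Basis"
proof -
  obtain f where f: "bij_betw f (Basis::'a set) (Basis::'b set)"
    using assms finite_same_card_bij[of "Basis::'a set" "Basis::'b set"] by auto
  define T where "T x = (\<Sum>b\<in>Basis. (x \<bullet> b) *\<^sub>R f b)" for x
  have "linear T"
    by (rule linearI) (simp_all add: T_def inner_add_left scaleR_add_left sum.distrib scaleR_sum_right)
  moreover have "T b = f b" if "b \<in> Basis" for b
  proof -
    have "T b = (\<Sum>c\<in>Basis. if c = b then f c else 0)"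
      unfolding T_def using that by (intro sum.cong) (auto simp: inner_Basis)
    then show ?thesis using that by simp
  qed
  then have "bij_betw T Basis Basis" using f bij_betw_cong[of Basis T f] by blast
  ultimately show ?thesis by (rule that)
qed

text \<open>Random points are functions under a product measure, whereas determinants and linear
  substitutions live on vectors. This identity lets integrals pass between the two.\<close>

lemma lborel_vec_eq_distr_PiM:
  "(lborel :: ('a::euclidean_space ^ 'o::finite) measure) =
     distr (PiM UNIV (\<lambda>_. lborel)) borel (\<lambda>x. \<chi> i. x i)"
proof (rule lborel_eqI)
  interpret product_sigma_finite "\<lambda>_::'o. lborel :: 'a measure" by standard
  show "sets (distr (PiM UNIV (\<lambda>_. lborel)) borel (\<lambda>x. \<chi> i. x i)) = sets borel" by simp
  fix l u :: "'a^'o" assume lu: "\<And>b. b \<in> Basis \<Longrightarrow> l \<bullet> b \<le> u \<bullet> b"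
  have lu': "l$i \<bullet> b \<le> u$i \<bullet> b" if "b \<in> Basis" for i b
    using lu[of "axis i b"] that by (simp add: inner_axis)
  have "(\<lambda>x. \<chi> i. x i) -` box l u = (\<Pi>\<^sub>E i\<in>UNIV. box (l$i) (u$i))"
    by (auto simp: box_def Basis_vec_def inner_axis PiE_def)
  then have "emeasure (distr (PiM UNIV (\<lambda>_. lborel)) borel (\<lambda>x. \<chi> i. x i)) (box l u) =
     (\<Prod>i\<in>UNIV. emeasure lborel (box (l$i) (u$i)))"
    by (subst emeasure_distr) (auto simp: space_PiM emeasure_PiM)
  also have "\<dots> = (\<Prod>i\<in>UNIV. ennreal (\<Prod>b\<in>Basis. (u$i - l$i) \<bullet> b))"
    by (intro prod.cong refl emeasure_lborel_box) (auto simp: lu')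
  also have "\<dots> = ennreal (\<Prod>i\<in>UNIV. \<Prod>b\<in>Basis. (u$i - l$i) \<bullet> b)"
    by (intro prod_ennreal prod_nonneg) (auto simp: lu' inner_diff_left)
  also have "(\<Prod>i\<in>UNIV. \<Prod>b\<in>Basis. (u$i - l$i) \<bullet> b) = (\<Prod>b\<in>Basis. (u - l) \<bullet> b)"
  proof -
    have "(Basis :: ('a^'o) set) = (\<lambda>(i,b). axis i b) ` (UNIV \<times> Basis)"
      by (auto simp: Basis_vec_def)
    moreover have "inj_on (\<lambda>(i,b). axis i b :: 'a^'o) (UNIV \<times> Basis)"
      by (auto simp: inj_on_def axis_eq_axis)
    ultimately have "(\<Prod>b\<in>Basis. (u - l) \<bullet> b) = (\<Prod>(i,b)\<in>UNIV \<times> Basis. (u - l) \<bullet> axis i b)"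
      by (metis (mono_tags, lifting) prod.reindex_cong case_prod_unfold)
    then show ?thesis
      by (simp add: prod.cartesian_product inner_axis)
  qed
  finally show "emeasure (distr (PiM UNIV (\<lambda>_. lborel)) borel (\<lambda>x. \<chi> i. x i)) (box l u) =
    ennreal (\<Prod>b\<in>Basis. (u - l) \<bullet> b)" .
qed

lemma nn_integral_lborel_vec_PiM:
  assumes [measurable]: "f \<in> borel_measurable (borel :: ('a::euclidean_space ^ 'o::finite) measure)"
  shows "(\<integral>\<^sup>+x. f x \<partial>lborel) = (\<integral>\<^sup>+x. f (\<chi> i. x i) \<partial>PiM UNIV (\<lambda>_::'o. lborel :: 'a measure))"
  by (subst lborel_vec_eq_distr_PiM) (simp add: nn_integral_distr)

lemma nn_integral_PiM_lborel_vec: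
  assumes [measurable]: "f \<in> borel_measurable (PiM UNIV (\<lambda>_::'o::finite. lborel :: 'a::euclidean_space measure))"
  shows "(\<integral>\<^sup>+x. f x \<partial>PiM UNIV (\<lambda>_::'o. lborel :: 'a measure)) =
    (\<integral>\<^sup>+x. f (\<lambda>i. x $ i) \<partial>(lborel :: ('a^'o) measure))"
proof -
  have [measurable]: "(\<lambda>x::'a^'o. \<lambda>i. x $ i) \<in> borel \<rightarrow>\<^sub>M PiM UNIV (\<lambda>_::'o. lborel :: 'a measure)"
    by (rule measurable_PiM_single') auto
  have "(\<lambda>i. (\<chi> i. x i) $ i) = x" for x :: "'o \<Rightarrow> 'a" by simp
  then show ?thesis by (subst nn_integral_lborel_vec_PiM) (measurable, metis)
qed

lemma nn_integral_lborel_vec_prod: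
  assumes [measurable]: "f \<in> borel_measurable borel"
  shows "(\<integral>\<^sup>+x. (\<Prod>i\<in>UNIV. f (x $ i)) \<partial>(lborel :: ('a::euclidean_space^'o::finite) measure)) = (\<integral>\<^sup>+x. f x \<partial>lborel) ^ CARD('o)"
proof -
  interpret product_sigma_finite "\<lambda>_::'o. lborel :: 'a measure" by standard
  show ?thesis
    using product_nn_integral_prod[of UNIV "\<lambda>_. f"] by (subst nn_integral_lborel_vec_PiM) simp_all
qed

text \<open>Regrouping coordinates is a bijection of bases. It separates the base points
  \<open>y\<close> from the heights \<open>z\<close>, so that the heights can be substituted while
  \<open>y\<close> stays fixed.\<close>

lemma nn_integral_lborel_vec_Pair:
  assumes [measurable]: "f \<in> borel_measurable borel"
  shows "(\<integral>\<^sup>+x. f x \<partial>(lborel :: (('a::euclidean_space \<times> 'b::euclidean_space)^'o::finite) measure)) =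
    (\<integral>\<^sup>+y. \<integral>\<^sup>+z. f (\<chi> i. (y $ i, z $ i)) \<partial>(lborel :: ('b^'o) measure) \<partial>(lborel :: ('a^'o) measure))"
proof -
  define T :: "('a^'o) \<times> ('b^'o) \<Rightarrow> ('a \<times> 'b)^'o" where "T = (\<lambda>(y,z). \<chi> i. (y $ i, z $ i))"
  have T: "linear T"
    by (rule linearI) (auto simp: T_def vec_eq_iff)
  have [measurable]: "T \<in> borel_measurable borel"
    by (rule linear_borel_measurable[OF T])
  have ax: "T (axis i a, 0) = axis i (a, 0)" "T (0, axis i b) = axis i (0, b)" for i a b
    by (auto simp: T_def vec_eq_iff axis_def zero_prod_def)
  have bij: "bij_betw T Basis Basis"
    unfolding bij_betw_def
  proof
    show "inj_on T Basis"
      by (auto simp: inj_on_def T_def vec_eq_iff)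
    show "T ` Basis = Basis"
    proof (intro equalityI subsetI)
      fix v assume "v \<in> T ` Basis"
      then show "v \<in> Basis"
        by (auto simp: Basis_prod_def Basis_vec_def ax; blast)
    next
      fix v :: "('a \<times> 'b)^'o" assume "v \<in> Basis"
      then obtain i p where v: "v = axis i p" "p \<in> Basis" by (auto simp: Basis_vec_def)
      then consider u where "v = axis i (u, 0)" "u \<in> Basis" | u where "v = axis i (0, u)" "u \<in> Basis"
        unfolding Basis_prod_def by blast
      then show "v \<in> T ` Basis"
      proof cases
        case 1
        then have "(axis i u, 0) \<in> Basis" by (simp add: Basis_prod_def)
        then show ?thesis unfolding 1(1) ax[symmetric] by (rule imageI)
      next
        case 2
        then have "(0, axis i u) \<in> Basis" by (simp add: Basis_prod_def)
        then show ?thesis unfolding 2(1) ax[symmetric] by (rule imageI)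
      qed
    qed
  qed
  have "(\<integral>\<^sup>+x. f x \<partial>lborel) = (\<integral>\<^sup>+p. f (T p) \<partial>(lborel \<Otimes>\<^sub>M lborel))"
    unfolding lborel_prod by (rule nn_integral_lborel_Basis_bij[OF T bij]) simp
  also have "\<dots> = (\<integral>\<^sup>+y. \<integral>\<^sup>+z. f (T (y,z)) \<partial>lborel \<partial>lborel)"
    by (rule lborel.nn_integral_fst[symmetric]) (simp add: lborel_prod)
  finally show ?thesis by (simp add: T_def)
qed

text \<open>The preimage of a box under \<open>M\<close> is its image under the inverse matrix, so
  the pushforward of Lebesgue measure shrinks boxes by \<open>\<bar>det N\<bar>\<close>; the density
  \<open>\<bar>det M\<bar>\<close> restores it.\<close>

lemma nn_integral_linear_vec:
  fixes M :: "real^('o::{finite,wellorder})^'o::_"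
  assumes det: "det M \<noteq> 0" and [measurable]: "f \<in> borel_measurable borel"
  shows "(\<integral>\<^sup>+x. f x \<partial>lborel) = ennreal \<bar>det M\<bar> * (\<integral>\<^sup>+x. f (M *v x) \<partial>lborel)"
proof -
  have lin: "linear ((*v) M)" by (simp add: matrix_vector_mul_linear)
  have [measurable]: "(*v) M \<in> borel_measurable borel"
    by (rule linear_borel_measurable[OF lin])
  obtain N where N: "M ** N = mat 1" "N ** M = mat 1"
    using det invertible_det_nz[of M] by (auto simp: invertible_def)
  have NM: "N *v (M *v x) = x" "M *v (N *v x) = x" for x
    using N by (simp_all add: matrix_vector_mul_assoc)
  have "det M * det N = 1" using N(1) by (metis det_I det_mul)
  have "lborel = density (distr lborel borel ((*v) M)) (\<lambda>_. ennreal \<bar>det M\<bar>)"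
  proof (rule lborel_eqI)
    fix l u :: "(real, 'o) vec" assume lu: "\<And>b. b \<in> Basis \<Longrightarrow> l \<bullet> b \<le> u \<bullet> b"
    have vim: "(*v) M -` box l u = (*v) N ` box l u"
      using NM by (auto simp: image_iff) metis
    have meas: "(*v) M -` box l u \<in> sets borel"
      using measurable_sets[OF \<open>(*v) M \<in> borel_measurable borel\<close>, of "box l u"] by simp
    have box: "box l u \<in> lmeasurable" by simp
    have "(*v) N ` box l u \<in> lmeasurable"
      by (rule measurable_linear_image[OF _ box]) (simp add: matrix_vector_mul_linear)
    then have "emeasure lebesgue ((*v) N ` box l u) = measure lebesgue ((*v) N ` box l u)"
      by (simp add: emeasure_eq_measure2)
    also have "\<dots> = \<bar>det N\<bar> * measure lebesgue (box l u)"
      by (subst measure_linear_image[OF _ box]) (simp_all add: matrix_vector_mul_linear)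
    finally have "emeasure lborel ((*v) M -` box l u) = \<bar>det N\<bar> * (\<Prod>b\<in>Basis. (u - l) \<bullet> b)"
      using meas lu unfolding vim by (auto simp: measure_lborel_box inner_diff_left)
    then have "emeasure (density (distr lborel borel ((*v) M)) (\<lambda>_. ennreal \<bar>det M\<bar>)) (box l u)
        = ennreal \<bar>det M\<bar> * ennreal (\<bar>det N\<bar> * (\<Prod>b\<in>Basis. (u - l) \<bullet> b))"
      by (simp add: emeasure_density_const emeasure_distr)
    also have "\<dots> = ennreal (\<bar>det M * det N\<bar> * (\<Prod>b\<in>Basis. (u - l) \<bullet> b))"
      by (simp add: ennreal_mult'[symmetric] abs_mult mult_ac)
    finally show "emeasure (density (distr lborel borel ((*v) M)) (\<lambda>_. ennreal \<bar>det M\<bar>)) (box l u)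
      = ennreal (\<Prod>b\<in>Basis. (u - l) \<bullet> b)" using \<open>det M * det N = 1\<close> by simp
  qed simp
  then have "(\<integral>\<^sup>+x. f x \<partial>lborel) = (\<integral>\<^sup>+x. f x \<partial>density (distr lborel borel ((*v) M)) (\<lambda>_. ennreal \<bar>det M\<bar>))"
    by simp
  also have "\<dots> = ennreal \<bar>det M\<bar> * (\<integral>\<^sup>+x. f (M *v x) \<partial>lborel)"
    by (simp add: nn_integral_density nn_integral_distr nn_integral_cmult)
  finally show ?thesis .
qed

subsection \<open>Volumes of simplices\<close>

lemma convex_hull_Times_singleton:
  "convex hull ((\<lambda>s. (s, u::real)) ` S) = (\<lambda>s. (s, u)) ` (convex hull (S::'b::euclidean_space set))"
proof -
  have *: "(\<lambda>s. (s, u)) = (\<lambda>z. (0, u) + z) \<circ> (\<lambda>s::'b. (s, 0))" by auto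
  have "linear (\<lambda>s::'b. (s, 0::real))" by (rule linearI) auto
  then show ?thesis
    unfolding * image_comp[symmetric]
    by (simp only: convex_hull_translation convex_hull_linear_image)
qed

lemma sets_lborel_pair:
  "sets (lborel \<Otimes>\<^sub>M lborel :: ('a::euclidean_space \<times> 'b::euclidean_space) measure) = sets borel"
  by (simp only: lborel_prod sets_lborel)

text \<open>The horizontal section at relative height \<open>l\<close> is a copy of \<open>S\<close>
  scaled by \<open>1 - l\<close>. Integrating the power \<open>(1 - l) ^ DIM('b)\<close> over the
  unit interval gives the denominator.\<close>

lemma measure_cone:
  fixes S :: "'b::euclidean_space set"
  assumes S: "compact S" "convex S" "S \<noteq> {}" and tu: "t \<noteq> u"
  shows "measure lborel (convex hull (insert (q, t) ((\<lambda>s. (s, u)) ` S))) =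
    measure lborel S * \<bar>t - u\<bar> / (DIM('b) + 1)"
proof -
  let ?C = "convex hull (insert (q, t) ((\<lambda>s. (s, u)) ` S))"
  let ?m = "DIM('b)"
  \<comment> \<open>The weight of the apex in a point at height \<open>z\<close>: 0 on the base, 1
    at the apex.\<close>
  define l where "l z = (z - u) / (t - u)" for z
  have comp: "compact ((\<lambda>s. (s, u)) ` S)"
    using S(1) by (intro compact_continuous_image continuous_intros)
  have C: "?C = {x. \<exists>a\<ge>0. \<exists>v\<ge>0. \<exists>s. a + v = 1 \<and> s \<in> S \<and> x = (a *\<^sub>R q + v *\<^sub>R s, a * t + v * u)}"
    using S by (subst convex_hull_insert) (auto simp: convex_hull_Times_singleton convex_hull_eq[THEN iffD2])
  have Cc: "compact ?C" using comp by (intro compact_convex_hull compact_insert)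
  then have [measurable]: "?C \<in> sets borel" by (simp add: borel_compact)
  have slice: "(\<lambda>x. (x, z)) -` ?C = (if 0 \<le> l z \<and> l z \<le> 1 then (\<lambda>s. (1 - l z) *\<^sub>R s + l z *\<^sub>R q) ` S else {})" for z
  proof -
    have "(x, z) \<in> ?C \<longleftrightarrow> 0 \<le> l z \<and> l z \<le> 1 \<and> (\<exists>s\<in>S. x = (1 - l z) *\<^sub>R s + l z *\<^sub>R q)" for x
    proof
      assume "(x, z) \<in> ?C"
      then obtain a v s where *: "a \<ge> 0" "v \<ge> 0" "a + v = 1" "s \<in> S" "x = a *\<^sub>R q + v *\<^sub>R s" "z = a * t + v * u"
        unfolding C by blast
      have v: "v = 1 - a" using * by simp
      have "l z = a" using tu unfolding l_def * v by (simp add: field_simps)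
      then show "0 \<le> l z \<and> l z \<le> 1 \<and> (\<exists>s\<in>S. x = (1 - l z) *\<^sub>R s + l z *\<^sub>R q)"
        using * v by (auto simp: add.commute)
    next
      assume *: "0 \<le> l z \<and> l z \<le> 1 \<and> (\<exists>s\<in>S. x = (1 - l z) *\<^sub>R s + l z *\<^sub>R q)"
      then obtain s where s: "s \<in> S" "x = (1 - l z) *\<^sub>R s + l z *\<^sub>R q" by auto
      have "z = l z * t + (1 - l z) * u" using tu by (simp add: l_def divide_simps) (simp add: algebra_simps)
      then have "0 \<le> l z \<and> 0 \<le> 1 - l z \<and> l z + (1 - l z) = 1 \<and> s \<in> S \<and>
          (x, z) = (l z *\<^sub>R q + (1 - l z) *\<^sub>R s, l z * t + (1 - l z) * u)"
        using * s by (simp add: add.commute)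
      then show "(x, z) \<in> ?C" unfolding C by blast
    qed
    then show ?thesis by auto
  qed
  have Sf: "emeasure lborel S = ennreal (measure lborel S)"
    using S(1) emeasure_compact_finite[of S] by (simp add: emeasure_eq_ennreal_measure)
  have sm: "emeasure lborel ((\<lambda>x. (x, z)) -` ?C) =
     ennreal (measure lborel S * ((1 - l z) ^ ?m * indicator {0..1} (l z)))" for z
  proof (cases "0 \<le> l z \<and> l z \<le> 1")
    case True
    let ?I = "(\<lambda>s. (1 - l z) *\<^sub>R s + l z *\<^sub>R q) ` S"
    have "compact ?I" using S(1) by (intro compact_continuous_image continuous_intros)
    then have "emeasure lborel ?I = emeasure lebesgue ?I" by (simp add: borel_compact)
    also have "\<dots> = \<bar>1 - l z\<bar> ^ ?m * emeasure lebesgue S"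
      using emeasure_lebesgue_affine[of "1 - l z" "l z *\<^sub>R q" S] by (simp)
    also have "emeasure lebesgue S = emeasure lborel S" using S(1) by (simp add: borel_compact)
    finally show ?thesis using True unfolding slice Sf
      by (simp add: ennreal_mult''[symmetric] mult.commute)
  qed (auto simp: slice)
  have "emeasure lborel ?C = (\<integral>\<^sup>+z. emeasure lborel ((\<lambda>x. (x, z)) -` ?C) \<partial>lborel)"
    unfolding lborel_prod[symmetric]
    by (rule lborel_pair.emeasure_pair_measure_alt2) (simp only: sets_lborel_pair, measurable)
  also have "\<dots> = (\<integral>\<^sup>+z. ennreal (measure lborel S * ((1 - l z) ^ ?m * indicator {0..1} (l z))) \<partial>lborel)"
    by (simp only: sm)
  also have "\<dots> = ennreal \<bar>t - u\<bar> * (\<integral>\<^sup>+z. ennreal (measure lborel S * ((1 - l (u + (t - u) * z)) ^ ?m * indicator {0..1} (l (u + (t - u) * z)))) \<partial>lborel)"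
    using tu unfolding l_def by (subst nn_integral_real_affine[where c="t - u" and t=u]) auto
  also have "(\<lambda>z. l (u + (t - u) * z)) = (\<lambda>z. z)" using tu by (auto simp: l_def)
  then have "(\<integral>\<^sup>+z. ennreal (measure lborel S * ((1 - l (u + (t - u) * z)) ^ ?m * indicator {0..1} (l (u + (t - u) * z)))) \<partial>lborel)
    = (\<integral>\<^sup>+z. ennreal (measure lborel S * ((1 - z) ^ ?m * indicator {0..1} z)) \<partial>lborel)" by (metis (no_types))
  also have "\<dots> = (\<integral>\<^sup>+z. ennreal (measure lborel S) * (ennreal ((1 - z) ^ ?m) * indicator {0..1} z) \<partial>lborel)"
    by (intro nn_integral_cong) (auto simp: ennreal_mult' split: split_indicator)
  also have "\<dots> = ennreal (measure lborel S) * (\<integral>\<^sup>+z. ennreal ((1 - z) ^ ?m) * indicator {0..1} z \<partial>lborel)"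
    by (rule nn_integral_cmult) auto
  also have "(\<integral>\<^sup>+z. ennreal ((1 - z) ^ ?m) * indicator {0..1} z \<partial>lborel) = ennreal (- ((1 - 1) ^ (?m + 1)) / (?m + 1) - - ((1 - 0) ^ (?m + 1)) / (?m + 1))"
  proof (rule nn_integral_FTC_Icc)
    fix x :: real assume "x \<in> {0..1}"
    show "((\<lambda>x. - ((1 - x) ^ (?m + 1)) / real (?m + 1)) has_real_derivative (1 - x) ^ ?m) (at x)"
      by (rule derivative_eq_intros refl | simp del: of_nat_Suc)+
  qed auto
  finally have "emeasure lborel ?C = ennreal (measure lborel S * \<bar>t - u\<bar> / (?m + 1))"
    by (simp add: ennreal_mult'[symmetric] ennreal_mult''[symmetric] mult_ac)
  then show ?thesis by (simp add: measure_def enn2real_mult)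
qed

text \<open>On every vertical line the shear is only a translation.\<close>

lemma emeasure_lborel_shear:
  fixes C :: "('b::euclidean_space \<times> real) set"
  assumes [measurable]: "C \<in> sets borel"
  shows "emeasure lborel {p. (fst p, snd p + a \<bullet> fst p) \<in> C} = emeasure lborel C"
proof -
  have [measurable]: "{p. (fst p, snd p + a \<bullet> fst p) \<in> C} \<in> sets (borel :: ('b \<times> real) measure)"
    by measurable
  have tr: "emeasure lborel {z. z + r \<in> D} = emeasure lborel D" if [measurable]: "D \<in> sets borel" for D and r :: real
  proof -
    have "emeasure lborel D = emeasure (distr lborel borel ((+) r)) D" by (simp add: lborel_distr_plus)
    also have "\<dots> = emeasure lborel {z. z + r \<in> D}"
      by (subst emeasure_distr) (auto simp: vimage_def add.commute)
    finally show ?thesis by simp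
  qed
  have "emeasure lborel {p. (fst p, snd p + a \<bullet> fst p) \<in> C} =
    (\<integral>\<^sup>+x. emeasure lborel (Pair x -` {p. (fst p, snd p + a \<bullet> fst p) \<in> C}) \<partial>lborel)"
    unfolding lborel_prod[symmetric] by (rule lborel.emeasure_pair_measure_alt) (simp only: sets_lborel_pair, measurable)
  also have "\<dots> = (\<integral>\<^sup>+x. emeasure lborel (Pair x -` C) \<partial>lborel)"
  proof (rule nn_integral_cong)
    fix x
    have "Pair x -` C \<in> sets borel" 
      by (metis assms sets_Pair1 sets_lborel sets_lborel_pair)
    then show "emeasure lborel (Pair x -` {p. (fst p, snd p + a \<bullet> fst p) \<in> C}) = emeasure lborel (Pair x -` C)"
      using tr[of "Pair x -` C" "a \<bullet> x"] by (simp add: vimage_def)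
  qed
  also have "\<dots> = emeasure lborel C"
    unfolding lborel_prod[symmetric] by (rule lborel.emeasure_pair_measure_alt[symmetric]) (simp only: sets_lborel_pair, measurable)
  finally show ?thesis .
qed

text \<open>Shearing by the slope \<open>a\<close> turns the face over the graph into a horizontal
  copy of its projection at height \<open>b\<close>. What remains is a cone whose height is the
  vertical distance of the apex from the hyperplane.\<close>

lemma measure_simplex_over_graph:
  fixes y :: "'o::finite \<Rightarrow> 'b::euclidean_space"
  shows "measure lborel (convex hull (insert (h, z) (range (\<lambda>i. (y i, a \<bullet> y i + b))))) =
    measure lborel (convex hull (range y)) * \<bar>z - (a \<bullet> h + b)\<bar> / (DIM('b) + 1)"
proof -
  let ?C = "convex hull (insert (h, z) (range (\<lambda>i. (y i, a \<bullet> y i + b))))"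
  define \<Phi> where "\<Phi> p = (fst p, snd p - a \<bullet> fst p)" for p :: "'b \<times> real"
  have lin: "linear \<Phi>" by (rule linearI) (auto simp: \<Phi>_def inner_add_right algebra_simps)
  have Cc: "compact ?C" by (intro finite_imp_compact_convex_hull) auto
  have im: "{p. (fst p, snd p + a \<bullet> fst p) \<in> ?C} = \<Phi> ` ?C"
    by (force simp: \<Phi>_def image_iff)
  have "measure lborel ?C = measure lborel (\<Phi> ` ?C)"
    using emeasure_lborel_shear[of ?C a] Cc unfolding im measure_def by (simp add: borel_compact)
  also have "\<Phi> ` ?C = convex hull (insert (h, z - a \<bullet> h) (range (\<lambda>i. (y i, b))))"
    by (subst convex_hull_linear_image[OF lin]) (simp add: image_image \<Phi>_def)
  also have "\<dots> = convex hull (insert (h, z - a \<bullet> h) ((\<lambda>s. (s, b)) ` (convex hull (range y))))"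
    using hull_insert[of convex "(h, z - a \<bullet> h)" "range (\<lambda>i. (y i, b))"]
      convex_hull_Times_singleton[of b "range y"] by (simp add: image_image)
  also have "measure lborel \<dots> = measure lborel (convex hull (range y)) * \<bar>z - (a \<bullet> h + b)\<bar> / (DIM('b) + 1)"
  proof (cases "z - a \<bullet> h = b")
    \<comment> \<open>The apex lies in the hyperplane, where the cone formula does not apply; the
      hull is then contained in a horizontal null set.\<close>
    case True
    have "convex hull (insert (h, z - a \<bullet> h) ((\<lambda>s. (s, b)) ` (convex hull (range y)))) \<subseteq> UNIV \<times> {b}"
      using True by (intro hull_minimal) (auto intro: convex_Times)
    moreover have "UNIV \<times> {b} \<in> null_sets (lborel :: ('b \<times> real) measure)"
      unfolding lborel_prod[symmetric]
      by (rule null_sets_def[THEN eq_reflection, unfolded atomize_eq, THEN equalityD2, THEN subsetD])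
        (simp add: lborel.emeasure_pair_measure_Times)
    moreover have "compact (convex hull (insert (h, z - a \<bullet> h) ((\<lambda>s. (s, b)) ` (convex hull (range y)))))"
      by (intro compact_convex_hull compact_insert compact_continuous_image continuous_intros finite_imp_compact_convex_hull) auto
    ultimately have "measure lborel (convex hull (insert (h, z - a \<bullet> h) ((\<lambda>s. (s, b)) ` (convex hull (range y))))) = 0"
      by (metis (no_types, lifting) borel_compact measure_eq_0_null_sets null_sets_subset sets_lborel)
    then show ?thesis using True by simp
  next
    case False
    then show ?thesis
      by (subst measure_cone) (auto simp: finite_imp_compact_convex_hull algebra_simps)
  qed
  finally show ?thesis .
qed

text \<open>The volume of the cone from the origin over the simplex lifted to height 1 is computed
  twice: as a cone it is the base divided by \<open>DIM('b) + 1\<close>, as a full-dimensional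
  simplex it is a determinant divided by \<open>fact (DIM('b) + 1)\<close>.\<close>

lemma measure_simplex_det:
  fixes y :: "'o::{finite,wellorder} \<Rightarrow> 'b::euclidean_space" and T :: "'b \<times> real \<Rightarrow> (real, 'o) vec"
  assumes T: "linear T" "bij_betw T Basis Basis" and card: "CARD('o) = DIM('b) + 1"
    and inj: "inj y"
  shows "measure lborel (convex hull (range y)) = \<bar>det (\<chi> i. T (y i, 1))\<bar> / fact DIM('b)"
proof -
  let ?C = "convex hull (insert (0, 0) ((\<lambda>s. (s, 1::real)) ` (convex hull (range y))))"
  have C: "?C = convex hull (insert (0, 0) (range (\<lambda>i. (y i, 1))))"
    using hull_insert[of convex "(0, 0)" "range (\<lambda>i. (y i, 1::real))"]
      convex_hull_Times_singleton[of 1 "range y"] by (simp add: image_image)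
  have Tinj: "inj T"
  proof (rule injI)
    fix p q assume "T p = T q"
    then have "T (p - q) \<bullet> T (p - q) = 0" by (simp add: linear_diff[OF T(1)])
    then show "p = q" by (simp add: inner_Basis_bij[OF T])
  qed
  have T0: "T p = 0 \<longleftrightarrow> p = 0" for p using Tinj linear_0[OF T(1)] by (metis injD)
  let ?X = "insert 0 (range (\<lambda>i. T (y i, 1)))"
  have "measure lborel (convex hull (range y)) / (DIM('b) + 1) = measure lborel ?C"
    by (subst measure_cone) (auto simp: finite_imp_compact_convex_hull)
  also have "\<dots> = measure lborel (T ` ?C)"
    by (rule measure_lborel_Basis_bij_image[OF T, symmetric]) (auto simp: C finite_imp_compact_convex_hull)
  also have "T ` ?C = convex hull ?X"
    unfolding C by (subst convex_hull_linear_image[OF T(1)])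
      (simp add: image_image linear_0[OF T(1)] zero_prod_def[symmetric])
  also have "measure lborel (convex hull ?X) = \<bar>det (\<chi> i. \<chi> j. T (y j, 1) $ i - 0 $ i)\<bar> / fact (CARD('o))"
  proof (rule content_simplex)
    have i: "inj (\<lambda>i. T (y i, 1))" using Tinj inj by (auto simp: inj_on_def)
    have n: "0 \<notin> range (\<lambda>i. T (y i, 1))" by (auto simp: T0 zero_prod_def eq_commute[of 0])
    show "card ?X = Suc CARD('o)" using i n by (simp add: card_image)
    show "bij_betw (\<lambda>i. T (y i, 1)) UNIV (?X - {0})" using i n by (auto simp: bij_betw_def)
  qed auto
  also have "(\<chi> i. \<chi> j. T (y j, 1) $ i - 0 $ i) = transpose (\<chi> i. T (y i, 1))"
    by (simp add: transpose_def vec_eq_iff)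
  finally have "measure lborel (convex hull (range y)) / (DIM('b) + 1) =
      \<bar>det (\<chi> i. T (y i, 1))\<bar> / fact DIM('b) / (DIM('b) + 1)"
    by (simp add: card det_transpose mult.commute)
  then show ?thesis by (subst (asm) divide_cancel_right) auto
qed

text \<open>For fixed base points the heights depend linearly on the hyperplane
  \<open>c = (a, t)\<close>, through the matrix with rows \<open>(y $ i, 1)\<close>.
  \<open>T\<close> flattens these rows, and \<open>c\<close> itself, into vectors over
  \<open>'o\<close>, which makes the matrix square.\<close>

lemma nn_integral_heights_eq_hyperplanes:
  fixes y :: "(('b::euclidean_space), 'o::{finite,wellorder}) vec" and T :: "'b \<times> real \<Rightarrow> (real, 'o) vec"
  assumes T: "linear T" "bij_betw T Basis Basis" and det: "det (\<chi> i. T (y $ i, 1)) \<noteq> 0"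
    and [measurable]: "f \<in> borel_measurable borel"
  shows "(\<integral>\<^sup>+z. f z \<partial>lborel) =
    ennreal \<bar>det (\<chi> i. T (y $ i, 1))\<bar> * (\<integral>\<^sup>+c. f (\<chi> i. fst c \<bullet> y $ i + snd c) \<partial>lborel)"
proof -
  have "(\<lambda>c. (\<chi> i. T (y $ i, 1)) *v c) \<in> borel_measurable borel"
    by (intro borel_measurable_continuous_onI linear_continuous_on linear_conv_bounded_linear[THEN iffD1]) simp
  note [measurable] = this
  have "(\<integral>\<^sup>+z. f z \<partial>lborel) = ennreal \<bar>det (\<chi> i. T (y $ i, 1))\<bar> * (\<integral>\<^sup>+c. f ((\<chi> i. T (y $ i, 1)) *v c) \<partial>lborel)"
    by (rule nn_integral_linear_vec[OF det]) simp
  also have "(\<integral>\<^sup>+c. f ((\<chi> i. T (y $ i, 1)) *v c) \<partial>lborel) = (\<integral>\<^sup>+c. f ((\<chi> i. T (y $ i, 1)) *v T c) \<partial>lborel)"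
    by (rule nn_integral_lborel_Basis_bij[OF T]) simp
  also have "(\<lambda>c. (\<chi> i. T (y $ i, 1)) *v T c) = (\<lambda>c. \<chi> i. fst c \<bullet> y $ i + snd c)"
  proof (intro ext, subst vec_eq_iff, intro allI)
    fix c i
    have "((\<chi> i. T (y $ i, 1)) *v T c) $ i = T (y $ i, 1) \<bullet> T c"
      by (simp add: matrix_vector_mult_def inner_vec_def)
    then show "((\<chi> i. T (y $ i, 1)) *v T c) $ i = (\<chi> i. fst c \<bullet> y $ i + snd c) $ i"
      by (simp add: inner_Basis_bij[OF T] inner_prod_def inner_commute)
  qed
  finally show ?thesis .
qed

lemma affine_sum_mem:
  fixes f :: "'i \<Rightarrow> 'a::real_vector"
  assumes "affine A" "finite I" "\<And>i. i \<in> I \<Longrightarrow> f i \<in> A" "sum w I = 1"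
  shows "(\<Sum>i\<in>I. w i *\<^sub>R f i) \<in> A"
proof -
  have "I \<noteq> {}" using assms(4) by auto
  then obtain a where a: "a \<in> A" using assms(3) by auto
  have sub: "subspace ((\<lambda>x. x - a) ` A)" by (rule affine_diffs_subspace_subtract[OF assms(1) a])
  have "(\<Sum>i\<in>I. w i *\<^sub>R (f i - a)) \<in> (\<lambda>x. x - a) ` A"
    using assms(3) by (intro subspace_sum[OF sub] subspace_scale[OF sub]) auto
  moreover have "(\<Sum>i\<in>I. w i *\<^sub>R (f i - a)) = (\<Sum>i\<in>I. w i *\<^sub>R f i) - a"
    using assms(4) by (simp add: scaleR_diff_right sum_subtractf scaleR_sum_left[symmetric])
  ultimately show ?thesis by auto
qed

text \<open>A linear relation between the rows \<open>(y i, 1)\<close> is an affine relation between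
  the points, since the last entry forces the coefficients to sum to zero. It can be solved for any
  point with nonzero coefficient.\<close>

lemma det_zero_imp_affine_hull:
  fixes y :: "'o::finite \<Rightarrow> 'b::euclidean_space" and T :: "'b \<times> real \<Rightarrow> (real, 'o) vec"
  assumes T: "linear T" "bij_betw T Basis Basis" and det: "det (\<chi> i. T (y i, 1)) = 0"
  shows "\<exists>i. y i \<in> affine hull (y ` (- {i}))"
proof -
  have "\<not> invertible (transpose (\<chi> i. T (y i, 1)))"
    using det by (simp add: invertible_det_nz det_transpose)
  then have "\<nexists>B. B ** transpose (\<chi> i. T (y i, 1)) = mat 1"
    by (metis invertible_left_inverse)
  then obtain v where v: "transpose (\<chi> i. T (y i, 1)) *v v = 0" "v \<noteq> 0"
    unfolding matrix_left_invertible_ker by auto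
  have "transpose (\<chi> i. T (y i, 1)) *v v = (\<Sum>i\<in>UNIV. (v $ i) *\<^sub>R T (y i, 1))"
    by (simp add: vec_eq_iff matrix_vector_mult_def transpose_def mult.commute)
  also have "\<dots> = T (\<Sum>i\<in>UNIV. (v $ i) *\<^sub>R (y i, 1))"
    by (simp only: linear_sum[OF T(1)] linear_cmul[OF T(1)])
  finally have "T (\<Sum>i\<in>UNIV. (v $ i) *\<^sub>R (y i, 1)) \<bullet> T (\<Sum>i\<in>UNIV. (v $ i) *\<^sub>R (y i, 1)) = 0" using v by simp
  then have "(\<Sum>i\<in>UNIV. (v $ i) *\<^sub>R (y i, 1::real)) = 0" by (simp only: inner_Basis_bij[OF T] inner_eq_zero_iff)
  then have s: "(\<Sum>i\<in>UNIV. (v $ i) *\<^sub>R y i) = 0" "(\<Sum>i\<in>UNIV. v $ i) = 0"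
    by (simp_all add: prod_eq_iff fst_sum snd_sum)
  obtain i where i: "v $ i \<noteq> 0" using v(2) by (auto simp: vec_eq_iff)
  have U: "(UNIV :: 'o set) = insert i (- {i})" by auto
  define w where "w j = - v $ j / v $ i" for j
  have "(\<Sum>j\<in>-{i}. v $ j) = - v $ i" using s(2) by (subst (asm) U) (simp add: eq_neg_iff_add_eq_0 add.commute)
  then have w1: "sum w (- {i}) = 1" using i by (simp add: w_def sum_divide_distrib[symmetric] sum_negf)
  have "(\<Sum>j\<in>-{i}. (v $ j) *\<^sub>R y j) = - (v $ i) *\<^sub>R y i"
    using s(1) by (subst (asm) U) (simp add: eq_neg_iff_add_eq_0 add.commute)
  then have "(- 1 / v $ i) *\<^sub>R (\<Sum>j\<in>-{i}. (v $ j) *\<^sub>R y j) = y i" using i by simp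
  then have "(\<Sum>j\<in>-{i}. w j *\<^sub>R y j) = y i"
    unfolding scaleR_sum_right by (simp add: w_def)
  moreover have "(\<Sum>j\<in>-{i}. w j *\<^sub>R y j) \<in> affine hull (y ` (- {i}))"
    using w1 by (intro affine_sum_mem) (auto intro: hull_inc)
  ultimately show ?thesis by metis
qed

subsection \<open>Measurability and general position\<close>

text \<open>A direction that strictly separates \<open>p\<close> from finitely many points may be
  perturbed, so a dense set of directions detects non-membership. With \<open>D\<close> countable,
  membership becomes a countable combination of measurable conditions.\<close>

lemma mem_convex_hull_iff_dense:
  fixes F :: "'i \<Rightarrow> 'a::euclidean_space"
  assumes I: "finite I" and D: "\<And>X. open X \<Longrightarrow> X \<noteq> {} \<Longrightarrow> \<exists>d\<in>D. d \<in> X"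
  shows "p \<in> convex hull (F ` I) \<longleftrightarrow> (\<forall>u\<in>D. \<exists>i\<in>I. u \<bullet> p \<le> u \<bullet> F i)"
proof
  assume p: "p \<in> convex hull (F ` I)"
  show "\<forall>u\<in>D. \<exists>i\<in>I. u \<bullet> p \<le> u \<bullet> F i"
  proof (intro ballI, rule ccontr)
    fix u assume "\<not> (\<exists>i\<in>I. u \<bullet> p \<le> u \<bullet> F i)"
    then have "F ` I \<subseteq> {x. u \<bullet> x < u \<bullet> p}" by auto
    then have "convex hull (F ` I) \<subseteq> {x. u \<bullet> x < u \<bullet> p}"
      by (intro hull_minimal convex_halfspace_lt)
    then show False using p by auto
  qed
next
  assume *: "\<forall>u\<in>D. \<exists>i\<in>I. u \<bullet> p \<le> u \<bullet> F i"
  show "p \<in> convex hull (F ` I)"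
  proof (rule ccontr)
    assume "p \<notin> convex hull (F ` I)"
    moreover have "closed (convex hull (F ` I))"
      using I by (intro compact_imp_closed finite_imp_compact_convex_hull) auto
    ultimately obtain a b where ab: "a \<bullet> p < b" "\<And>x. x \<in> convex hull (F ` I) \<Longrightarrow> a \<bullet> x > b"
      using separating_hyperplane_closed_point[of "convex hull (F ` I)" p] convex_convex_hull by blast
    let ?X = "\<Inter>i\<in>I. {u. u \<bullet> F i < u \<bullet> p}"
    have "open ?X" using I by (intro open_INT ballI open_Collect_less continuous_intros)
    \<comment> \<open>The separating functional is smaller at \<open>p\<close> than on the hull,
      while \<open>?X\<close> asks for the opposite order.\<close>
    moreover have "- a \<in> ?X"
      using ab by (auto intro: less_trans hull_inc)
    ultimately obtain d where "d \<in> D" "d \<in> ?X" using D by blast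
    then show False using * by fastforce
  qed
qed

text \<open>The part of a ball outside a closed set is open, so it would contain a point of the
  dense set if it were nonempty.\<close>

lemma mem_interior_iff_dense:
  fixes C :: "'a::euclidean_space set"
  assumes C: "closed C" and D: "\<And>X. open X \<Longrightarrow> X \<noteq> {} \<Longrightarrow> \<exists>d\<in>D. d \<in> X"
  shows "p \<in> interior C \<longleftrightarrow> (\<exists>n::nat. \<forall>q\<in>D. norm q < 1 / real (Suc n) \<longrightarrow> p + q \<in> C)"
proof
  assume "p \<in> interior C"
  then obtain e where e: "e > 0" "ball p e \<subseteq> C" by (auto simp: mem_interior)
  obtain n where n: "1 / real (Suc n) < e" using e(1) nat_approx_posE by blast
  have "p + q \<in> C" if "norm q < 1 / real (Suc n)" for q
    using that n e(2) by (auto simp: subset_iff dist_norm)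
  then show "\<exists>n::nat. \<forall>q\<in>D. norm q < 1 / real (Suc n) \<longrightarrow> p + q \<in> C" by blast
next
  assume "\<exists>n::nat. \<forall>q\<in>D. norm q < 1 / real (Suc n) \<longrightarrow> p + q \<in> C"
  then obtain n :: nat where n: "\<And>q. q \<in> D \<Longrightarrow> norm q < 1 / real (Suc n) \<Longrightarrow> p + q \<in> C" by blast
  have "ball p (1 / real (Suc n)) \<subseteq> C"
  proof (rule ccontr)
    assume "\<not> ball p (1 / real (Suc n)) \<subseteq> C"
    then obtain x where x: "x \<in> ball p (1 / real (Suc n)) - C" by blast
    let ?X = "(\<lambda>q. p + q) -` (ball p (1 / real (Suc n)) - C)"
    have "open ?X" using C by (intro open_vimage open_Diff continuous_intros) auto
    moreover have "x - p \<in> ?X" using x by auto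
    ultimately obtain q where "q \<in> D" "q \<in> ?X" using D by blast
    then show False using n[of q] by (auto simp: dist_norm)
  qed
  then show "p \<in> interior C" by (meson centre_in_ball interior_maximal open_ball subsetD zero_less_divide_1_iff of_nat_0_less_iff zero_less_Suc)
qed

text \<open>Affine hulls are closed, so approximation by rational weights decides membership.
  Subtracting \<open>F i0\<close> frees the weights from the condition of summing to 1, and
  extensionality makes the set of weight functions countable.\<close>

lemma mem_affine_hull_iff_rational:
  fixes F :: "'i \<Rightarrow> 'a::euclidean_space"
  assumes I: "finite I" "i0 \<in> I"
  shows "p \<in> affine hull (F ` I) \<longleftrightarrow>
    (\<forall>n::nat. \<exists>w\<in>I \<rightarrow>\<^sub>E \<rat>. norm (p - F i0 - (\<Sum>i\<in>I. w i *\<^sub>R (F i - F i0))) < 1 / real (Suc n))"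
    (is "_ \<longleftrightarrow> ?R")
proof
  let ?A = "affine hull (F ` I)"
  have F0: "F i0 \<in> ?A" using I by (auto intro: hull_inc)
  have sub: "subspace ((\<lambda>x. x - F i0) ` ?A)" by (rule affine_diffs_subspace_subtract[OF _ F0]) simp
  have mem: "F i0 + (\<Sum>i\<in>I. w i *\<^sub>R (F i - F i0)) \<in> ?A" for w
  proof -
    have "(\<Sum>i\<in>I. w i *\<^sub>R (F i - F i0)) \<in> (\<lambda>x. x - F i0) ` ?A"
      by (intro subspace_sum[OF sub] subspace_scale[OF sub]) (auto intro: hull_inc)
    then show ?thesis by auto
  qed
  {
    assume R: ?R
    have "p \<in> closure ?A"
      unfolding closure_approachable
    proof (intro allI impI)
      fix e :: real assume "e > 0"
      then obtain n where n: "1 / real (Suc n) < e" using nat_approx_posE by blast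
      then obtain w where "norm (p - F i0 - (\<Sum>i\<in>I. w i *\<^sub>R (F i - F i0))) < 1 / real (Suc n)" using R by blast
      then show "\<exists>y\<in>?A. dist y p < e"
        using n by (intro bexI[OF _ mem[of w]]) (simp add: dist_norm norm_minus_commute algebra_simps)
    qed
    then show "p \<in> ?A" by simp
  }
  assume "p \<in> ?A"
  have "?A = {y. \<exists>u. sum u (F ` I) = 1 \<and> (\<Sum>v\<in>F ` I. u v *\<^sub>R v) = y}"
    using I by (intro affine_hull_finite) simp
  then obtain u where u: "sum u (F ` I) = 1" "(\<Sum>v\<in>F ` I. u v *\<^sub>R v) = p" using \<open>p \<in> ?A\<close> by blast
  \<comment> \<open>The weights \<open>u\<close> belong to points, not to indices; as
    \<open>F\<close> may repeat points, one index is chosen for each.\<close>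
  define s where "s v = (SOME i. i \<in> I \<and> F i = v)" for v
  have s: "s v \<in> I" "F (s v) = v" if "v \<in> F ` I" for v
    using that someI_ex[of "\<lambda>i. i \<in> I \<and> F i = v"] by (auto simp: s_def)
  have sinj: "inj_on s (F ` I)" by (metis inj_onI s(2))
  define w where "w i = (if i \<in> s ` F ` I then u (F i) else 0)" for i
  have "(\<Sum>i\<in>I. w i *\<^sub>R (F i - F i0)) = (\<Sum>i\<in>s ` F ` I. u (F i) *\<^sub>R (F i - F i0))"
    using I s by (intro sum.mono_neutral_cong_right) (auto simp: w_def)
  also have "\<dots> = (\<Sum>v\<in>F ` I. u v *\<^sub>R (v - F i0))"
    using s by (subst sum.reindex[OF sinj]) (auto intro!: sum.cong)
  also have "\<dots> = p - F i0"
    using u by (simp add: scaleR_diff_right sum_subtractf scaleR_sum_left[symmetric])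
  finally have w: "p - F i0 = (\<Sum>i\<in>I. w i *\<^sub>R (F i - F i0))" by simp
  show ?R
  proof
    fix n :: nat
    \<comment> \<open>A rounding error below \<open>e\<close> in every weight moves the sum by less
      than \<open>1 / Suc n\<close>; the added 1 keeps the denominator positive when all points
      coincide.\<close>
    define e where "e = 1 / real (Suc n) / (1 + (\<Sum>i\<in>I. norm (F i - F i0)))"
    have S: "0 \<le> (\<Sum>i\<in>I. norm (F i - F i0))" by (simp add: sum_nonneg)
    then have e: "e > 0" by (simp add: e_def)
    have "\<exists>r\<in>\<rat>. \<bar>w i - r\<bar> < e" for i
      using Rats_dense_in_real[of "w i - e" "w i"] e by (auto intro!: bexI)
    then obtain r where r: "\<And>i. r i \<in> \<rat>" "\<And>i. \<bar>w i - r i\<bar> < e" by metis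
    have "norm (p - F i0 - (\<Sum>i\<in>I. restrict r I i *\<^sub>R (F i - F i0))) = norm (\<Sum>i\<in>I. (w i - r i) *\<^sub>R (F i - F i0))"
      unfolding w by (simp add: sum_subtractf scaleR_diff_left)
    also have "\<dots> \<le> (\<Sum>i\<in>I. e * norm (F i - F i0))"
      using r(2) by (intro sum_norm_le) (auto intro!: mult_right_mono simp: less_imp_le)
    also have "\<dots> = e * (\<Sum>i\<in>I. norm (F i - F i0))" by (simp add: sum_distrib_left)
    also have "\<dots> < e * (1 + (\<Sum>i\<in>I. norm (F i - F i0)))" using e by simp
    also have "\<dots> = 1 / real (Suc n)" using S by (simp add: e_def add_nonneg_eq_0_iff)
    finally show "\<exists>w\<in>I \<rightarrow>\<^sub>E \<rat>. norm (p - F i0 - (\<Sum>i\<in>I. w i *\<^sub>R (F i - F i0))) < 1 / real (Suc n)"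
      using r(1) by (intro bexI[of _ "restrict r I"]) auto
  qed
qed

lemma pred_countable_ball:
  assumes "countable X" "\<And>i. i \<in> X \<Longrightarrow> Measurable.pred M (P i)"
  shows "Measurable.pred M (\<lambda>\<omega>. \<forall>i\<in>X. P i \<omega>)" "Measurable.pred M (\<lambda>\<omega>. \<exists>i\<in>X. P i \<omega>)"
proof -
  have [measurable]: "Measurable.pred M (P (from_nat_into X n))" if "X \<noteq> {}" for n
    using that assms(2) from_nat_into by metis
  have "Measurable.pred M (\<lambda>\<omega>. \<forall>n. P (from_nat_into X n) \<omega>)" "Measurable.pred M (\<lambda>\<omega>. \<exists>n. P (from_nat_into X n) \<omega>)"
    if "X \<noteq> {}" using that by measurable
  moreover have "(\<forall>i\<in>X. Q i) \<longleftrightarrow> (\<forall>n. Q (from_nat_into X n))" "(\<exists>i\<in>X. Q i) \<longleftrightarrow> (\<exists>n. Q (from_nat_into X n))"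
    if "X \<noteq> {}" for Q
    using range_from_nat_into[OF that assms(1)] by (metis rangeE rangeI)+
  ultimately show "Measurable.pred M (\<lambda>\<omega>. \<forall>i\<in>X. P i \<omega>)" "Measurable.pred M (\<lambda>\<omega>. \<exists>i\<in>X. P i \<omega>)"
    by (cases "X = {}"; simp)+
qed

lemma pred_mem_convex_hull:
  fixes F :: "'i \<Rightarrow> 'w \<Rightarrow> 'a::euclidean_space"
  assumes I: "finite I" and [measurable]: "\<And>i. i \<in> I \<Longrightarrow> F i \<in> borel_measurable M" "p \<in> borel_measurable M"
  shows "Measurable.pred M (\<lambda>\<omega>. p \<omega> \<in> convex hull ((\<lambda>i. F i \<omega>) ` I))"
proof -
  obtain D :: "'a set" where D: "countable D" "\<And>X. open X \<Longrightarrow> X \<noteq> {} \<Longrightarrow> \<exists>d\<in>D. d \<in> X"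
    using countable_dense_setE by metis
  note [measurable] = I D(1)
  have [measurable]: "Measurable.pred M (\<lambda>\<omega>. \<exists>i\<in>I. u \<bullet> p \<omega> \<le> u \<bullet> F i \<omega>)" for u
    using I by (intro pred_intros_finite) measurable
  have "Measurable.pred M (\<lambda>\<omega>. \<forall>u\<in>D. \<exists>i\<in>I. u \<bullet> p \<omega> \<le> u \<bullet> F i \<omega>)"
    using D(1) by (intro pred_countable_ball(1)) auto
  moreover have "p \<omega> \<in> convex hull ((\<lambda>i. F i \<omega>) ` I) \<longleftrightarrow> (\<forall>u\<in>D. \<exists>i\<in>I. u \<bullet> p \<omega> \<le> u \<bullet> F i \<omega>)" for \<omega>
    by (rule mem_convex_hull_iff_dense[OF I D(2)])
  ultimately show ?thesis by presburger
qed

lemma pred_mem_interior_convex_hull: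
  fixes F :: "'i \<Rightarrow> 'w \<Rightarrow> 'a::euclidean_space"
  assumes I: "finite I" and [measurable]: "\<And>i. i \<in> I \<Longrightarrow> F i \<in> borel_measurable M" "p \<in> borel_measurable M"
  shows "Measurable.pred M (\<lambda>\<omega>. p \<omega> \<in> interior (convex hull ((\<lambda>i. F i \<omega>) ` I)))"
proof -
  obtain D :: "'a set" where D: "countable D" "\<And>X. open X \<Longrightarrow> X \<noteq> {} \<Longrightarrow> \<exists>d\<in>D. d \<in> X"
    using countable_dense_setE by metis
  have cl: "closed (convex hull ((\<lambda>i. F i \<omega>) ` I))" for \<omega>
    using I by (intro compact_imp_closed finite_imp_compact_convex_hull) auto
  have [measurable]: "Measurable.pred M (\<lambda>\<omega>. p \<omega> + q \<in> convex hull ((\<lambda>i. F i \<omega>) ` I))" for q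
    using I by (intro pred_mem_convex_hull) measurable
  have "Measurable.pred M (\<lambda>\<omega>. \<exists>n::nat. \<forall>q\<in>D. norm q < 1 / real (Suc n) \<longrightarrow> p \<omega> + q \<in> convex hull ((\<lambda>i. F i \<omega>) ` I))"
    using D(1) by (intro pred_intros_countable pred_countable_ball) measurable
  moreover have "p \<omega> \<in> interior (convex hull ((\<lambda>i. F i \<omega>) ` I)) \<longleftrightarrow>
      (\<exists>n::nat. \<forall>q\<in>D. norm q < 1 / real (Suc n) \<longrightarrow> p \<omega> + q \<in> convex hull ((\<lambda>i. F i \<omega>) ` I))" for \<omega>
    by (rule mem_interior_iff_dense[OF cl D(2)])
  ultimately show ?thesis by presburger
qed

lemma pred_mem_affine_hull:
  fixes F :: "'i \<Rightarrow> 'w \<Rightarrow> 'a::euclidean_space"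
  assumes I: "finite I" and F [measurable]: "\<And>i. i \<in> I \<Longrightarrow> F i \<in> borel_measurable M" and [measurable]: "p \<in> borel_measurable M"
  shows "Measurable.pred M (\<lambda>\<omega>. p \<omega> \<in> affine hull ((\<lambda>i. F i \<omega>) ` I))"
proof (cases "I = {}")
  case False
  then obtain i0 where i0: "i0 \<in> I" by auto
  have [measurable]: "F i0 \<in> borel_measurable M" using F i0 .
  have c: "countable (I \<rightarrow>\<^sub>E (\<rat> :: real set))" using I by (intro countable_PiE) (auto simp: countable_rat)
  have [measurable]: "(\<lambda>\<omega>. \<Sum>i\<in>I. w i *\<^sub>R (F i \<omega> - F i0 \<omega>)) \<in> borel_measurable M" for w :: "'i \<Rightarrow> real"
    by (intro borel_measurable_sum) measurable
  have "Measurable.pred M (\<lambda>\<omega>. \<forall>n::nat. \<exists>w\<in>I \<rightarrow>\<^sub>E \<rat>. norm (p \<omega> - F i0 \<omega> - (\<Sum>i\<in>I. w i *\<^sub>R (F i \<omega> - F i0 \<omega>))) < 1 / real (Suc n))"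
    using c by (intro pred_intros_countable pred_countable_ball) measurable
  then show ?thesis unfolding mem_affine_hull_iff_rational[OF I i0] .
qed simp

text \<open>The definition of general position speaks of subspaces of dimension exactly
  \<open>j\<close>. A flatter set is raised to that dimension by adding points outside its affine
  hull.\<close>

lemma ex_affine_superset_aff_dim:
  fixes S :: "'a::euclidean_space set"
  assumes "aff_dim S \<le> int j" "j \<le> DIM('a)"
  shows "\<exists>B. affine B \<and> aff_dim B = int j \<and> S \<subseteq> B"
  using assms
proof (induction "nat (int j - aff_dim S)" arbitrary: S)
  case 0
  then show ?case by (intro exI[of _ "affine hull S"]) (auto simp: hull_subset)
next
  case (Suc k)
  then have "aff_dim S < DIM('a)" by auto
  then have "affine hull S \<noteq> UNIV" by (metis aff_dim_UNIV aff_dim_affine_hull less_irrefl)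
  then obtain a where a: "a \<notin> affine hull S" by auto
  then have "aff_dim (insert a S) = aff_dim S + 1" by (simp add: aff_dim_insert)
  with Suc have "\<exists>B. affine B \<and> aff_dim B = int j \<and> insert a S \<subseteq> B"
    by (intro Suc.hyps(1)) auto
  then show ?case by auto
qed

lemma affine_dependent_image_iff:
  assumes "inj_on x J"
  shows "affine_dependent (x ` J) \<longleftrightarrow> (\<exists>i\<in>J. x i \<in> affine hull (x ` (J - {i})))"
proof -
  have "x ` J - {x i} = x ` (J - {i})" if "i \<in> J" for i
    using assms that by (auto simp: inj_on_def)
  then show ?thesis by (auto simp: affine_dependent_def)
qed

text \<open>For \<open>j + 2\<close> points, lying in a \<open>j\<close>-dimensional affine subspace
  is affine dependence, and the range of \<open>j\<close> yields the cardinalities from 3 to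
  \<open>DIM('a) + 1\<close>. The indexed form is a finite combination of affine hull conditions,
  which is what measurability requires.\<close>

lemma general_position_image_iff:
  fixes x :: "'i \<Rightarrow> 'a::euclidean_space"
  assumes A: "finite A"
  shows "general_position (x ` A) \<longleftrightarrow>
    (\<forall>J\<in>Pow A. 3 \<le> card J \<and> card J \<le> DIM('a) + 1 \<longrightarrow> inj_on x J \<longrightarrow> \<not> (\<exists>i\<in>J. x i \<in> affine hull (x ` (J - {i}))))"
proof -
  have flat: "(\<exists>B. affine B \<and> aff_dim B = int j \<and> T \<subseteq> B) \<longleftrightarrow> affine_dependent T"
    if "j \<le> DIM('a) - 1" "card T = j + 2" for j and T :: "'a set"
  proof
    assume "\<exists>B. affine B \<and> aff_dim B = int j \<and> T \<subseteq> B"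
    then obtain B where "aff_dim B = int j" "T \<subseteq> B" by auto
    then have "aff_dim T \<le> int j" using aff_dim_subset by metis
    then show "affine_dependent T" using that(2) aff_dim_affine_independent[of T] by auto
  next
    assume dep: "affine_dependent T"
    have fin: "finite T" using that(2) by (metis add_is_0 card.infinite zero_neq_numeral)
    have "aff_dim T \<le> int (card T) - 1" by (rule aff_dim_le_card[OF fin])
    moreover have "aff_dim T \<noteq> int (card T) - 1" using dep fin affine_independent_iff_card by blast
    ultimately show "\<exists>B. affine B \<and> aff_dim B = int j \<and> T \<subseteq> B"
      using that by (intro ex_affine_superset_aff_dim) auto
  qed
  have "general_position (x ` A) \<longleftrightarrow>
     (\<forall>T\<subseteq>x ` A. 3 \<le> card T \<and> card T \<le> DIM('a) + 1 \<longrightarrow> \<not> affine_dependent T)"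
  proof -
    have "(\<forall>j\<in>{1..DIM('a) - 1}. \<forall>T\<subseteq>x ` A. card T = j + 2 \<longrightarrow>
        \<not> (\<exists>B. affine B \<and> aff_dim B = int j \<and> T \<subseteq> B)) \<longleftrightarrow>
       (\<forall>j\<in>{1..DIM('a) - 1}. \<forall>T\<subseteq>x ` A. card T = j + 2 \<longrightarrow> \<not> affine_dependent T)"
      using flat by (intro ball_cong refl all_cong1 imp_cong) auto
    also have "\<dots> \<longleftrightarrow> (\<forall>T\<subseteq>x ` A. 3 \<le> card T \<and> card T \<le> DIM('a) + 1 \<longrightarrow> \<not> affine_dependent T)"
    proof (intro iffI allI ballI impI)
      fix T assume *: "\<forall>j\<in>{1..DIM('a) - 1}. \<forall>T\<subseteq>x ` A. card T = j + 2 \<longrightarrow> \<not> affine_dependent T"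
        and T: "T \<subseteq> x ` A" "3 \<le> card T \<and> card T \<le> DIM('a) + 1"
      then have "card T - 2 \<in> {1..DIM('a) - 1}" "card T = (card T - 2) + 2" by auto
      then show "\<not> affine_dependent T" using * T(1) by blast
    qed auto
    finally show ?thesis using A by (simp add: general_position_def)
  qed
  also have "\<dots> \<longleftrightarrow> (\<forall>J\<in>Pow A. 3 \<le> card J \<and> card J \<le> DIM('a) + 1 \<longrightarrow> inj_on x J \<longrightarrow> \<not> affine_dependent (x ` J))"
  proof (intro iffI allI ballI impI)
    fix T assume *: "\<forall>J\<in>Pow A. 3 \<le> card J \<and> card J \<le> DIM('a) + 1 \<longrightarrow> inj_on x J \<longrightarrow> \<not> affine_dependent (x ` J)"
      and T: "T \<subseteq> x ` A" "3 \<le> card T \<and> card T \<le> DIM('a) + 1"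
    obtain J where "J \<subseteq> A" "inj_on x J" "x ` J = T" using T(1) by (metis subset_image_inj)
    then show "\<not> affine_dependent T" using * T by (auto simp: card_image)
  next
    fix J assume *: "\<forall>T\<subseteq>x ` A. 3 \<le> card T \<and> card T \<le> DIM('a) + 1 \<longrightarrow> \<not> affine_dependent T"
      and J: "J \<in> Pow A" "3 \<le> card J \<and> card J \<le> DIM('a) + 1" "inj_on x J"
    then have "card (x ` J) = card J" "x ` J \<subseteq> x ` A" by (auto simp: card_image)
    then show "\<not> affine_dependent (x ` J)" using * J(2) by simp
  qed
  also have "\<dots> \<longleftrightarrow> (\<forall>J\<in>Pow A. 3 \<le> card J \<and> card J \<le> DIM('a) + 1 \<longrightarrow> inj_on x J \<longrightarrow> \<not> (\<exists>i\<in>J. x i \<in> affine hull (x ` (J - {i}))))"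
    by (intro ball_cong refl imp_cong) (simp add: affine_dependent_image_iff)
  finally show ?thesis .
qed

lemma pred_general_position:
  fixes F :: "'i \<Rightarrow> 'w \<Rightarrow> 'a::euclidean_space"
  assumes A: "finite A" and F [measurable]: "\<And>i. i \<in> A \<Longrightarrow> F i \<in> borel_measurable M"
  shows "Measurable.pred M (\<lambda>\<omega>. general_position ((\<lambda>i. F i \<omega>) ` A))"
proof -
  have "Measurable.pred M (\<lambda>\<omega>. 3 \<le> card J \<and> card J \<le> DIM('a) + 1 \<longrightarrow>
     (\<forall>i\<in>J. \<forall>j\<in>J. F i \<omega> = F j \<omega> \<longrightarrow> i = j) \<longrightarrow>
     \<not> (\<exists>i\<in>J. F i \<omega> \<in> affine hull ((\<lambda>i. F i \<omega>) ` (J - {i}))))" if J: "J \<in> Pow A" for J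
  proof -
    have fin: "finite J" using J A finite_subset by auto
    have [measurable]: "F i \<in> borel_measurable M" if "i \<in> J" for i using J F that by auto
    have 0: "Measurable.pred M (\<lambda>\<omega>. F i \<omega> \<in> affine hull ((\<lambda>i. F i \<omega>) ` (J - {i})))" if "i \<in> J" for i
      using fin that by (intro pred_mem_affine_hull) auto
    have 1: "Measurable.pred M (\<lambda>\<omega>. \<exists>i\<in>J. F i \<omega> \<in> affine hull ((\<lambda>i. F i \<omega>) ` (J - {i})))"
      using fin 0 by (rule pred_intros_finite(4))
    have "Measurable.pred M (\<lambda>\<omega>. F i \<omega> = F j \<omega> \<longrightarrow> i = j)" if "i \<in> J" "j \<in> J" for i j
    proof (cases "i = j")
      case False
      have [measurable]: "F i \<in> borel_measurable M" "F j \<in> borel_measurable M" using that by auto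
      show ?thesis using False by simp
    qed simp
    then have 2: "Measurable.pred M (\<lambda>\<omega>. \<forall>i\<in>J. \<forall>j\<in>J. F i \<omega> = F j \<omega> \<longrightarrow> i = j)"
      using fin by (intro pred_intros_finite(3))
    show ?thesis using pred_intros_logic(4)[OF 2 pred_intros_logic(2)[OF 1]]
      by (cases "3 \<le> card J \<and> card J \<le> DIM('a) + 1") simp_all
  qed
  then have "Measurable.pred M (\<lambda>\<omega>. \<forall>J\<in>Pow A. 3 \<le> card J \<and> card J \<le> DIM('a) + 1 \<longrightarrow>
     (\<forall>i\<in>J. \<forall>j\<in>J. F i \<omega> = F j \<omega> \<longrightarrow> i = j) \<longrightarrow>
     \<not> (\<exists>i\<in>J. F i \<omega> \<in> affine hull ((\<lambda>i. F i \<omega>) ` (J - {i}))))"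
    using A by (intro pred_intros_finite(3)) blast+
  then show ?thesis unfolding general_position_image_iff[OF A] inj_on_def .
qed

text \<open>A hole is represented by the set of the smallest indices of its points, so that it is counted
  once even when points coincide.\<close>

lemma card_holes_eq_sum:
  "real (card {H. is_hole k (x ` {..<n::nat}) H}) =
    (\<Sum>I\<in>Pow {..<n}. of_bool ((\<forall>i\<in>I. \<forall>j<i. x j \<noteq> x i) \<and> is_hole k (x ` {..<n}) (x ` I)))"
proof -
  let ?P = "\<lambda>I. (\<forall>i\<in>I. \<forall>j<i. x j \<noteq> x i) \<and> is_hole k (x ` {..<n}) (x ` I)"
  have "bij_betw ((`) x) {I \<in> Pow {..<n}. ?P I} {H. is_hole k (x ` {..<n}) H}"
    unfolding bij_betw_def
  proof
    have sub: "I \<subseteq> J" if IJ: "\<forall>i\<in>I. \<forall>j<i. x j \<noteq> x i" "\<forall>i\<in>J. \<forall>j<i. x j \<noteq> x i" "x ` I = x ` J" for I J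
    proof
      fix i assume i: "i \<in> I"
      then have "x i \<in> x ` J" using IJ(3) by blast
      then obtain j where j: "j \<in> J" "x j = x i" by force
      have "\<not> i < j" using IJ(2) j by force
      moreover have "\<not> j < i" using IJ(1) i j(2) by blast
      ultimately show "i \<in> J" using j(1) by simp
    qed
    show "inj_on ((`) x) {I \<in> Pow {..<n}. ?P I}"
    proof (rule inj_onI)
      fix I J assume I: "I \<in> {I \<in> Pow {..<n}. ?P I}" and J: "J \<in> {I \<in> Pow {..<n}. ?P I}" and IJ: "x ` I = x ` J"
      have I: "\<forall>i\<in>I. \<forall>j<i. x j \<noteq> x i" using I by (elim CollectE conjE)
      have J: "\<forall>i\<in>J. \<forall>j<i. x j \<noteq> x i" using J by (elim CollectE conjE)
      show "I = J" by (rule equalityI[OF sub[OF I J IJ] sub[OF J I IJ[symmetric]]])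
    qed
    have ex: "\<exists>I\<in>Pow {..<n}. ?P I \<and> H = x ` I" if H: "is_hole k (x ` {..<n}) H" for H
    proof -
      have sub: "H \<subseteq> x ` {..<n}" using H by (simp add: is_hole_def)
      let ?I = "{i. i < n \<and> x i \<in> H \<and> (\<forall>j<i. x j \<noteq> x i)}"
      have "H = x ` ?I"
      proof (intro equalityI subsetI)
        fix h assume h: "h \<in> H"
        then obtain i where i: "i < n" "x i = h" using sub by auto
        define i' where "i' = (LEAST i. x i = h)"
        have "x i' = h" unfolding i'_def using i(2) by (rule LeastI)
        moreover have "i' \<le> i" unfolding i'_def using i(2) by (rule Least_le)
        moreover have "x j \<noteq> h" if "j < i'" for j using that not_less_Least unfolding i'_def by blast
        ultimately have "i' \<in> ?I" using h i by auto
        then show "h \<in> x ` ?I" using \<open>x i' = h\<close> by blast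
      qed auto
      moreover have "?I \<in> Pow {..<n}" "\<forall>i\<in>?I. \<forall>j<i. x j \<noteq> x i" by auto
      ultimately show ?thesis using H by (intro bexI[of _ ?I] conjI) (assumption | erule subst)+
    qed
    then show "(`) x ` {I \<in> Pow {..<n}. ?P I} = {H. is_hole k (x ` {..<n}) H}"
    proof (intro equalityI subsetI)
      fix H assume "H \<in> {H. is_hole k (x ` {..<n}) H}"
      then have "is_hole k (x ` {..<n}) H" by simp
      from ex[OF this] obtain I where I: "I \<in> Pow {..<n}" "?P I \<and> H = x ` I" by blast
      then have "I \<in> {I \<in> Pow {..<n}. ?P I}" "H = x ` I" by blast+
      then show "H \<in> (`) x ` {I \<in> Pow {..<n}. ?P I}" by (rule image_eqI[rotated])
    qed auto
  qed
  then have "card {H. is_hole k (x ` {..<n}) H} = card {I \<in> Pow {..<n}. ?P I}"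
    by (rule bij_betw_same_card[symmetric])
  moreover have "(\<Sum>I\<in>Pow {..<n}. of_bool (?P I)) = real (card (Pow {..<n} \<inter> {I. ?P I}))"
    by (rule sum_of_bool_eq) simp_all
  moreover have "Pow {..<n} \<inter> {I. ?P I} = {I \<in> Pow {..<n}. ?P I}" by blast
  ultimately show ?thesis by (simp only:)
qed

lemma is_hole_image_iff:
  fixes x :: "nat \<Rightarrow> 'a::euclidean_space"
  assumes "inj_on x I" "I \<subseteq> {..<n}"
  shows "is_hole k (x ` {..<n}) (x ` I) \<longleftrightarrow> general_position (x ` {..<n}) \<and> card I = k \<and>
     (\<forall>i\<in>I. x i \<notin> convex hull (x ` (I - {i}))) \<and> (\<forall>j\<in>{..<n}. x j \<notin> interior (convex hull (x ` I)))"
proof -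
  have "x ` I - {x i} = x ` (I - {i})" if "i \<in> I" for i
    using assms that by (auto simp: inj_on_def)
  then have "convex_position (x ` I) \<longleftrightarrow> (\<forall>i\<in>I. x i \<notin> convex hull (x ` (I - {i})))"
    using assms finite_subset[of I] by (auto simp: convex_position_def)
  then show ?thesis using assms by (auto simp: is_hole_def card_image)
qed

text \<open>The integral in \<open>expected_holes\<close> can be converted to a nonnegative integral
  only for a measurable integrand; without integrability it would be 0 by convention.\<close>

lemma measurable_card_holes:
  fixes F :: "nat \<Rightarrow> 'w \<Rightarrow> 'a::euclidean_space"
  assumes F [measurable]: "\<And>i. i < n \<Longrightarrow> F i \<in> borel_measurable M"
  shows "(\<lambda>\<omega>. real (card {H. is_hole k ((\<lambda>i. F i \<omega>) ` {..<n}) H})) \<in> borel_measurable M"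
  unfolding card_holes_eq_sum
proof (intro borel_measurable_sum)
  fix I assume I: "I \<in> Pow {..<n}"
  then have fin: "finite I" by (auto intro: finite_subset)
  have [measurable]: "F i \<in> borel_measurable M" if "i \<in> I" for i using that I F by auto
  have eq: "((\<forall>i\<in>I. \<forall>j<i. F j \<omega> \<noteq> F i \<omega>) \<and> is_hole k ((\<lambda>i. F i \<omega>) ` {..<n}) ((\<lambda>i. F i \<omega>) ` I)) \<longleftrightarrow>
    (\<forall>i\<in>I. \<forall>j\<in>{..<i}. F j \<omega> \<noteq> F i \<omega>) \<and> general_position ((\<lambda>i. F i \<omega>) ` {..<n}) \<and> card I = k \<and>
     (\<forall>i\<in>I. F i \<omega> \<notin> convex hull ((\<lambda>i. F i \<omega>) ` (I - {i}))) \<and>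
     (\<forall>j\<in>{..<n}. F j \<omega> \<notin> interior (convex hull ((\<lambda>i. F i \<omega>) ` I)))" for \<omega>
  proof -
    have "inj_on (\<lambda>i. F i \<omega>) I" if "\<forall>i\<in>I. \<forall>j\<in>{..<i}. F j \<omega> \<noteq> F i \<omega>"
      using that by (intro inj_onI) (metis lessThan_iff linorder_neqE_nat)
    then show ?thesis using is_hole_image_iff[of "\<lambda>i. F i \<omega>" I n k] I by auto
  qed
  have 1: "Measurable.pred M (\<lambda>\<omega>. \<forall>i\<in>I. \<forall>j\<in>{..<i}. F j \<omega> \<noteq> F i \<omega>)"
  proof (intro pred_intros_finite(3) fin finite_lessThan)
    fix i j assume "i \<in> I" "j \<in> {..<i}"
    then have "i < n" "j < n" using I by auto
    then have [measurable]: "F i \<in> borel_measurable M" "F j \<in> borel_measurable M" by (auto intro: F)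
    show "Measurable.pred M (\<lambda>\<omega>. F j \<omega> \<noteq> F i \<omega>)" by simp
  qed
  have 2: "Measurable.pred M (\<lambda>\<omega>. general_position ((\<lambda>i. F i \<omega>) ` {..<n}))"
    by (intro pred_general_position) (auto intro: F)
  have 3: "Measurable.pred M (\<lambda>\<omega>. \<forall>i\<in>I. F i \<omega> \<notin> convex hull ((\<lambda>i. F i \<omega>) ` (I - {i})))"
    using fin I by (intro pred_intros_finite(3) pred_intros_logic(2) pred_mem_convex_hull) (auto intro!: F)
  have 4: "Measurable.pred M (\<lambda>\<omega>. \<forall>j\<in>{..<n}. F j \<omega> \<notin> interior (convex hull ((\<lambda>i. F i \<omega>) ` I)))"
    using fin I by (intro pred_intros_finite(3) pred_intros_logic(2) pred_mem_interior_convex_hull) (auto intro!: F)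
  have 5: "Measurable.pred M (\<lambda>\<omega>. card I = k)" by simp
  show "(\<lambda>\<omega>. of_bool ((\<forall>i\<in>I. \<forall>j<i. F j \<omega> \<noteq> F i \<omega>) \<and> is_hole k ((\<lambda>i. F i \<omega>) ` {..<n}) ((\<lambda>i. F i \<omega>) ` I)) :: real) \<in> borel_measurable M"
    unfolding eq of_bool_def
    by (rule measurable_If[OF measurable_const measurable_const predE]; (simp; fail)?)
      (rule pred_intros_logic(3)[OF 1 pred_intros_logic(3)[OF 2 pred_intros_logic(3)[OF 5 pred_intros_logic(3)[OF 3 4]]]])
qed

section \<open>General position of almost all configurations\<close>

lemma null_sets_affine_hull:
  fixes S :: "'a::euclidean_space set"
  assumes "finite S" "card S \<le> DIM('a)"
  shows "affine hull S \<in> null_sets lborel"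
proof -
  have "aff_dim (affine hull S) < DIM('a)" using aff_dim_le_card[OF assms(1)] assms(2) by simp
  then have "interior (affine hull S) = {}" using aff_dim_nonempty_interior by fastforce
  then have "negligible (affine hull S)" by (simp add: negligible_convex_interior affine_imp_convex)
  then have "affine hull S \<in> null_sets lebesgue" by (simp add: negligible_iff_null_sets)
  then show ?thesis by (simp add: null_sets_def)
qed

text \<open>Unlike \<open>general_position\<close>, which sees only the set of points, this keeps
  the indices and thus also excludes coincidences: take \<open>J\<close> to be a singleton.\<close>

definition generic_points :: "'i set \<Rightarrow> ('i \<Rightarrow> 'a::euclidean_space) \<Rightarrow> bool" where
  "generic_points A x \<longleftrightarrow> (\<forall>i\<in>A. \<forall>J\<in>Pow (A - {i}). card J \<le> DIM('a) \<longrightarrow> x i \<notin> affine hull (x ` J))"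

text \<open>With all points but \<open>x i\<close> fixed, the affine hull of at most
  \<open>DIM('a)\<close> of them is a null set, and Fubini applies. The law \<open>N\<close> is left
  general because the result serves both the uniform law and Lebesgue measure itself.\<close>

lemma AE_generic_points:
  fixes N :: "'a::euclidean_space measure"
  assumes "sigma_finite_measure N" and sets [measurable_cong]: "sets N = sets borel" and ac: "absolutely_continuous lborel N"
    and A: "finite A"
  shows "AE x in PiM A (\<lambda>_. N). generic_points A x"
proof -
  interpret N: sigma_finite_measure N by fact
  interpret product_sigma_finite "\<lambda>_. N" by standard
  have "AE x in PiM A (\<lambda>_. N). card J \<le> DIM('a) \<longrightarrow> x i \<notin> affine hull (x ` J)" if i: "i \<in> A" and J: "J \<in> Pow (A - {i})" for i J
  proof (cases "card J \<le> DIM('a)")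
    case True
    have fJ: "finite J" using J A finite_subset by blast
    have insA: "insert i (A - {i}) = A" using i by auto
    let ?B = "{x \<in> space (PiM A (\<lambda>_. N)). x i \<in> affine hull (x ` J)}"
    have [measurable]: "Measurable.pred (PiM A (\<lambda>_. N)) (\<lambda>x. x i \<in> affine hull ((\<lambda>i. x i) ` J))"
      using i J by (intro pred_mem_affine_hull fJ) (auto simp: sets intro!: measurable_component_singleton cong: measurable_cong_sets)
    have B: "?B \<in> sets (PiM A (\<lambda>_. N))" by (rule predE) (use \<open>Measurable.pred _ _\<close> in simp)
    have "emeasure (PiM A (\<lambda>_. N)) ?B = (\<integral>\<^sup>+x. indicator ?B x \<partial>PiM (insert i (A - {i})) (\<lambda>_. N))"
      using B unfolding insA by simp
    also have "\<dots> = (\<integral>\<^sup>+x. \<integral>\<^sup>+y. indicator ?B (x(i := y)) \<partial>N \<partial>PiM (A - {i}) (\<lambda>_. N))"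
    proof (rule product_nn_integral_insert)
      show "indicator ?B \<in> borel_measurable (PiM (insert i (A - {i})) (\<lambda>_. N))" using B unfolding insA by simp
    qed (use A in auto)
    also have "\<dots> = (\<integral>\<^sup>+x. 0 \<partial>PiM (A - {i}) (\<lambda>_. N))"
    proof (rule nn_integral_cong)
      fix x
      have "affine hull (x ` J) \<in> null_sets N"
        using null_sets_affine_hull[of "x ` J"] fJ True card_image_le[OF fJ, of x] ac
        by (auto simp: absolutely_continuous_def)
      then have "AE y in N. y \<notin> affine hull (x ` J)" by (rule AE_not_in)
      moreover have "(x(i := y)) ` J = x ` J" for y using J by auto
      ultimately have "AE y in N. indicator ?B (x(i := y)) = (0::ennreal)" by (auto elim!: eventually_mono simp: indicator_def)
      then show "(\<integral>\<^sup>+y. indicator ?B (x(i := y)) \<partial>N) = 0" by (simp add: nn_integral_0_iff_AE cong: nn_integral_cong_AE)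
    qed
    finally have "emeasure (PiM A (\<lambda>_. N)) ?B = 0" by simp
    then have "?B \<in> null_sets (PiM A (\<lambda>_. N))" using B by auto
    then show ?thesis by (rule AE_I') auto
  qed simp
  then show ?thesis unfolding generic_points_def using A by (intro AE_finite_allI) auto
qed

lemma generic_points_inj_on:
  fixes x :: "'i \<Rightarrow> 'a::euclidean_space"
  assumes "generic_points A x" shows "inj_on x A"
proof (rule inj_onI, rule ccontr)
  fix i j assume *: "i \<in> A" "j \<in> A" "x i = x j" "i \<noteq> j"
  have "card {j} \<le> DIM('a)" by (simp add: Suc_le_eq)
  moreover have "{j} \<in> Pow (A - {i})" using * by auto
  ultimately have "x i \<notin> affine hull (x ` {j})" using assms *(1) unfolding generic_points_def by blast
  then show False using * by simp
qed

lemma generic_points_affine_independent: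
  fixes x :: "'i \<Rightarrow> 'a::euclidean_space"
  assumes g: "generic_points A x" and J: "J \<subseteq> A" "finite J" "card J \<le> DIM('a) + 1"
  shows "\<not> affine_dependent (x ` J)"
proof -
  have "inj_on x J" using generic_points_inj_on[OF g] J inj_on_subset by blast
  moreover have "x i \<notin> affine hull (x ` (J - {i}))" if "i \<in> J" for i
  proof -
    have "card (J - {i}) \<le> DIM('a)" "i \<in> A" "J - {i} \<in> Pow (A - {i})" using J that by auto
    then show ?thesis using g unfolding generic_points_def by blast
  qed
  ultimately show ?thesis by (simp add: affine_dependent_image_iff)
qed

lemma generic_points_general_position:
  fixes x :: "'i \<Rightarrow> 'a::euclidean_space"
  assumes g: "generic_points A x" and A: "finite A"
  shows "general_position (x ` A)"
  unfolding general_position_image_iff[OF A]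
proof (intro ballI impI)
  fix J assume J: "J \<in> Pow A" "3 \<le> card J \<and> card J \<le> DIM('a) + 1" "inj_on x J"
  then have "\<not> affine_dependent (x ` J)"
    using A by (intro generic_points_affine_independent[OF g]) (auto intro: finite_subset)
  then show "\<not> (\<exists>i\<in>J. x i \<in> affine hull (x ` (J - {i})))" using affine_dependent_image_iff[OF J(3)] by simp
qed

subsection \<open>Uniform random points in a convex body\<close>

text \<open>Singles out the point at \<open>i\<close>, integrated innermost, and renames the others
  by a finite type so that they can be read as a vector. \<open>H\<close> sees them only as a set,
  so the choice of the bijection is immaterial.\<close>

lemma nn_integral_PiM_insert_reindex:
  fixes N :: "'a measure" and H :: "'a \<Rightarrow> 'a set \<Rightarrow> ennreal" and B :: "'i set"
  assumes "prob_space N" and B: "finite B" "i \<notin> B" "card B = CARD('o::finite)"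
    and meas: "(\<lambda>z. H (z i) (z ` B)) \<in> borel_measurable (PiM (insert i B) (\<lambda>_. N))"
  shows "(\<integral>\<^sup>+z. H (z i) (z ` B) \<partial>PiM (insert i B) (\<lambda>_. N)) =
    (\<integral>\<^sup>+x. \<integral>\<^sup>+p. H p (range x) \<partial>N \<partial>PiM (UNIV :: 'o set) (\<lambda>_. N))"
proof -
  interpret N: prob_space N by fact
  interpret product_sigma_finite "\<lambda>_. N" by standard
  obtain f :: "_ \<Rightarrow> 'o" where f: "bij_betw f B UNIV"
    using finite_same_card_bij[of B "UNIV :: 'o set"] B by auto
  have im: "(\<lambda>b\<in>B. \<omega> (f b)) ` B = range \<omega>" for \<omega> :: "'o \<Rightarrow> 'a"
  proof -
    have "(\<lambda>b\<in>B. \<omega> (f b)) ` B = \<omega> ` f ` B" by (auto simp: image_image)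
    then show ?thesis using f by (simp add: bij_betw_def)
  qed
  let ?g = "\<lambda>x. \<integral>\<^sup>+p. H p (x ` B) \<partial>N"
  have g: "?g \<in> borel_measurable (PiM B (\<lambda>_. N))"
  proof (rule N.borel_measurable_nn_integral)
    have "(\<lambda>(x, p). x(i := p)) \<in> PiM B (\<lambda>_. N) \<Otimes>\<^sub>M N \<rightarrow>\<^sub>M PiM (insert i B) (\<lambda>_. N)"
      by (rule measurable_add_dim)
    from measurable_compose[OF this meas]
    have "(\<lambda>w. H (snd w) ((fst w)(i := snd w) ` B)) \<in> borel_measurable (PiM B (\<lambda>_. N) \<Otimes>\<^sub>M N)"
      by (simp add: case_prod_unfold del: fun_upd_image)
    moreover have "(x(i := p)) ` B = x ` B" for x :: "'i \<Rightarrow> 'a" and p using B(2) by auto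
    ultimately show "(\<lambda>(x, p). H p (x ` B)) \<in> borel_measurable (PiM B (\<lambda>_. N) \<Otimes>\<^sub>M N)"
      by (simp only: case_prod_unfold)
  qed
  have "(\<integral>\<^sup>+z. H (z i) (z ` B) \<partial>PiM (insert i B) (\<lambda>_. N)) =
     (\<integral>\<^sup>+x. \<integral>\<^sup>+p. H ((x(i := p)) i) ((x(i := p)) ` B) \<partial>N \<partial>PiM B (\<lambda>_. N))"
    by (rule product_nn_integral_insert[OF B(1,2) meas])
  also have "\<dots> = (\<integral>\<^sup>+x. ?g x \<partial>PiM B (\<lambda>_. N))"
  proof -
    have "(x(i := p)) ` B = x ` B" for x :: "'i \<Rightarrow> 'a" and p using B(2) by auto
    then show ?thesis by simp
  qed
  also have "PiM B (\<lambda>_. N) = distr (PiM (UNIV :: 'o set) (\<lambda>_. N)) (PiM B (\<lambda>_. N)) (\<lambda>\<omega>. \<lambda>b\<in>B. \<omega> (f b))"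
    using f by (intro distr_PiM_reindex[symmetric] assms(1)) (auto simp: bij_betw_def)
  also have "(\<integral>\<^sup>+x. ?g x \<partial>\<dots>) = (\<integral>\<^sup>+\<omega>. ?g (\<lambda>b\<in>B. \<omega> (f b)) \<partial>PiM (UNIV :: 'o set) (\<lambda>_. N))"
    using g by (subst nn_integral_distr) (auto intro!: measurable_restrict measurable_component_singleton)
  finally show ?thesis unfolding im .
qed

lemma measurable_emeasure_convex_hull:
  fixes N :: "'a::euclidean_space measure"
  assumes "prob_space N" and sets [measurable_cong]: "sets N = sets borel" and I: "finite I"
    and F [measurable]: "\<And>i. i \<in> I \<Longrightarrow> F i \<in> borel_measurable M"
  shows "(\<lambda>\<omega>. emeasure N (convex hull ((\<lambda>i. F i \<omega>) ` I))) \<in> borel_measurable M"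
proof -
  interpret N: prob_space N by fact
  have "Measurable.pred (M \<Otimes>\<^sub>M N) (\<lambda>w. snd w \<in> convex hull ((\<lambda>i. F i (fst w)) ` I))"
    by (intro pred_mem_convex_hull[OF I]) measurable
  then have "{w \<in> space (M \<Otimes>\<^sub>M N). snd w \<in> convex hull ((\<lambda>i. F i (fst w)) ` I)} \<in> sets (M \<Otimes>\<^sub>M N)"
    by (simp add: pred_def)
  from N.measurable_emeasure_Pair[OF this]
  have "(\<lambda>\<omega>. emeasure N (Pair \<omega> -` {w \<in> space (M \<Otimes>\<^sub>M N). snd w \<in> convex hull ((\<lambda>i. F i (fst w)) ` I)})) \<in> borel_measurable M" .
  moreover have "Pair \<omega> -` {w \<in> space (M \<Otimes>\<^sub>M N). snd w \<in> convex hull ((\<lambda>i. F i (fst w)) ` I)} =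
     convex hull ((\<lambda>i. F i \<omega>) ` I)" if "\<omega> \<in> space M" for \<omega>
    using that sets_eq_imp_space_eq[OF sets] by (auto simp: space_pair_measure)
  ultimately show ?thesis by (subst measurable_cong) auto
qed

text \<open>The volume is only required to be positive because the locale serves the given body as
  well as the projected sections, whose volumes vary.\<close>

locale uniform_body =
  fixes K :: "'a::euclidean_space set"
  assumes compact_K: "compact K" and convex_K: "convex K" and pos_K: "emeasure lborel K \<noteq> 0"
begin

definition U :: "'a measure" where "U = uniform_measure lborel K"

lemma K_borel [measurable]: "K \<in> sets borel"
  using compact_K by (simp add: borel_compact)

lemma K_finite: "emeasure lborel K < \<infinity>"
  by (rule emeasure_compact_finite[OF compact_K])

lemma sets_U [measurable_cong, simp]: "sets U = sets borel" by (simp add: U_def)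

lemma space_U [simp]: "space U = UNIV" by (simp add: U_def)

sublocale U: prob_space U
  unfolding U_def using pos_K K_finite by (intro prob_space_uniform_measure) auto

lemma borel_measurable_point: "i \<in> A \<Longrightarrow> (\<lambda>x. x i) \<in> borel_measurable (PiM A (\<lambda>_. U))"
  using measurable_component_singleton[of i A "\<lambda>_. U"] by (simp cong: measurable_cong_sets)

lemma ac_U: "absolutely_continuous lborel U"
  unfolding absolutely_continuous_def
proof
  fix A :: "'a set" assume A: "A \<in> null_sets lborel"
  then have "A \<in> sets borel" by auto
  moreover have "emeasure lborel (K \<inter> A) = 0"
    using A by (metis emeasure_mono Int_lower2 null_setsD1 null_setsD2 le_zero_eq sets_lborel)
  ultimately show "A \<in> null_sets U" by (auto simp: U_def null_sets_def)
qed

lemma AE_generic: "finite A \<Longrightarrow> AE x in PiM A (\<lambda>_. U). generic_points A x"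
  by (rule AE_generic_points[OF U.sigma_finite_measure sets_U ac_U])

lemma random_points_eq: "random_points K n = PiM {..<n} (\<lambda>_. U)"
  by (simp add: random_points_def U_def)

text \<open>Given the vertices indexed by \<open>I\<close>, the other
  \<open>n - (DIM('a) + 1)\<close> points are independent, so the probability that all of them avoid
  the simplex is a power.\<close>

lemma nn_integral_empty_hull:
  fixes n :: nat
  assumes I: "I \<subseteq> {..<n}" "card I = DIM('a) + 1" and card: "CARD('o::finite) = DIM('a)"
  shows "(\<integral>\<^sup>+x. of_bool (\<forall>j\<in>{..<n} - I. x j \<notin> interior (convex hull (x ` I))) \<partial>PiM {..<n} (\<lambda>_. U)) =
    (\<integral>\<^sup>+x. \<integral>\<^sup>+p. ennreal ((1 - measure U (convex hull (insert p (range x)))) ^ (n - (DIM('a) + 1))) \<partial>U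
       \<partial>PiM (UNIV :: 'o set) (\<lambda>_. U))"
proof -
  interpret product_sigma_finite "\<lambda>_. U" by standard
  let ?J = "{..<n} - I" and ?r = "n - (DIM('a) + 1)"
  have fin: "finite I" using I(1) finite_subset by blast
  have cJ: "card ?J = ?r" using I fin by (simp add: card_Diff_subset)
  have un: "I \<union> ?J = {..<n}" using I by auto
  have comp [measurable]: "(\<lambda>x. x i) \<in> borel_measurable (PiM A (\<lambda>_. U))" if "i \<in> A" for i :: nat and A
    using that by (rule borel_measurable_point)
  let ?P = "\<lambda>x. \<forall>j\<in>?J. x j \<notin> interior (convex hull (x ` I))"
  have P: "Measurable.pred (PiM {..<n} (\<lambda>_. U)) ?P"
    using fin I by (intro pred_intros_finite(3) pred_intros_logic(2) pred_mem_interior_convex_hull) (auto intro!: comp)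
  have Pm: "(\<lambda>x. of_bool (?P x) :: ennreal) \<in> borel_measurable (PiM (I \<union> ?J) (\<lambda>_. U))"
    unfolding un of_bool_def by (rule measurable_If[OF measurable_const measurable_const predE[OF P]]) simp_all
  have mm: "merge I ?J (x, y) ` I = x ` I" "j \<in> ?J \<Longrightarrow> merge I ?J (x, y) j = y j" for x y j
    by (auto simp: merge_def)
  \<comment> \<open>The frontier of a convex set is null, so missing the interior is as likely as
    missing the hull.\<close>
  have fr: "emeasure U (- interior C) = ennreal (1 - measure U C)" if C: "closed C" "convex C" for C
  proof -
    have "frontier C \<in> null_sets lebesgue" using negligible_convex_frontier[OF C(2)] by (simp add: negligible_iff_null_sets)
    then have "frontier C \<in> null_sets lborel" by (simp add: null_sets_def)
    then have "frontier C \<in> null_sets U" using ac_U by (auto simp: absolutely_continuous_def)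
    moreover have "C = interior C \<union> frontier C" using C(1) interior_subset[of C] by (auto simp: frontier_def)
    ultimately have "emeasure U C = emeasure U (interior C)"
      by (metis emeasure_Un_null_set borel_open open_interior sets_U)
    then have "measure U (interior C) = measure U C" by (simp add: measure_def)
    then show ?thesis
      using U.prob_compl[of "interior C"] by (simp add: U.emeasure_eq_measure Compl_eq_Diff_UNIV)
  qed
  have "(\<integral>\<^sup>+x. of_bool (?P x) \<partial>PiM {..<n} (\<lambda>_. U)) =
     (\<integral>\<^sup>+x. \<integral>\<^sup>+y. of_bool (?P (merge I ?J (x, y))) \<partial>PiM ?J (\<lambda>_. U) \<partial>PiM I (\<lambda>_. U))"
    using product_nn_integral_fold[OF _ fin _ Pm] unfolding un by simp
  also have "\<dots> = (\<integral>\<^sup>+x. ennreal ((1 - measure U (convex hull (x ` I))) ^ ?r) \<partial>PiM I (\<lambda>_. U))"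
  proof (rule nn_integral_cong)
    fix x :: "nat \<Rightarrow> 'a"
    let ?C = "convex hull (x ` I)"
    have C: "closed ?C" "convex ?C" using fin by (auto intro: compact_imp_closed finite_imp_compact_convex_hull)
    have m [measurable]: "- interior ?C \<in> sets U" by simp
    have "(\<integral>\<^sup>+y. of_bool (?P (merge I ?J (x, y))) \<partial>PiM ?J (\<lambda>_. U)) =
       (\<integral>\<^sup>+y. (\<Prod>j\<in>?J. indicator (- interior ?C) (y j)) \<partial>PiM ?J (\<lambda>_. U))"
      unfolding mm(1)
      by (intro nn_integral_cong) (auto simp: mm(2) prod_zero_iff indicator_def)
    also have "\<dots> = (\<Prod>j\<in>?J. emeasure U (- interior ?C))"
      using m by (subst product_nn_integral_prod) auto
    also have "\<dots> = ennreal ((1 - measure U ?C) ^ ?r)"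
      by (simp add: fr[OF C] cJ ennreal_power)
    finally show "(\<integral>\<^sup>+y. of_bool (?P (merge I ?J (x, y))) \<partial>PiM ?J (\<lambda>_. U)) = ennreal ((1 - measure U ?C) ^ ?r)" .
  qed
  also have "\<dots> = (\<integral>\<^sup>+x. \<integral>\<^sup>+p. ennreal ((1 - measure U (convex hull (insert p (range x)))) ^ ?r) \<partial>U
       \<partial>PiM (UNIV :: 'o set) (\<lambda>_. U))"
  proof -
    \<comment> \<open>An arbitrary vertex becomes the apex \<open>p\<close>; the other
      \<open>DIM('a)\<close> vertices will span the hyperplane.\<close>
    obtain i where i: "i \<in> I" using I(2) by fastforce
    define B where "B = I - {i}"
    have B: "finite B" "i \<notin> B" "card B = CARD('o)" "insert i B = I" using i fin I card by (auto simp: B_def)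
    have "(\<lambda>x. measure U (convex hull (x ` I))) \<in> borel_measurable (PiM I (\<lambda>_. U))"
      unfolding measure_def using measurable_emeasure_convex_hull[OF U.prob_space_axioms sets_U fin comp]
      by simp
    then have m: "(\<lambda>z. ennreal ((1 - measure U (convex hull (insert (z i) (z ` B)))) ^ ?r)) \<in> borel_measurable (PiM (insert i B) (\<lambda>_. U))"
      unfolding B(4) image_insert[symmetric] by simp
    show ?thesis
      using nn_integral_PiM_insert_reindex[OF U.prob_space_axioms B(1-3), of "\<lambda>p S. ennreal ((1 - measure U (convex hull (insert p S))) ^ ?r)", OF m]
      unfolding image_insert[symmetric] B(4) .
  qed
  finally show ?thesis .
qed

text \<open>For generic points, \<open>DIM('a) + 1\<close> of them are affinely independent, hence
  in convex position, and are extreme points of their hull, hence not interior to it. Emptiness need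
  only be tested on the remaining points, and distinct index sets give distinct holes.\<close>

lemma card_holes_generic:
  fixes x :: "nat \<Rightarrow> 'a"
  assumes g: "generic_points {..<n} x"
  shows "real (card {H. is_hole (DIM('a) + 1) (x ` {..<n}) H}) =
    (\<Sum>I | I \<subseteq> {..<n} \<and> card I = DIM('a) + 1. of_bool (\<forall>j\<in>{..<n} - I. x j \<notin> interior (convex hull (x ` I))))"
proof -
  let ?k = "DIM('a) + 1"
  have inj: "inj_on x {..<n}" by (rule generic_points_inj_on[OF g])
  have eq: "((\<forall>i\<in>I. \<forall>j<i. x j \<noteq> x i) \<and> is_hole ?k (x ` {..<n}) (x ` I)) \<longleftrightarrow>
      card I = ?k \<and> (\<forall>j\<in>{..<n} - I. x j \<notin> interior (convex hull (x ` I)))" if I: "I \<subseteq> {..<n}" for I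
  proof -
    have "\<forall>i\<in>I. \<forall>j<i. x j \<noteq> x i"
      using inj I unfolding inj_on_def by (metis lessThan_iff less_irrefl less_trans subsetD)
    moreover have injI: "inj_on x I" using inj I inj_on_subset by blast
    have gp: "general_position (x ` {..<n})" by (rule generic_points_general_position[OF g]) simp
    have fin: "finite I" using I finite_subset by blast
    have "x i \<notin> convex hull (x ` (I - {i}))" if "card I = ?k" "i \<in> I" for i
    proof -
      have "i \<in> {..<n}" "I - {i} \<in> Pow ({..<n} - {i})" "card (I - {i}) \<le> DIM('a)" using that I by auto
      then have "x i \<notin> affine hull (x ` (I - {i}))" using g unfolding generic_points_def by blast
      then show ?thesis using convex_hull_subset_affine_hull by blast
    qed
    moreover have "x j \<notin> interior (convex hull (x ` I))" if "card I = ?k" "j \<in> I" for j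
    proof -
      have "\<not> affine_dependent (x ` I)" using that I fin by (intro generic_points_affine_independent[OF g]) auto
      then have "x j extreme_point_of (convex hull (x ` I))"
        using that(2) by (simp add: extreme_point_of_convex_hull_affine_independent)
      then show ?thesis using extreme_point_not_in_interior by blast
    qed
    ultimately show ?thesis using is_hole_image_iff[OF injI I, of ?k] gp I by blast
  qed
  show ?thesis
    unfolding card_holes_eq_sum
  proof (rule sum.mono_neutral_cong_right)
    fix I assume "I \<in> {I. I \<subseteq> {..<n} \<and> card I = ?k}"
    then show "of_bool ((\<forall>i\<in>I. \<forall>j<i. x j \<noteq> x i) \<and> is_hole ?k (x ` {..<n}) (x ` I)) =
        (of_bool (\<forall>j\<in>{..<n} - I. x j \<notin> interior (convex hull (x ` I))) :: real)"
      using eq[of I] by (simp only: mem_Collect_eq simp_thms)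
  next
    show "\<forall>I\<in>Pow {..<n} - {I. I \<subseteq> {..<n} \<and> card I = ?k}.
       of_bool ((\<forall>i\<in>I. \<forall>j<i. x j \<noteq> x i) \<and> is_hole ?k (x ` {..<n}) (x ` I)) = (0 :: real)"
    proof
      fix I assume "I \<in> Pow {..<n} - {I. I \<subseteq> {..<n} \<and> card I = ?k}"
      then have "I \<subseteq> {..<n}" "card I \<noteq> ?k" by auto
      then show "of_bool ((\<forall>i\<in>I. \<forall>j<i. x j \<noteq> x i) \<and> is_hole ?k (x ` {..<n}) (x ` I)) = (0 :: real)"
        using eq[of I] by (simp only: of_bool_eq simp_thms)
    qed
  qed auto
qed

text \<open>Linearity of expectation: every index set of the right size contributes the same
  integral.\<close>

lemma expected_holes_eq:
  assumes card: "CARD('o::finite) = DIM('a)"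
  shows "ennreal (expected_holes K (DIM('a) + 1) n) = of_nat (n choose (DIM('a) + 1)) *
    (\<integral>\<^sup>+x. \<integral>\<^sup>+p. ennreal ((1 - measure U (convex hull (insert p (range x)))) ^ (n - (DIM('a) + 1))) \<partial>U
       \<partial>PiM (UNIV :: 'o set) (\<lambda>_. U))" (is "_ = _ * ?W")
proof -
  let ?k = "DIM('a) + 1"
  interpret P: prob_space "PiM {..<n} (\<lambda>_. U)" by (intro prob_space_PiM U.prob_space_axioms)
  have comp [measurable]: "(\<lambda>x. x i) \<in> borel_measurable (PiM A (\<lambda>_. U))" if "i \<in> A" for i :: nat and A
    using that by (rule borel_measurable_point)
  let ?c = "\<lambda>x. real (card {H. is_hole ?k (x ` {..<n}) H})"
  let ?S = "{I. I \<subseteq> {..<n} \<and> card I = ?k}"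
  let ?P = "\<lambda>I x. \<forall>j\<in>{..<n} - I. x j \<notin> interior (convex hull (x ` I))"
  have cm: "?c \<in> borel_measurable (PiM {..<n} (\<lambda>_. U))"
    using measurable_card_holes[of n "\<lambda>i x. x i" "PiM {..<n} (\<lambda>_. U)" ?k] comp by simp
  have Pm: "(\<lambda>x. of_bool (?P I x) :: ennreal) \<in> borel_measurable (PiM {..<n} (\<lambda>_. U))" if "I \<subseteq> {..<n}" for I
  proof -
    have "finite I" using that finite_subset by blast
    then have "Measurable.pred (PiM {..<n} (\<lambda>_. U)) (?P I)"
      using that by (intro pred_intros_finite(3) pred_intros_logic(2) pred_mem_interior_convex_hull) (auto intro!: comp)
    then show ?thesis unfolding of_bool_def by (intro measurable_If[OF measurable_const measurable_const predE]) simp_all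
  qed
  have "(\<integral>\<^sup>+x. ennreal (?c x) \<partial>PiM {..<n} (\<lambda>_. U)) = (\<integral>\<^sup>+x. (\<Sum>I\<in>?S. of_bool (?P I x)) \<partial>PiM {..<n} (\<lambda>_. U))"
  proof (rule nn_integral_cong_AE)
    show "AE x in PiM {..<n} (\<lambda>_. U). ennreal (?c x) = (\<Sum>I\<in>?S. of_bool (?P I x))"
      using AE_generic[OF finite_lessThan[of n]]
    proof eventually_elim
      case (elim x)
      have "ennreal (?c x) = (\<Sum>I\<in>?S. ennreal (of_bool (?P I x)))"
        unfolding card_holes_generic[OF elim] by (rule sum_ennreal[symmetric]) simp
      also have "\<dots> = (\<Sum>I\<in>?S. of_bool (?P I x))" by (intro sum.cong) (auto simp: of_bool_def)
      finally show ?case .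
    qed
  qed
  also have "\<dots> = (\<Sum>I\<in>?S. \<integral>\<^sup>+x. of_bool (?P I x) \<partial>PiM {..<n} (\<lambda>_. U))"
    using Pm by (intro nn_integral_sum) auto
  also have "\<dots> = (\<Sum>I\<in>?S. ?W)"
    using card by (intro sum.cong refl nn_integral_empty_hull) auto
  also have "\<dots> = of_nat (n choose ?k) * ?W"
    using n_subsets[of "{..<n}" ?k] by simp
  finally have eq: "(\<integral>\<^sup>+x. ennreal (?c x) \<partial>PiM {..<n} (\<lambda>_. U)) = of_nat (n choose ?k) * ?W" .
  \<comment> \<open>Finiteness matters because \<open>enn2real\<close> sends an infinite value to
    0.\<close>
  have "?W \<le> (\<integral>\<^sup>+x. \<integral>\<^sup>+p. 1 \<partial>U \<partial>PiM (UNIV :: 'o set) (\<lambda>_. U))"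
    by (intro nn_integral_mono) (auto intro!: ennreal_le_1[THEN iffD2] power_le_one simp: U.prob_le_1)
  also have "\<dots> = 1"
  proof -
    interpret Q: prob_space "PiM (UNIV :: 'o set) (\<lambda>_. U)" by (intro prob_space_PiM U.prob_space_axioms)
    show ?thesis by (simp add: U.emeasure_space_1[simplified] Q.emeasure_space_1)
  qed
  finally have "?W < \<infinity>" by (rule le_less_trans) simp
  then have "of_nat (n choose ?k) * ?W < \<infinity>" by (simp only: infinity_ennreal_def ennreal_mult_less_top of_nat_less_top) simp
  moreover have "expected_holes K ?k n = enn2real (\<integral>\<^sup>+x. ennreal (?c x) \<partial>PiM {..<n} (\<lambda>_. U))"
    unfolding expected_holes_def random_points_eq using cm by (intro integral_eq_nn_integral) auto
  ultimately show ?thesis unfolding eq by (simp only: ennreal_enn2real infinity_ennreal_def)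
qed

text \<open>Almost surely at most one point lies in the hull of the others, so the probability is a
  sum over the points, and by symmetry each term is the expected relative volume of a random
  simplex.\<close>

lemma simplex_prob_eq:
  assumes card: "CARD('o::finite) = DIM('a) + 1"
  shows "ennreal (simplex_prob K) = of_nat (DIM('a) + 2) *
    (\<integral>\<^sup>+x. emeasure U (convex hull (range x)) \<partial>PiM (UNIV :: 'o set) (\<lambda>_. U))"
proof -
  let ?n = "DIM('a) + 2"
  interpret P: prob_space "PiM {..<?n} (\<lambda>_. U)" by (intro prob_space_PiM U.prob_space_axioms)
  have comp [measurable]: "(\<lambda>x. x i) \<in> borel_measurable (PiM A (\<lambda>_. U))" if "i \<in> A" for i :: nat and A
    using that by (rule borel_measurable_point)
  let ?P = "\<lambda>i x. x i \<in> convex hull (x ` ({..<?n} - {i}))"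
  have pm: "Measurable.pred (PiM {..<?n} (\<lambda>_. U)) (?P i)" if "i \<in> {..<?n}" for i
    using that by (intro pred_mem_convex_hull) auto
  have Pm: "(\<lambda>x. of_bool (?P i x) :: ennreal) \<in> borel_measurable (PiM {..<?n} (\<lambda>_. U))" if "i \<in> {..<?n}" for i
    unfolding of_bool_def by (rule measurable_If[OF measurable_const measurable_const predE[OF pm[OF that]]]) simp_all
  have ex: "Measurable.pred (PiM {..<?n} (\<lambda>_. U)) (\<lambda>x. \<exists>i\<in>{..<?n}. ?P i x)"
    using pm by (intro pred_intros_finite(4)) auto
  have "ennreal (simplex_prob K) = emeasure (PiM {..<?n} (\<lambda>_. U)) {x \<in> space (PiM {..<?n} (\<lambda>_. U)). \<exists>i\<in>{..<?n}. ?P i x}"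
    unfolding simplex_prob_def random_points_eq P.emeasure_eq_measure lessThan_iff[symmetric] by (simp only: Bex_def)
  also have "\<dots> = (\<integral>\<^sup>+x. of_bool (\<exists>i\<in>{..<?n}. ?P i x) \<partial>PiM {..<?n} (\<lambda>_. U))"
  proof -
    let ?E = "{x \<in> space (PiM {..<?n} (\<lambda>_. U)). \<exists>i\<in>{..<?n}. ?P i x}"
    have "(\<integral>\<^sup>+x. of_bool (\<exists>i\<in>{..<?n}. ?P i x) \<partial>PiM {..<?n} (\<lambda>_. U)) = (\<integral>\<^sup>+x. indicator ?E x \<partial>PiM {..<?n} (\<lambda>_. U))"
      by (intro nn_integral_cong) (auto simp: indicator_def)
    then show ?thesis using nn_integral_indicator[OF predE[OF ex]] by (simp only:)
  qed
  also have "\<dots> = (\<integral>\<^sup>+x. (\<Sum>i\<in>{..<?n}. of_bool (?P i x)) \<partial>PiM {..<?n} (\<lambda>_. U))"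
  proof (rule nn_integral_cong_AE)
    show "AE x in PiM {..<?n} (\<lambda>_. U). of_bool (\<exists>i\<in>{..<?n}. ?P i x) = (\<Sum>i\<in>{..<?n}. of_bool (?P i x) :: ennreal)"
      using AE_generic[OF finite_lessThan[of ?n]]
    proof eventually_elim
      case (elim x)
      have inj: "inj_on x {..<?n}" by (rule generic_points_inj_on[OF elim])
      \<comment> \<open>If \<open>x i\<close> is in the hull of the others, then omitting
        \<open>j\<close> does not lead outside the hull without \<open>i\<close>, of which
        \<open>x j\<close> is an extreme point. Being also in the hull without \<open>j\<close>,
        \<open>x j\<close> would be extreme there and thus equal to another point.\<close>
      have uniq: "i = j" if ij: "i \<in> {..<?n}" "j \<in> {..<?n}" "?P i x" "?P j x" for i j
      proof (rule ccontr)
        assume "i \<noteq> j"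
        let ?R = "\<lambda>i. x ` ({..<?n} - {i})"
        have "\<not> affine_dependent (?R i)"
          using ij by (intro generic_points_affine_independent[OF elim]) auto
        then have "x j extreme_point_of (convex hull (?R i))"
          using ij \<open>i \<noteq> j\<close> by (simp add: extreme_point_of_convex_hull_affine_independent)
        moreover have "convex hull (?R j) \<subseteq> convex hull (?R i)"
        proof (rule hull_minimal)
          show "?R j \<subseteq> convex hull (?R i)"
          proof (intro subsetI)
            fix y assume "y \<in> ?R j"
            then obtain l where l: "l < ?n" "y = x l" by auto
            then show "y \<in> convex hull (?R i)" using ij(3) by (cases "l = i") (auto intro!: hull_inc)
          qed
        qed simp
        ultimately have "x j extreme_point_of (convex hull (?R j))"
          using ij(4) by (auto simp: extreme_point_of_def)
        then have "x j \<in> ?R j" by (rule extreme_point_of_convex_hull)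
        then show False using inj ij(2) by (auto simp: inj_on_def)
      qed
      show ?case
      proof (cases "\<exists>i\<in>{..<?n}. ?P i x")
        case True
        then obtain i where i: "i \<in> {..<?n}" "?P i x" by auto
        have "(\<Sum>j\<in>{..<?n}. of_bool (?P j x) :: ennreal) = (\<Sum>j\<in>{..<?n}. if j = i then 1 else 0)"
          using i uniq by (intro sum.cong refl) (auto simp: of_bool_def)
        also have "\<dots> = 1" using i by simp
        finally show ?thesis using True by simp
      next
        case False
        then have "(\<Sum>j\<in>{..<?n}. of_bool (?P j x) :: ennreal) = 0" by (intro sum.neutral) auto
        then show ?thesis using False by simp
      qed
    qed
  qed
  also have "\<dots> = (\<Sum>i\<in>{..<?n}. \<integral>\<^sup>+x. of_bool (?P i x) \<partial>PiM {..<?n} (\<lambda>_. U))"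
    using Pm by (intro nn_integral_sum) auto
  also have "\<dots> = (\<Sum>i\<in>{..<?n}. \<integral>\<^sup>+x. emeasure U (convex hull (range x)) \<partial>PiM (UNIV :: 'o set) (\<lambda>_. U))"
  proof (intro sum.cong refl)
    fix i assume i: "i \<in> {..<?n}"
    let ?B = "{..<?n} - {i}"
    have B: "finite ?B" "i \<notin> ?B" "card ?B = CARD('o)" "insert i ?B = {..<?n}" using i card by auto
    have m: "(\<lambda>z. of_bool (z i \<in> convex hull (z ` ?B)) :: ennreal) \<in> borel_measurable (PiM (insert i ?B) (\<lambda>_. U))"
      unfolding B(4) by (rule Pm[OF i])
    have "(\<integral>\<^sup>+x. of_bool (?P i x) \<partial>PiM {..<?n} (\<lambda>_. U)) =
       (\<integral>\<^sup>+x. \<integral>\<^sup>+p. of_bool (p \<in> convex hull (range x)) \<partial>U \<partial>PiM (UNIV :: 'o set) (\<lambda>_. U))"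
      using nn_integral_PiM_insert_reindex[OF U.prob_space_axioms B(1-3), of "\<lambda>p S. of_bool (p \<in> convex hull S)", OF m]
      unfolding B(4) .
    also have "\<dots> = (\<integral>\<^sup>+x. emeasure U (convex hull (range x)) \<partial>PiM (UNIV :: 'o set) (\<lambda>_. U))"
    proof (rule nn_integral_cong)
      fix x :: "'o \<Rightarrow> 'a"
      have "convex hull (range x) \<in> sets U"
        by (simp add: borel_compact finite_imp_compact_convex_hull)
      moreover have "(\<lambda>p. of_bool (p \<in> convex hull (range x)) :: ennreal) = indicator (convex hull (range x))"
        by (auto simp: indicator_def fun_eq_iff)
      ultimately show "(\<integral>\<^sup>+p. of_bool (p \<in> convex hull (range x)) \<partial>U) = emeasure U (convex hull (range x))"
        by (simp only: nn_integral_indicator)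
    qed
    finally show "(\<integral>\<^sup>+x. of_bool (?P i x) \<partial>PiM {..<?n} (\<lambda>_. U)) = (\<integral>\<^sup>+x. emeasure U (convex hull (range x)) \<partial>PiM (UNIV :: 'o set) (\<lambda>_. U))" .
  qed
  finally show ?thesis by simp
qed

end

text \<open>The quantity \<open>D\<close> of the overview: the Jacobian of the passage from heights
  to hyperplanes, and up to a factorial the volume of the projected simplex.\<close>

definition height_det :: "('b::euclidean_space \<times> real \<Rightarrow> (real, 'o::finite) vec) \<Rightarrow> ('b, 'o) vec \<Rightarrow> real" where
  "height_det T y = \<bar>det (\<chi> i. T (y $ i, 1))\<bar>"

lemma height_det_nonneg [simp]: "0 \<le> height_det T y" by (simp add: height_det_def)

lemma borel_measurable_height_det [measurable]:
  assumes "linear T"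
  shows "height_det T \<in> borel_measurable borel"
proof (rule borel_measurable_continuous_onI)
  have bl: "bounded_linear T" using assms by (simp add: linear_conv_bounded_linear)
  have "continuous_on UNIV (\<lambda>y. T (y $ i, 1))" for i
    by (intro bounded_linear.continuous_on[OF bl] continuous_intros)
  then show "continuous_on UNIV (height_det T)"
    unfolding height_det_def[abs_def] det_def by (auto intro!: continuous_intros)
qed

lemma AE_lborel_vec:
  assumes "AE x in PiM UNIV (\<lambda>_::'o::finite. lborel :: 'a::euclidean_space measure). P (\<chi> i. x i)"
    and "{y. P y} \<in> sets borel"
  shows "AE y in lborel :: ('a^'o) measure. P y"
  by (subst lborel_vec_eq_distr_PiM, subst AE_distr_iff) (use assms in simp_all)

text \<open>A vanishing determinant puts some base point into the affine hull of the
  \<open>DIM('b)\<close> others. Positivity is needed both for the substitution and for the later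
  cancellation of \<open>D\<close>.\<close>

lemma AE_height_det_pos:
  fixes T :: "'b::euclidean_space \<times> real \<Rightarrow> (real, 'o::{finite,wellorder}) vec"
  assumes T: "linear T" "bij_betw T Basis Basis" and card: "CARD('o) = DIM('b) + 1"
  shows "AE y in (lborel :: ('b, 'o) vec measure). 0 < height_det T y"
proof (rule AE_lborel_vec)
  have "AE x in PiM UNIV (\<lambda>_::'o. lborel :: 'b measure). generic_points UNIV x"
    by (rule AE_generic_points) (auto simp: absolutely_continuous_def lborel.sigma_finite_measure_axioms)
  then show "AE x in PiM UNIV (\<lambda>_::'o. lborel :: 'b measure). 0 < height_det T (\<chi> i. x i)"
  proof eventually_elim
    case (elim x)
    have "x i \<notin> affine hull (x ` (- {i}))" for i
    proof -
      have "card (- {i}) \<le> DIM('b)" using card by (simp add: Compl_eq_Diff_UNIV card_Diff_subset)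
      then show ?thesis using elim unfolding generic_points_def by (auto simp: Compl_eq_Diff_UNIV)
    qed
    then have "det (\<chi> i. T (x i, 1)) \<noteq> 0" using det_zero_imp_affine_hull[OF T] by blast
    then show ?case by (simp add: height_det_def)
  qed
  have [measurable]: "height_det T \<in> borel_measurable borel" by (rule borel_measurable_height_det[OF T(1)])
  show "{y. 0 < height_det T y} \<in> sets borel" by measurable
qed

text \<open>A repeated point would repeat a row of the matrix, so a positive determinant already
  makes the vertices distinct.\<close>

lemma measure_simplex_height_det:
  fixes T :: "'b::euclidean_space \<times> real \<Rightarrow> (real, 'o::{finite,wellorder}) vec" and y :: "('b, 'o) vec"
  assumes T: "linear T" "bij_betw T Basis Basis" and card: "CARD('o) = DIM('b) + 1"
    and pos: "0 < height_det T y"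
  shows "measure lborel (convex hull (range (($) y))) = height_det T y / fact DIM('b)"
proof -
  have "inj (($) y)"
  proof (rule injI, rule ccontr)
    fix i j assume "y $ i = y $ j" "i \<noteq> j"
    then have "det (\<chi> i. T (y $ i, 1)) = 0"
      by (intro det_identical_rows[of i j]) (auto simp: row_def vec_eq_iff)
    then show False using pos by (simp add: height_det_def)
  qed
  from measure_simplex_det[OF T card this] show ?thesis by (simp add: height_det_def)
qed

context uniform_body
begin

lemma PiM_U_eq_density:
  assumes I: "finite I"
  shows "PiM I (\<lambda>_. U) = density (PiM I (\<lambda>_. lborel)) (\<lambda>x. \<Prod>i\<in>I. indicator K (x i) / emeasure lborel K)"
proof -
  interpret U: product_sigma_finite "\<lambda>_. U" by standard
  interpret L: product_sigma_finite "\<lambda>_. lborel :: 'a measure" by standard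
  let ?w = "\<lambda>x. indicator K x / emeasure lborel K"
  have w [measurable]: "?w \<in> borel_measurable borel" by simp
  have pw: "(\<lambda>x. \<Prod>i\<in>I. ?w (x i)) \<in> borel_measurable (PiM I (\<lambda>_. lborel))" by measurable
  show ?thesis
  proof (rule U.PiM_eqI[OF I, symmetric])
    show "sets (density (PiM I (\<lambda>_. lborel)) (\<lambda>x. \<Prod>i\<in>I. ?w (x i))) = sets (PiM I (\<lambda>_. U))"
      by (simp cong: sets_PiM_cong)
    fix A assume A: "\<And>i. i \<in> I \<Longrightarrow> A i \<in> sets U"
    have P: "Pi\<^sub>E I A \<in> sets (PiM I (\<lambda>_. lborel))" using A I by (intro sets_PiM_I_finite) auto
    have "emeasure (density (PiM I (\<lambda>_. lborel)) (\<lambda>x. \<Prod>i\<in>I. ?w (x i))) (Pi\<^sub>E I A) =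
      (\<integral>\<^sup>+x. (\<Prod>i\<in>I. ?w (x i)) * indicator (Pi\<^sub>E I A) x \<partial>PiM I (\<lambda>_. lborel))"
      by (rule emeasure_density[OF pw P])
    also have "\<dots> = (\<integral>\<^sup>+x. (\<Prod>i\<in>I. ?w (x i) * indicator (A i) (x i)) \<partial>PiM I (\<lambda>_. lborel))"
    proof (rule nn_integral_cong)
      fix x assume "x \<in> space (PiM I (\<lambda>_. lborel :: 'a measure))"
      then have "x \<in> extensional I" by (simp add: space_PiM PiE_def)
      then have "indicator (Pi\<^sub>E I A) x = (\<Prod>i\<in>I. indicator (A i) (x i) :: ennreal)"
        using I by (auto simp: indicator_def PiE_def Pi_def prod_zero_iff)
      then show "(\<Prod>i\<in>I. ?w (x i)) * indicator (Pi\<^sub>E I A) x = (\<Prod>i\<in>I. ?w (x i) * indicator (A i) (x i))"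
        by (simp add: prod.distrib)
    qed
    also have "\<dots> = (\<Prod>i\<in>I. \<integral>\<^sup>+x. ?w x * indicator (A i) x \<partial>lborel)"
      using A by (intro L.product_nn_integral_prod I) auto
    also have "\<dots> = (\<Prod>i\<in>I. emeasure U (A i))"
      using A by (intro prod.cong refl) (simp add: U_def uniform_measure_def emeasure_density)
    finally show "emeasure (density (PiM I (\<lambda>_. lborel)) (\<lambda>x. \<Prod>i\<in>I. ?w (x i))) (Pi\<^sub>E I A) = (\<Prod>i\<in>I. emeasure U (A i))" .
  qed
qed

lemma nn_integral_PiM_U_vec:
  assumes f: "f \<in> borel_measurable (PiM (UNIV :: 'o::finite set) (\<lambda>_. U))"
  shows "(\<integral>\<^sup>+x. f x \<partial>PiM (UNIV :: 'o set) (\<lambda>_. U)) =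
    (\<integral>\<^sup>+y. f (($) y) * (\<Prod>i\<in>UNIV. indicator K (y $ i)) \<partial>(lborel :: ('a, 'o) vec measure)) * inverse (emeasure lborel K) ^ CARD('o)"
proof -
  have eq: "sets (PiM (UNIV :: 'o set) (\<lambda>_. U)) = sets (PiM UNIV (\<lambda>_. lborel))"
    by (rule sets_PiM_cong) auto
  have [measurable]: "f \<in> borel_measurable (PiM UNIV (\<lambda>_. lborel))"
    using f by (simp cong: measurable_cong_sets add: measurable_cong_sets[OF eq refl])
  let ?w = "\<lambda>x. \<Prod>i\<in>UNIV. indicator K (x i) / emeasure lborel K"
  have pw: "?w \<in> borel_measurable (PiM (UNIV :: 'o set) (\<lambda>_. lborel))" by measurable
  have "(\<integral>\<^sup>+x. f x \<partial>PiM (UNIV :: 'o set) (\<lambda>_. U)) = (\<integral>\<^sup>+x. ?w x * f x \<partial>PiM UNIV (\<lambda>_. lborel))"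
    unfolding PiM_U_eq_density[OF finite] by (rule nn_integral_density[OF pw]) simp
  also have "\<dots> = (\<integral>\<^sup>+y. (\<Prod>i\<in>UNIV. indicator K (y $ i) / emeasure lborel K) * f (($) y) \<partial>(lborel :: ('a, 'o) vec measure))"
    using pw by (intro nn_integral_PiM_lborel_vec) measurable
  also have "\<dots> = (\<integral>\<^sup>+y. f (($) y) * (\<Prod>i\<in>UNIV. indicator K (y $ i)) * inverse (emeasure lborel K) ^ CARD('o) \<partial>(lborel :: ('a, 'o) vec measure))"
    by (intro nn_integral_cong) (simp add: divide_ennreal_def prod.distrib mult_ac)
  also have "\<dots> = (\<integral>\<^sup>+y. f (($) y) * (\<Prod>i\<in>UNIV. indicator K (y $ i)) \<partial>(lborel :: ('a, 'o) vec measure)) * inverse (emeasure lborel K) ^ CARD('o)"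
  proof (rule nn_integral_multc)
    have [measurable]: "(\<lambda>x::('a, 'o) vec. ($) x) \<in> borel \<rightarrow>\<^sub>M PiM UNIV (\<lambda>_::'o. lborel :: 'a measure)"
      by (rule measurable_PiM_single') auto
    show "(\<lambda>y. f (($) y) * (\<Prod>i\<in>UNIV. indicator K (y $ i))) \<in> borel_measurable (lborel :: ('a, 'o) vec measure)"
      by measurable
  qed
  finally show ?thesis .
qed

lemma emeasure_U_hull:
  assumes "finite S" "S \<subseteq> K"
  shows "emeasure U (convex hull S) = ennreal (measure lborel (convex hull S)) / emeasure lborel K"
proof -
  have sub: "convex hull S \<subseteq> K" using assms convex_K by (intro hull_minimal)
  have c: "compact (convex hull S)" using assms by (intro finite_imp_compact_convex_hull)
  then have "emeasure lborel (convex hull S) = ennreal (measure lborel (convex hull S))"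
    using emeasure_compact_finite[OF c] by (simp add: emeasure_eq_ennreal_measure)
  moreover have "K \<inter> convex hull S = convex hull S" using sub by auto
  ultimately show ?thesis using c by (simp add: U_def borel_compact)
qed

end

section \<open>The first moment of the Jacobian over a convex set\<close>

lemma simplex_prob_le_max:
  fixes L :: "'b::euclidean_space set"
  assumes "convex_body L"
  shows "simplex_prob L \<le> max_simplex_prob TYPE('b)"
  unfolding max_simplex_prob_def
proof (rule cSUP_upper)
  \<comment> \<open>A supremum of reals is an upper bound only for a bounded family; probabilities
    are bounded by 1.\<close>
  show "bdd_above (simplex_prob ` {L :: 'b set. convex_body L})"
  proof (rule bdd_aboveI)
    fix z assume "z \<in> simplex_prob ` {L :: 'b set. convex_body L}"
    then obtain L :: "'b set" where L: "convex_body L" and z: "z = simplex_prob L" by auto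
    have "emeasure lborel L \<noteq> 0"
    proof
      assume "emeasure lborel L = 0"
      then have "L \<in> null_sets lebesgue"
        using L by (intro null_sets_completionI) (auto simp: convex_body_def borel_compact)
      then show False
        using L open_not_negligible[of "interior L"] negligible_subset[OF _ interior_subset, of L]
        by (auto simp: convex_body_def negligible_iff_null_sets)
    qed
    then interpret uniform_body L using L by unfold_locales (auto simp: convex_body_def)
    interpret P: prob_space "PiM {..<DIM('b) + 2} (\<lambda>_. U)" by (intro prob_space_PiM U.prob_space_axioms)
    show "z \<le> 1" unfolding z simplex_prob_def random_points_eq by (rule P.prob_le_1)
  qed
qed (use assms in simp)

text \<open>For uniform points of \<open>L\<close>, the simplex probability is
  \<open>DIM('b) + 2\<close> times the mean relative volume of a simplex. That volume is
  \<open>height_det\<close> over \<open>fact DIM('b)\<close>; one factor of the volume of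
  \<open>L\<close> comes from relative volume, \<open>DIM('b) + 1\<close> more from the densities of
  the vertices.\<close>

lemma height_det_moment_le:
  fixes T :: "'b::euclidean_space \<times> real \<Rightarrow> (real, 'o::{finite,wellorder}) vec" and L :: "'b set"
  assumes T: "linear T" "bij_betw T Basis Basis" and card: "CARD('o) = DIM('b) + 1"
    and L: "compact L" "convex L"
  shows "(\<integral>\<^sup>+y. ennreal (height_det T y) * (\<Prod>i\<in>UNIV. indicator L (y $ i)) \<partial>(lborel :: ('b, 'o) vec measure)) \<le>
    ennreal (fact DIM('b) * max_simplex_prob TYPE('b) / (DIM('b) + 2)) * emeasure lborel L ^ (DIM('b) + 2)"
    (is "?I \<le> _")
proof (cases "emeasure lborel L = 0")
  \<comment> \<open>A section may be empty or flat, and then carries no uniform law; the integral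
    vanishes.\<close>
  case True
  have Lb [measurable]: "L \<in> sets borel" using L by (simp add: borel_compact)
  have "(\<integral>\<^sup>+y. (\<Prod>i\<in>UNIV. indicator L (y $ i)) \<partial>(lborel :: ('b, 'o) vec measure)) = 0"
    using True by (subst nn_integral_lborel_vec_prod) (auto simp: power_0_left)
  then have "AE y in (lborel :: ('b, 'o) vec measure). (\<Prod>i\<in>UNIV. indicator L (y $ i)) = (0 :: ennreal)"
    by (subst (asm) nn_integral_0_iff_AE) measurable
  then have "?I = (\<integral>\<^sup>+y. 0 \<partial>(lborel :: ('b, 'o) vec measure))"
    by (intro nn_integral_cong_AE) (auto elim!: eventually_mono)
  then show ?thesis by simp
next
  case False
  then interpret uniform_body L using L by unfold_locales
  have hm [measurable]: "height_det T \<in> borel_measurable borel" by (rule borel_measurable_height_det[OF T(1)])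
  have "interior L \<noteq> {}"
  proof
    assume "interior L = {}"
    then have "L \<in> null_sets lebesgue" using L by (simp add: negligible_convex_interior[symmetric] negligible_iff_null_sets)
    then show False using False L by (simp add: null_sets_def borel_compact)
  qed
  then have "simplex_prob L \<le> max_simplex_prob TYPE('b)"
    using L by (intro simplex_prob_le_max) (simp add: convex_body_def)
  have fL: "emeasure lborel L \<noteq> \<infinity>" using K_finite by simp
  define v where "v = measure lborel L"
  have v: "emeasure lborel L = ennreal v" using fL by (simp add: v_def emeasure_eq_ennreal_measure)
  have v0: "v > 0" using False v by (metis ennreal_0 less_eq_real_def measure_nonneg v_def)
  have sets: "sets (PiM (UNIV :: 'o set) (\<lambda>_. U)) = sets (PiM UNIV (\<lambda>_. lborel))" by (rule sets_PiM_cong) auto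
  have m: "(\<lambda>x. emeasure U (convex hull (range x))) \<in> borel_measurable (PiM (UNIV :: 'o set) (\<lambda>_. U))"
    using measurable_emeasure_convex_hull[OF U.prob_space_axioms sets_U finite borel_measurable_point[OF UNIV_I]] by simp
  have "ennreal (simplex_prob L) = of_nat (DIM('b) + 2) *
    ((\<integral>\<^sup>+y. emeasure U (convex hull (range (($) y))) * (\<Prod>i\<in>UNIV. indicator L (y $ i)) \<partial>(lborel :: ('b, 'o) vec measure)) * inverse (ennreal v) ^ CARD('o))"
    unfolding simplex_prob_eq[OF card] nn_integral_PiM_U_vec[OF m] v ..
  also have "(\<integral>\<^sup>+y. emeasure U (convex hull (range (($) y))) * (\<Prod>i\<in>UNIV. indicator L (y $ i)) \<partial>(lborel :: ('b, 'o) vec measure)) =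
     (\<integral>\<^sup>+y. ennreal (1 / (fact DIM('b) * v)) * (ennreal (height_det T y) * (\<Prod>i\<in>UNIV. indicator L (y $ i))) \<partial>(lborel :: ('b, 'o) vec measure))"
  proof (rule nn_integral_cong_AE)
    show "AE y in (lborel :: ('b, 'o) vec measure). emeasure U (convex hull (range (($) y))) * (\<Prod>i\<in>UNIV. indicator L (y $ i)) =
       ennreal (1 / (fact DIM('b) * v)) * (ennreal (height_det T y) * (\<Prod>i\<in>UNIV. indicator L (y $ i)))"
      using AE_height_det_pos[OF T card]
    proof eventually_elim
      case (elim y)
      show ?case
      proof (cases "range (($) y) \<subseteq> L")
        case True
        have "emeasure U (convex hull (range (($) y))) = ennreal (height_det T y / fact DIM('b)) / ennreal v"
          using emeasure_U_hull[OF _ True] measure_simplex_height_det[OF T card elim] v by simp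
        also have "\<dots> = ennreal (1 / (fact DIM('b) * v)) * ennreal (height_det T y)"
          using v0 by (simp add: divide_ennreal ennreal_mult''[symmetric])
        finally show ?thesis by (simp add: mult.assoc)
      next
        case False
        then obtain i where "y $ i \<notin> L" by auto
        then have "(\<Prod>i\<in>UNIV. indicator L (y $ i)) = (0 :: ennreal)"
            by (intro prod_zero bexI[of _ i]) (auto simp: indicator_def)
        then show ?thesis by (simp only: mult_zero_left mult_zero_right)
      qed
    qed
  qed
  also have "\<dots> = ennreal (1 / (fact DIM('b) * v)) * ?I"
    by (rule nn_integral_cmult) measurable
  finally have eq: "ennreal (simplex_prob L) = of_nat (DIM('b) + 2) * (ennreal (1 / (fact DIM('b) * v)) * ?I * inverse (ennreal v) ^ CARD('o))" .
  have "?I = ennreal (fact DIM('b) * v / (DIM('b) + 2) * v ^ CARD('o)) * ennreal (simplex_prob L)"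
  proof -
    have "ennreal (fact DIM('b) * v / (DIM('b) + 2) * v ^ CARD('o)) * ennreal (simplex_prob L) =
       (ennreal (fact DIM('b) * v / (DIM('b) + 2) * v ^ CARD('o)) * ennreal (real (DIM('b) + 2)) * ennreal (1 / (fact DIM('b) * v)) * ennreal (inverse v ^ CARD('o))) * ?I"
      unfolding eq using v0 by (simp only: ennreal_of_nat_eq_real_of_nat inverse_ennreal ennreal_power[symmetric] mult_ac inverse_nonnegative_iff_nonnegative less_imp_le)
    also have "ennreal (fact DIM('b) * v / (DIM('b) + 2) * v ^ CARD('o)) * ennreal (real (DIM('b) + 2)) * ennreal (1 / (fact DIM('b) * v)) * ennreal (inverse v ^ CARD('o)) =
       ennreal ((fact DIM('b) * v / (DIM('b) + 2) * v ^ CARD('o)) * real (DIM('b) + 2) * (1 / (fact DIM('b) * v)) * inverse v ^ CARD('o))"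
      using v0 by (simp only: ennreal_mult[symmetric] mult_nonneg_nonneg divide_nonneg_nonneg less_imp_le fact_ge_zero of_nat_0_le_iff zero_le_power inverse_nonnegative_iff_nonnegative zero_le_one)
    also have "(fact DIM('b) * v / (DIM('b) + 2) * v ^ CARD('o)) * real (DIM('b) + 2) * (1 / (fact DIM('b) * v)) * inverse v ^ CARD('o) = 1"
    proof -
      have g: "a * v / k * w * k * (1 / (a * v)) * u = 1" if "a \<noteq> 0" "k \<noteq> 0" "w * u = 1" for a k w u :: real
        using that v0 by (simp add: field_simps)
      have "v ^ CARD('o) * inverse v ^ CARD('o) = 1" using v0 by (simp add: power_mult_distrib[symmetric])
      then show ?thesis by (intro g) simp_all
    qed
    finally show ?thesis by simp
  qed
  also have "\<dots> \<le> ennreal (fact DIM('b) * v / (DIM('b) + 2) * v ^ CARD('o)) * ennreal (max_simplex_prob TYPE('b))"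
    using \<open>simplex_prob L \<le> max_simplex_prob TYPE('b)\<close> by (intro mult_left_mono ennreal_leI) auto
  also have "\<dots> = ennreal (fact DIM('b) * max_simplex_prob TYPE('b) / (DIM('b) + 2)) * ennreal v ^ (DIM('b) + 2)"
  proof -
    have "0 \<le> simplex_prob L" by (simp add: simplex_prob_def)
    then have "0 \<le> max_simplex_prob TYPE('b)" using \<open>simplex_prob L \<le> max_simplex_prob TYPE('b)\<close> by linarith
    then show ?thesis using v0 card by (simp add: ennreal_mult''[symmetric] ennreal_mult'[symmetric] ennreal_power field_simps)
  qed
  finally show ?thesis unfolding v .
qed

section \<open>The hole integral in hyperplane coordinates\<close>

lemma nn_integral_lborel_vec_map:
  fixes S :: "'a::euclidean_space \<Rightarrow> 'b::euclidean_space"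
  assumes S: "linear S" "bij_betw S Basis Basis" and [measurable]: "f \<in> borel_measurable borel"
  shows "(\<integral>\<^sup>+x. f x \<partial>(lborel :: ('b, 'o::finite) vec measure)) =
    (\<integral>\<^sup>+x. f (\<chi> i. S (x $ i)) \<partial>(lborel :: ('a, 'o) vec measure))"
proof (rule nn_integral_lborel_Basis_bij)
  show "linear (\<lambda>x::('a, 'o) vec. \<chi> i. S (x $ i))"
    by (rule linearI) (auto simp: vec_eq_iff linear_add[OF S(1)] linear_cmul[OF S(1)])
  have inj: "inj_on S Basis" and im: "S ` Basis = Basis" using S(2) by (auto simp: bij_betw_def)
  have ax: "(\<chi> i. S (axis j b $ i)) = axis j (S b)" for j :: 'o and b
    by (auto simp: vec_eq_iff axis_def linear_0[OF S(1)])
  show "bij_betw (\<lambda>x::('a, 'o) vec. \<chi> i. S (x $ i)) Basis Basis"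
    unfolding bij_betw_def
  proof
    show "inj_on (\<lambda>x::('a, 'o) vec. \<chi> i. S (x $ i)) Basis"
    proof (rule inj_onI)
      fix u v :: "('a, 'o) vec" assume "u \<in> Basis" "v \<in> Basis" and eq: "(\<chi> i. S (u $ i)) = (\<chi> i. S (v $ i))"
      then obtain i a j b where uv: "u = axis i a" "a \<in> Basis" "v = axis j b" "b \<in> Basis"
        unfolding Basis_vec_def by blast
      then have "axis i (S a) = axis j (S b)" using eq by (simp add: ax)
      moreover have "S a \<noteq> 0" "S b \<noteq> 0" using uv im by (metis imageI nonzero_Basis)+
      ultimately have "i = j" "S a = S b" by (auto simp: axis_eq_axis)
      then show "u = v" using uv inj by (auto simp: inj_on_def)
    qed
    have "(\<lambda>x::('a, 'o) vec. \<chi> i. S (x $ i)) ` Basis = (\<Union>i. axis i ` S ` Basis)"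
      unfolding Basis_vec_def by (force simp: ax image_iff)
    also have "\<dots> = Basis" unfolding im by (auto simp: Basis_vec_def)
    finally show "(\<lambda>x::('a, 'o) vec. \<chi> i. S (x $ i)) ` Basis = (Basis :: ('b, 'o) vec set)" .
  qed
qed simp

context uniform_body
begin

lemma measurable_measure_hull_insert:
  "(\<lambda>w. measure U (convex hull (insert (snd w) (range (fst w))))) \<in>
    borel_measurable (PiM (UNIV :: 'o::finite set) (\<lambda>_. U) \<Otimes>\<^sub>M U)"
proof -
  let ?M = "PiM (UNIV :: 'o set) (\<lambda>_. U) \<Otimes>\<^sub>M U"
  \<comment> \<open>\<open>option\<close> adds one index, \<open>None\<close>, for the apex.\<close>
  let ?F = "\<lambda>i w. case i of None \<Rightarrow> snd w | Some j \<Rightarrow> fst w j"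
  have F: "?F i \<in> borel_measurable ?M" for i
  proof (cases i)
    case None
    have "snd \<in> ?M \<rightarrow>\<^sub>M U" by simp
    then show ?thesis using None by (simp cong: measurable_cong_sets)
  next
    case (Some j)
    have "(\<lambda>w. fst w j) \<in> ?M \<rightarrow>\<^sub>M U" by measurable
    then show ?thesis using Some by (simp cong: measurable_cong_sets)
  qed
  have im: "(\<lambda>i. ?F i w) ` UNIV = insert (snd w) (range (fst w))" for w :: "('o \<Rightarrow> 'a) \<times> 'a"
    by (simp add: UNIV_option_conv image_image)
  have "(\<lambda>w. emeasure U (convex hull ((\<lambda>i. ?F i w) ` UNIV))) \<in> borel_measurable ?M"
    by (rule measurable_emeasure_convex_hull[OF U.prob_space_axioms sets_U finite F])
  then show ?thesis unfolding measure_def im by simp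
qed

text \<open>After transport by \<open>S\<close>, the \<open>d\<close> points of the base split into
  base points and heights, and the heights are replaced by their hyperplane \<open>c\<close>. Since
  the body has volume 1, the probability of hitting the simplex is its Lebesgue measure, given by
  the cone over the graph of \<open>c\<close>.\<close>

lemma hole_integral_eq:
  fixes S :: "'b::euclidean_space \<times> real \<Rightarrow> 'a" and T :: "'b \<times> real \<Rightarrow> (real, 'o::{finite,wellorder}) vec"
  assumes S: "linear S" "bij_betw S Basis Basis"
    and T: "linear T" "bij_betw T Basis Basis"
    and card: "CARD('o) = DIM('b) + 1" and one: "emeasure lborel K = 1"
  shows "(\<integral>\<^sup>+x. \<integral>\<^sup>+p. ennreal ((1 - measure U (convex hull (insert p (range x)))) ^ r) \<partial>U \<partial>PiM (UNIV :: 'o set) (\<lambda>_. U)) =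
    (\<integral>\<^sup>+y. ennreal (height_det T y) * (\<integral>\<^sup>+c. (\<Prod>i\<in>UNIV. indicator (S -` K) (y $ i, fst c \<bullet> y $ i + snd c)) *
       (\<integral>\<^sup>+p. indicator (S -` K) p *
         ennreal (max 0 (1 - height_det T y * \<bar>snd p - (fst c \<bullet> fst p + snd c)\<bar> / fact (DIM('b) + 1)) ^ r) \<partial>lborel)
       \<partial>lborel) \<partial>(lborel :: ('b, 'o) vec measure))"
    (is "_ = (\<integral>\<^sup>+y. _ y * (\<integral>\<^sup>+c. ?g y c \<partial>lborel) \<partial>lborel)")
proof -
  let ?\<phi> = "\<lambda>x p. ennreal ((1 - measure U (convex hull (insert p (range x)))) ^ r)"
  let ?F = "\<lambda>x :: 'o \<Rightarrow> 'a. \<integral>\<^sup>+p. ?\<phi> x p \<partial>U"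
  let ?H = "\<lambda>X :: ('a, 'o) vec. ?F (($) X) * (\<Prod>i\<in>UNIV. indicator K (X $ i))"
  have \<phi>m: "(\<lambda>w. ?\<phi> (fst w) (snd w)) \<in> borel_measurable (PiM (UNIV :: 'o set) (\<lambda>_. U) \<Otimes>\<^sub>M U)"
    using measurable_measure_hull_insert by measurable
  have Fm: "?F \<in> borel_measurable (PiM (UNIV :: 'o set) (\<lambda>_. U))"
    by (rule U.borel_measurable_nn_integral) (use \<phi>m in \<open>simp add: case_prod_unfold\<close>)
  have sets: "sets (PiM (UNIV :: 'o set) (\<lambda>_. U)) = sets (PiM UNIV (\<lambda>_. lborel))" by (rule sets_PiM_cong) auto
  have nthm: "(\<lambda>x::('a, 'o) vec. ($) x) \<in> borel \<rightarrow>\<^sub>M PiM UNIV (\<lambda>_::'o. U)"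
    by (rule measurable_PiM_single') auto
  have Hm [measurable]: "?H \<in> borel_measurable borel"
    using measurable_compose[OF nthm Fm] by measurable
  have \<phi>m': "?\<phi> x \<in> borel_measurable borel" for x :: "'o \<Rightarrow> 'a"
  proof -
    have "(\<lambda>p. (x, p)) \<in> U \<rightarrow>\<^sub>M PiM (UNIV :: 'o set) (\<lambda>_. U) \<Otimes>\<^sub>M U"
      by (rule measurable_Pair1') (simp add: space_PiM)
    from measurable_compose[OF this \<phi>m] show ?thesis by (simp cong: measurable_cong_sets)
  qed
  have Sm [measurable]: "S \<in> borel_measurable borel" by (rule linear_borel_measurable[OF S(1)])
  have "(\<integral>\<^sup>+x. ?F x \<partial>PiM (UNIV :: 'o set) (\<lambda>_. U)) = (\<integral>\<^sup>+X. ?H X \<partial>lborel)"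
    unfolding nn_integral_PiM_U_vec[OF Fm] by (simp add: one)
  also have "\<dots> = (\<integral>\<^sup>+X. ?H (\<chi> i. S (X $ i)) \<partial>(lborel :: ('b \<times> real, 'o) vec measure))"
    by (rule nn_integral_lborel_vec_map[OF S Hm])
  also have "\<dots> = (\<integral>\<^sup>+y. \<integral>\<^sup>+z. ?H (\<chi> i. S (y $ i, z $ i)) \<partial>(lborel :: (real, 'o) vec measure) \<partial>(lborel :: ('b, 'o) vec measure))"
  proof -
    have m: "(\<lambda>x::('b \<times> real, 'o) vec. ?H (\<chi> i. S (x $ i))) \<in> borel_measurable borel"
      by (rule measurable_compose[OF _ Hm]) measurable
    from nn_integral_lborel_vec_Pair[OF m] show ?thesis by (simp only: vec_lambda_beta)
  qed
  also have "\<dots> = (\<integral>\<^sup>+y. ennreal (height_det T y) * (\<integral>\<^sup>+c. ?g y c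
       \<partial>lborel) \<partial>(lborel :: ('b, 'o) vec measure))"
  proof (rule nn_integral_cong_AE)
    show "AE y in (lborel :: ('b, 'o) vec measure). (\<integral>\<^sup>+z. ?H (\<chi> i. S (y $ i, z $ i)) \<partial>(lborel :: (real, 'o) vec measure)) =
      ennreal (height_det T y) * (\<integral>\<^sup>+c. ?g y c \<partial>lborel)"
      using AE_height_det_pos[OF T card]
    proof eventually_elim
      case (elim y)
      have det: "det (\<chi> i. T (y $ i, 1)) \<noteq> 0" using elim by (auto simp: height_det_def)
      have Sz: "(\<lambda>z::(real, 'o) vec. ?H (\<chi> i. S (y $ i, z $ i))) \<in> borel_measurable borel"
        by (rule measurable_compose[OF _ Hm]) measurable
      have "(\<integral>\<^sup>+z. ?H (\<chi> i. S (y $ i, z $ i)) \<partial>(lborel :: (real, 'o) vec measure)) =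
         ennreal (height_det T y) * (\<integral>\<^sup>+c. ?H (\<chi> i. S (y $ i, fst c \<bullet> y $ i + snd c)) \<partial>lborel)"
        unfolding nn_integral_heights_eq_hyperplanes[OF T det Sz] height_det_def
        by (simp only: vec_lambda_beta)
      also have "(\<integral>\<^sup>+c. ?H (\<chi> i. S (y $ i, fst c \<bullet> y $ i + snd c)) \<partial>lborel) =
        (\<integral>\<^sup>+c. ?g y c \<partial>lborel)"
      proof (rule nn_integral_cong)
        fix c :: "'b \<times> real"
        let ?x = "\<lambda>i. (y $ i, fst c \<bullet> y $ i + snd c)"
        let ?q = "\<lambda>p. ennreal (max 0 (1 - height_det T y * \<bar>snd p - (fst c \<bullet> fst p + snd c)\<bar> / fact (DIM('b) + 1)) ^ r)"
        have ind: "(\<Prod>i\<in>UNIV. indicator K ((\<chi> i. S (?x i)) $ i)) = (\<Prod>i\<in>UNIV. indicator (S -` K) (?x i) :: ennreal)"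
          by (simp add: indicator_def)
        show "?H (\<chi> i. S (?x i)) = (\<Prod>i\<in>UNIV. indicator (S -` K) (?x i)) * (\<integral>\<^sup>+p. indicator (S -` K) p * ?q p \<partial>lborel)"
        proof (cases "\<forall>i. S (?x i) \<in> K")
          \<comment> \<open>With a vertex outside the body both sides vanish, so the volume formula
            is needed only for simplices inside it.\<close>
          case False
          then obtain i where "S (?x i) \<notin> K" by auto
          then have "(\<Prod>i\<in>UNIV. indicator (S -` K) (?x i)) = (0 :: ennreal)"
            by (intro prod_zero bexI[of _ i]) (auto simp: indicator_def)
          then show ?thesis unfolding ind by (simp only: mult_zero_left mult_zero_right)
        next
          case True
          have nth: "($) (\<chi> i. S (?x i)) = (\<lambda>i. S (?x i))" by (rule ext) simp
          have "?F (($) (\<chi> i. S (?x i))) = (\<integral>\<^sup>+p. ?\<phi> (\<lambda>i. S (?x i)) p * indicator K p \<partial>lborel)"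
            unfolding nth unfolding U_def using \<phi>m'[unfolded U_def] one
            by (subst nn_integral_uniform_measure) (auto simp: divide_ennreal_def)
          also have "\<dots> = (\<integral>\<^sup>+p. ?\<phi> (\<lambda>i. S (?x i)) (S p) * indicator K (S p) \<partial>lborel)"
            by (rule nn_integral_lborel_Basis_bij[OF S borel_measurable_times_ennreal[OF \<phi>m' borel_measurable_indicator]])
              (rule K_borel)
          also have "\<dots> = (\<integral>\<^sup>+p. indicator (S -` K) p * ?q p \<partial>lborel)"
          proof (rule nn_integral_cong)
            fix p :: "'b \<times> real"
            show "?\<phi> (\<lambda>i. S (?x i)) (S p) * indicator K (S p) = indicator (S -` K) p * ?q p"
            proof (cases "S p \<in> K")
              case pK: True
              let ?C = "convex hull (insert p (range ?x))"
              have im: "insert (S p) (range (\<lambda>i. S (?x i))) = S ` insert p (range ?x)" by auto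
              have "ennreal (measure U (convex hull (insert (S p) (range (\<lambda>i. S (?x i)))))) =
                 ennreal (measure lborel (convex hull (insert (S p) (range (\<lambda>i. S (?x i))))))"
                using emeasure_U_hull[of "insert (S p) (range (\<lambda>i. S (?x i)))"] True pK one
                by (auto simp: U.emeasure_eq_measure divide_ennreal_def image_subset_iff)
              then have "measure U (convex hull (insert (S p) (range (\<lambda>i. S (?x i))))) =
                 measure lborel (convex hull (insert (S p) (range (\<lambda>i. S (?x i)))))" by simp
              also have "\<dots> = measure lborel (S ` ?C)" unfolding im convex_hull_linear_image[OF S(1)] ..
              also have "\<dots> = measure lborel ?C"
                by (rule measure_lborel_Basis_bij_image[OF S]) (simp add: finite_imp_compact_convex_hull)
              also have "\<dots> = measure lborel (convex hull (range (($) y))) * \<bar>snd p - (fst c \<bullet> fst p + snd c)\<bar> / (DIM('b) + 1)"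
                using measure_simplex_over_graph[of "fst p" "snd p" "($) y" "fst c" "snd c"] by simp
              also have "\<dots> = height_det T y * \<bar>snd p - (fst c \<bullet> fst p + snd c)\<bar> / fact (DIM('b) + 1)"
                unfolding measure_simplex_height_det[OF T card elim] by (simp add: mult.commute)
              finally have eq: "measure U (convex hull (insert (S p) (range (\<lambda>i. S (?x i))))) =
                height_det T y * \<bar>snd p - (fst c \<bullet> fst p + snd c)\<bar> / fact (DIM('b) + 1)" .
              \<comment> \<open>The truncation by \<open>max 0\<close> is inactive here: the
                subtracted term is a probability.\<close>
              have "measure U (convex hull (insert (S p) (range (\<lambda>i. S (?x i))))) \<le> 1" by simp
              then have "height_det T y * \<bar>snd p - (fst c \<bullet> fst p + snd c)\<bar> / fact (DIM('b) + 1) \<le> 1" unfolding eq .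
              then show ?thesis unfolding eq using pK by (simp add: max_def)
            qed (simp add: indicator_def)
          qed
          finally have F: "?F (($) (\<chi> i. S (?x i))) = (\<integral>\<^sup>+p. indicator (S -` K) p * ?q p \<partial>lborel)" .
          show ?thesis unfolding F ind by (rule mult.commute)
        qed
      qed
      finally show ?case .
    qed
  qed
  finally show ?thesis .
qed

end

subsection \<open>Hyperplane sections\<close>

text \<open>In direction \<open>k\<close> the strip cuts out an interval of length at most
  \<open>2 * R / \<bar>a \<bullet> k\<bar>\<close>, and the cube one of length at most
  \<open>2 * R\<close>; the smaller bound explains \<open>max 1\<close>. Each other coordinate
  contributes \<open>2 * R\<close>.\<close>

lemma emeasure_cube_strip_le:
  fixes a k :: "'b::euclidean_space"
  assumes k: "k \<in> Basis" and R: "R > 0"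
  shows "(\<integral>\<^sup>+x. indicator {x. (\<forall>b\<in>Basis. \<bar>x \<bullet> b\<bar> \<le> R) \<and> \<bar>a \<bullet> x + t\<bar> \<le> R} x \<partial>lborel) \<le>
    ennreal ((2 * R) ^ DIM('b) / max 1 \<bar>a \<bullet> k\<bar>)"
proof -
  interpret product_sigma_finite "\<lambda>_. lborel :: real measure" by standard
  let ?A = "{x. (\<forall>b\<in>Basis. \<bar>x \<bullet> b\<bar> \<le> R) \<and> \<bar>a \<bullet> x + t\<bar> \<le> R}"
  let ?B = "Basis - {k}"
  let ?s = "\<lambda>f. \<Sum>b\<in>Basis. f b *\<^sub>R b :: 'b"
  have [measurable]: "?A \<in> sets borel" by measurable
  have insB: "insert k ?B = Basis" using k by auto
  have sm: "?s \<in> PiM Basis (\<lambda>_. lborel) \<rightarrow>\<^sub>M borel" by measurable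
  have sb: "?s f \<bullet> b = f b" if "b \<in> Basis" for f b
    using that by (simp add: inner_sum_left inner_Basis if_distrib cong: if_cong)
  have inner: "(\<integral>\<^sup>+y. indicator ?A (?s (f(k := y))) \<partial>lborel) \<le>
      (\<Prod>b\<in>?B. indicator {-R..R} (f b)) * ennreal (2 * R / max 1 \<bar>a \<bullet> k\<bar>)" for f
  proof -
    let ?P = "(\<Prod>b\<in>?B. indicator {-R..R} (f b))"
    define \<alpha> where "\<alpha> = a \<bullet> k"
    define \<beta> where "\<beta> = (\<Sum>b\<in>?B. f b * (a \<bullet> b)) + t"
    let ?Y = "{y. \<bar>y\<bar> \<le> R \<and> \<bar>\<alpha> * y + \<beta>\<bar> \<le> R}"
    have as: "a \<bullet> ?s (f(k := y)) + t = \<alpha> * y + \<beta>" for y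
    proof -
      have "a \<bullet> ?s (f(k := y)) = (\<Sum>b\<in>Basis. (f(k := y)) b * (a \<bullet> b))" by (simp add: inner_sum_right)
      also have "\<dots> = y * (a \<bullet> k) + (\<Sum>b\<in>?B. f b * (a \<bullet> b))"
        using k by (subst sum.remove[OF _ k]) auto
      finally show ?thesis by (simp add: \<alpha>_def \<beta>_def)
    qed
    have "indicator ?A (?s (f(k := y))) \<le> ?P * (indicator ?Y y :: ennreal)" for y
    proof (cases "?s (f(k := y)) \<in> ?A")
      case True
      then have "\<forall>b\<in>Basis. \<bar>(f(k := y)) b\<bar> \<le> R" "\<bar>\<alpha> * y + \<beta>\<bar> \<le> R" using sb as by auto
      then have "\<bar>f b\<bar> \<le> R" if "b \<in> ?B" for b
        using that by (auto dest!: bspec[of _ _ b])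
      moreover have "\<bar>y\<bar> \<le> R" using \<open>\<forall>b\<in>Basis. \<bar>(f(k := y)) b\<bar> \<le> R\<close> k by (auto dest!: bspec[of _ _ k])
      ultimately have "?P = (1 :: ennreal)"
        by (intro prod.neutral) (fastforce simp: indicator_def abs_le_iff)
      then show ?thesis using True \<open>\<bar>y\<bar> \<le> R\<close> \<open>\<bar>\<alpha> * y + \<beta>\<bar> \<le> R\<close> by simp
    qed simp
    then have "(\<integral>\<^sup>+y. indicator ?A (?s (f(k := y))) \<partial>lborel) \<le>
      (\<integral>\<^sup>+y. ?P * indicator ?Y y \<partial>lborel)"
      by (rule nn_integral_mono)
    also have "\<dots> = ?P * emeasure lborel ?Y"
      by (subst nn_integral_cmult) (auto simp: nn_integral_indicator)
    also have "emeasure lborel ?Y \<le> ennreal (2 * R / max 1 \<bar>\<alpha>\<bar>)"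
    proof (cases "\<bar>\<alpha>\<bar> \<le> 1")
      case True
      have "emeasure lborel ?Y \<le> emeasure lborel {-R..R}"
        by (intro emeasure_mono) auto
      then show ?thesis using True R by (simp add: max_def)
    next
      case False
      then have a0: "\<alpha> \<noteq> 0" by auto
      let ?c = "- \<beta> / \<alpha>" and ?r = "R / \<bar>\<alpha>\<bar>"
      have "?Y \<subseteq> {?c - ?r..?c + ?r}"
      proof
        fix y assume "y \<in> ?Y"
        then have "\<bar>\<alpha> * y + \<beta>\<bar> \<le> R" by simp
        moreover have "\<bar>\<alpha> * y + \<beta>\<bar> = \<bar>\<alpha>\<bar> * \<bar>y - ?c\<bar>" using a0 by (simp add: abs_mult[symmetric] field_simps)
        ultimately have "\<bar>y - ?c\<bar> \<le> ?r" using a0 by (simp add: pos_le_divide_eq mult.commute)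
        then show "y \<in> {?c - ?r..?c + ?r}" by (simp add: abs_le_iff)
      qed
      then have "emeasure lborel ?Y \<le> emeasure lborel {?c - ?r..?c + ?r}"
        by (intro emeasure_mono) auto
      also have "\<dots> = ennreal (2 * R / max 1 \<bar>\<alpha>\<bar>)" using R False by (simp add: max_def)
      finally show ?thesis .
    qed
    finally show ?thesis by (simp add: \<alpha>_def mult_left_mono)
  qed
  have "(\<integral>\<^sup>+x. indicator ?A x \<partial>lborel) = (\<integral>\<^sup>+f. indicator ?A (?s f) \<partial>PiM (insert k ?B) (\<lambda>_. lborel))"
  proof -
    have "(\<integral>\<^sup>+x. indicator ?A x \<partial>distr (PiM Basis (\<lambda>_. lborel)) borel ?s) = (\<integral>\<^sup>+f. indicator ?A (?s f) \<partial>PiM Basis (\<lambda>_. lborel))"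
      using \<open>?A \<in> sets borel\<close> by (intro nn_integral_distr[OF sm] borel_measurable_indicator) simp
    then show ?thesis unfolding insB by (simp only: lborel_eq[symmetric])
  qed
  also have "\<dots> = (\<integral>\<^sup>+f. \<integral>\<^sup>+y. indicator ?A (?s (f(k := y))) \<partial>lborel \<partial>PiM ?B (\<lambda>_. lborel))"
  proof (rule product_nn_integral_insert)
    show "(\<lambda>f. indicator ?A (?s f)) \<in> borel_measurable (PiM (insert k ?B) (\<lambda>_. lborel))"
      unfolding insB by (rule measurable_compose[OF sm]) simp
  qed auto
  also have "\<dots> \<le> (\<integral>\<^sup>+f. (\<Prod>b\<in>?B. indicator {-R..R} (f b)) * ennreal (2 * R / max 1 \<bar>a \<bullet> k\<bar>) \<partial>PiM ?B (\<lambda>_. lborel))"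
    by (intro nn_integral_mono inner)
  also have "\<dots> = (\<integral>\<^sup>+f. (\<Prod>b\<in>?B. indicator {-R..R} (f b)) \<partial>PiM ?B (\<lambda>_. lborel)) * ennreal (2 * R / max 1 \<bar>a \<bullet> k\<bar>)"
    by (intro nn_integral_multc) measurable
  also have "(\<integral>\<^sup>+f. (\<Prod>b\<in>?B. indicator {-R..R} (f b)) \<partial>PiM ?B (\<lambda>_. lborel)) = (\<Prod>b\<in>?B. ennreal (2 * R))"
    using R by (subst product_nn_integral_prod) auto
  also have "\<dots> * ennreal (2 * R / max 1 \<bar>a \<bullet> k\<bar>) = ennreal ((2 * R) ^ DIM('b) / max 1 \<bar>a \<bullet> k\<bar>)"
  proof -
    have "(\<Prod>b\<in>?B. ennreal (2 * R)) = ennreal ((2 * R) ^ (DIM('b) - 1))"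
      using k R by (simp add: ennreal_power)
    moreover have "(2 * R) ^ (DIM('b) - 1) * (2 * R) = (2 * R) ^ DIM('b)"
      by (rule power_minus_mult) simp
    ultimately show ?thesis using R by (simp only: ennreal_mult''[symmetric] divide_nonneg_nonneg zero_le_power
      less_imp_le mult_nonneg_nonneg zero_le_numeral max.coboundedI1 zero_le_one times_divide_eq_right)
  qed
  finally show ?thesis .
qed

lemma nn_integral_inverse_max_powr_finite:
  assumes p: "p > 1"
  shows "(\<integral>\<^sup>+t. ennreal ((1 / max 1 \<bar>t\<bar>) powr p) \<partial>lborel) < \<infinity>"
proof -
  let ?h = "\<lambda>t::real. ennreal (t powr - p) * indicator {1..} t"
  have hm: "(\<lambda>t::real. t powr - p) \<in> borel_measurable borel" by measurable
  have "(\<integral>\<^sup>+t. ?h t \<partial>lborel) = ennreal (0 - 1 powr (1 - p) / (1 - p))"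
  proof (rule nn_integral_FTC_atLeast[OF hm, where F = "\<lambda>x. x powr (1 - p) / (1 - p)"])
    fix x :: real assume "1 \<le> x"
    then show "((\<lambda>x. x powr (1 - p) / (1 - p)) has_real_derivative x powr - p) (at x)"
      using p by (auto intro!: derivative_eq_intros)
  next
    have "((\<lambda>x::real. x powr (1 - p)) \<longlongrightarrow> 0) at_top" using p by (intro tendsto_neg_powr filterlim_ident) auto
    from tendsto_divide[OF this tendsto_const[of "1 - p"]] p
    show "((\<lambda>x::real. x powr (1 - p) / (1 - p)) \<longlongrightarrow> 0) at_top" by simp
  qed simp
  then have h: "(\<integral>\<^sup>+t. ?h t \<partial>lborel) < \<infinity>" by simp
  have "(\<integral>\<^sup>+t. ?h t \<partial>lborel) = (\<integral>\<^sup>+t. ?h (- t) \<partial>lborel)"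
    using nn_integral_real_affine[of ?h "-1" 0] by simp
  then have h': "(\<integral>\<^sup>+t. ?h (- t) \<partial>lborel) < \<infinity>" using h by simp
  have "(\<integral>\<^sup>+t. ennreal ((1 / max 1 \<bar>t\<bar>) powr p) \<partial>lborel) \<le> (\<integral>\<^sup>+t. indicator {-1..1} t + (?h t + ?h (- t)) \<partial>lborel)"
  proof (rule nn_integral_mono)
    fix t :: real
    have pw: "(1 / s) powr p = s powr - p" if "s > 0" for s
      using that by (simp add: powr_minus powr_divide inverse_eq_divide)
    consider "\<bar>t\<bar> \<le> 1" | "t > 1" | "t < -1" by linarith
    then show "ennreal ((1 / max 1 \<bar>t\<bar>) powr p) \<le> indicator {-1..1} t + (?h t + ?h (- t))"
    proof cases
      case 1
      then have "indicator {-1..1} t = (1 :: ennreal)" by (auto simp: indicator_def)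
      moreover have "ennreal ((1 / max 1 \<bar>t\<bar>) powr p) = 1" using 1 by (simp add: max_def)
      ultimately show ?thesis by simp
    next
      case 2
      then have "(1 / max 1 \<bar>t\<bar>) powr p = t powr - p" using pw[of t] by (simp add: max_def)
      then show ?thesis using 2 by simp
    next
      case 3
      then have "max 1 \<bar>t\<bar> = - t" by simp
      then have "(1 / max 1 \<bar>t\<bar>) powr p = (- t) powr - p" using pw[of "- t"] 3 by simp
      then show ?thesis using 3 by simp
    qed
  qed
  also have "\<dots> = 2 + ((\<integral>\<^sup>+t. ?h t \<partial>lborel) + (\<integral>\<^sup>+t. ?h (- t) \<partial>lborel))"
    by (subst nn_integral_add, simp, simp, subst nn_integral_add) auto
  also have "\<dots> < \<infinity>" using h h' by simp
  finally show ?thesis .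
qed

definition slice_bound :: "real \<Rightarrow> 'b::euclidean_space \<Rightarrow> real" where
  "slice_bound R a = (2 * R) ^ DIM('b) * (\<Prod>b\<in>Basis. (1 / max 1 \<bar>a \<bullet> b\<bar>) powr (1 / DIM('b)))"

lemma borel_measurable_slice_bound [measurable]: "slice_bound R \<in> borel_measurable borel"
  unfolding slice_bound_def[abs_def] by measurable

text \<open>The geometric mean over the coordinates makes the bound a product; the exponent
  \<open>DIM('b) + 1\<close> is just large enough for integrability.\<close>

lemma nn_integral_slice_bound_finite:
  assumes R: "R > 0"
  shows "(\<integral>\<^sup>+a. ennreal (slice_bound R a) ^ (DIM('b) + 1) \<partial>(lborel :: 'b::euclidean_space measure)) < \<infinity>"
proof -
  let ?m = "DIM('b)"
  \<comment> \<open>The exponent left for each coordinate, \<open>1 / ?m\<close> times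
    \<open>?m + 1\<close>; it exceeds 1, so the one-dimensional integrals converge.\<close>
  let ?p = "1 + 1 / real ?m"
  have eq: "ennreal (slice_bound R a) ^ (?m + 1) =
     ennreal (((2 * R) ^ ?m) ^ (?m + 1)) * ennreal (\<Prod>b\<in>Basis. (1 / max 1 \<bar>a \<bullet> b\<bar>) powr ?p)" for a :: 'b
  proof -
    have "((1 / max 1 \<bar>a \<bullet> b\<bar>) powr (1 / real ?m)) ^ (?m + 1) = (1 / max 1 \<bar>a \<bullet> b\<bar>) powr ?p" for b
    proof -
      have "0 < 1 / max 1 \<bar>a \<bullet> b\<bar>" by simp
      then have "((1 / max 1 \<bar>a \<bullet> b\<bar>) powr (1 / real ?m)) ^ (?m + 1) = (1 / max 1 \<bar>a \<bullet> b\<bar>) powr (1 / real ?m * real (?m + 1))"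
        by (simp only: powr_powr powr_realpow[symmetric] powr_gt_zero)
      also have "1 / real ?m * real (?m + 1) = ?p" by (simp add: field_simps)
      finally show ?thesis .
    qed
    then have "slice_bound R a ^ (?m + 1) = ((2 * R) ^ ?m) ^ (?m + 1) * (\<Prod>b\<in>Basis. (1 / max 1 \<bar>a \<bullet> b\<bar>) powr ?p)"
      unfolding slice_bound_def power_mult_distrib prod_power_distrib by simp
    moreover have "0 \<le> slice_bound R a" using R by (simp add: slice_bound_def prod_nonneg)
    ultimately show ?thesis using R by (simp add: ennreal_power ennreal_mult'[symmetric])
  qed
  have "(\<integral>\<^sup>+a. ennreal (slice_bound R a) ^ (?m + 1) \<partial>(lborel :: 'b measure)) =
     ennreal (((2 * R) ^ ?m) ^ (?m + 1)) * (\<integral>\<^sup>+a. ennreal (\<Prod>b\<in>Basis. (1 / max 1 \<bar>a \<bullet> b\<bar>) powr ?p) \<partial>(lborel :: 'b measure))"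
    unfolding eq by (rule nn_integral_cmult) measurable
  also have "(\<integral>\<^sup>+a. ennreal (\<Prod>b\<in>Basis. (1 / max 1 \<bar>a \<bullet> b\<bar>) powr ?p) \<partial>(lborel :: 'b measure)) =
     (\<integral>\<^sup>+a. (\<Prod>b\<in>Basis. ennreal ((1 / max 1 \<bar>a \<bullet> b\<bar>) powr ?p)) \<partial>(lborel :: 'b measure))"
    by (simp add: prod_ennreal)
  also have "\<dots> = (\<Prod>b\<in>(Basis :: 'b set). \<integral>\<^sup>+t. ennreal ((1 / max 1 \<bar>t\<bar>) powr ?p) \<partial>lborel)"
    by (subst nn_integral_lborel_prod) auto
  finally have "(\<integral>\<^sup>+a. ennreal (slice_bound R a) ^ (?m + 1) \<partial>(lborel :: 'b measure)) =
    ennreal (((2 * R) ^ ?m) ^ (?m + 1)) * (\<Prod>b\<in>(Basis :: 'b set). \<integral>\<^sup>+t. ennreal ((1 / max 1 \<bar>t\<bar>) powr ?p) \<partial>lborel)" .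
  moreover have "(\<Prod>b\<in>(Basis :: 'b set). \<integral>\<^sup>+t. ennreal ((1 / max 1 \<bar>t\<bar>) powr ?p) \<partial>lborel) < \<infinity>"
    using nn_integral_inverse_max_powr_finite[of ?p] by (simp add: power_less_top_ennreal)
  ultimately show ?thesis by (simp only: ennreal_mult_less_top infinity_ennreal_def) simp
qed

text \<open>The strip estimate is used in the coordinate where its factor is smallest, and a
  smallest factor is at most the geometric mean of all of them.\<close>

lemma slice_le_slice_bound:
  fixes C :: "('b::euclidean_space \<times> real) set"
  assumes R: "R > 0" and C: "\<And>x z b. (x, z) \<in> C \<Longrightarrow> b \<in> Basis \<Longrightarrow> \<bar>x \<bullet> b\<bar> \<le> R" "\<And>x z. (x, z) \<in> C \<Longrightarrow> \<bar>z\<bar> \<le> R"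
  shows "(\<integral>\<^sup>+x. indicator C (x, a \<bullet> x + t) \<partial>lborel) \<le> ennreal (slice_bound R a)"
proof -
  have "finite ((\<lambda>b. 1 / max 1 \<bar>a \<bullet> b\<bar>) ` (Basis :: 'b set))" "(\<lambda>b. 1 / max 1 \<bar>a \<bullet> b\<bar>) ` (Basis :: 'b set) \<noteq> {}" by auto
  from Min_in[OF this] obtain k :: 'b where k: "k \<in> Basis" "1 / max 1 \<bar>a \<bullet> k\<bar> = Min ((\<lambda>b. 1 / max 1 \<bar>a \<bullet> b\<bar>) ` Basis)"
    by (metis (no_types, lifting) imageE)
  then have mn: "1 / max 1 \<bar>a \<bullet> k\<bar> \<le> 1 / max 1 \<bar>a \<bullet> b\<bar>" if "b \<in> Basis" for b using that by simp
  have "(\<integral>\<^sup>+x. indicator C (x, a \<bullet> x + t) \<partial>lborel) \<le>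
     (\<integral>\<^sup>+x. indicator {x. (\<forall>b\<in>Basis. \<bar>x \<bullet> b\<bar> \<le> R) \<and> \<bar>a \<bullet> x + t\<bar> \<le> R} x \<partial>lborel)"
    using C by (intro nn_integral_mono) (auto simp: indicator_def)
  also have "\<dots> \<le> ennreal ((2 * R) ^ DIM('b) / max 1 \<bar>a \<bullet> k\<bar>)" by (rule emeasure_cube_strip_le[OF k(1) R])
  also have "\<dots> \<le> ennreal (slice_bound R a)"
  proof (rule ennreal_leI)
    have "1 / max 1 \<bar>a \<bullet> k\<bar> = (1 / max 1 \<bar>a \<bullet> k\<bar>) powr (1 / DIM('b) * DIM('b))" by simp
    also have "\<dots> = (\<Prod>b\<in>(Basis :: 'b set). (1 / max 1 \<bar>a \<bullet> k\<bar>) powr (1 / DIM('b)))"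
      by (simp only: prod_constant powr_powr[symmetric] powr_realpow powr_gt_zero) (simp add: powr_realpow)
    also have "\<dots> \<le> (\<Prod>b\<in>Basis. (1 / max 1 \<bar>a \<bullet> b\<bar>) powr (1 / DIM('b)))"
      by (intro prod_mono conjI powr_mono2 mn) auto
    finally show "(2 * R) ^ DIM('b) / max 1 \<bar>a \<bullet> k\<bar> \<le> slice_bound R a"
      using R unfolding slice_bound_def by (metis (no_types, lifting) divide_inverse inverse_eq_divide mult_left_mono zero_le_power less_imp_le mult_pos_pos zero_less_numeral)
  qed
  finally show ?thesis .
qed

lemma nn_integral_lborel_pair:
  assumes "f \<in> borel_measurable (borel :: ('a::euclidean_space \<times> 'b::euclidean_space) measure)"
  shows "(\<integral>\<^sup>+w. f w \<partial>lborel) = (\<integral>\<^sup>+x. \<integral>\<^sup>+y. f (x, y) \<partial>lborel \<partial>lborel)"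
  using lborel.nn_integral_fst[of f lborel] assms by (simp add: lborel_prod)

lemma nn_integral_lborel_swap:
  assumes "(\<lambda>(x, y). f x y) \<in> borel_measurable (borel :: ('a::euclidean_space \<times> 'b::euclidean_space) measure)"
  shows "(\<integral>\<^sup>+x. \<integral>\<^sup>+y. f x y \<partial>lborel \<partial>lborel) = (\<integral>\<^sup>+y. \<integral>\<^sup>+x. f x y \<partial>lborel \<partial>lborel)"
  by (rule lborel_pair.Fubini'[symmetric]) (use assms in \<open>simp add: lborel_prod\<close>)

lemma nn_integral_exp_abs:
  assumes k: "k > 0"
  shows "(\<integral>\<^sup>+s. ennreal (exp (- (k * \<bar>s\<bar>))) \<partial>lborel) = ennreal (2 / k)"
proof -
  let ?h = "\<lambda>t::real. ennreal (exp (- (k * t))) * indicator {0..} t"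
  have "(\<integral>\<^sup>+t. ?h t \<partial>lborel) = ennreal (0 - (- exp (- (k * 0)) / k))"
  proof (rule nn_integral_FTC_atLeast[where F = "\<lambda>t. - exp (- (k * t)) / k"])
    show "((\<lambda>t. - exp (- (k * t)) / k) \<longlongrightarrow> 0) at_top"
    proof -
      have "filterlim (\<lambda>t. k * t) at_top at_top" using k by (intro filterlim_tendsto_pos_mult_at_top[OF tendsto_const]) (auto simp: filterlim_ident)
      then have "((\<lambda>t. exp (- (k * t))) \<longlongrightarrow> 0) at_top"
        by (intro filterlim_compose[OF exp_at_bot]) (simp add: filterlim_uminus_at_top[symmetric])
      from tendsto_divide[OF tendsto_minus[OF this] tendsto_const[of k]] k show ?thesis by simp
    qed
  qed (use k in \<open>auto intro!: derivative_eq_intros\<close>)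
  then have h: "(\<integral>\<^sup>+t. ?h t \<partial>lborel) = ennreal (1 / k)" by simp
  have h': "(\<integral>\<^sup>+t. ?h (- t) \<partial>lborel) = ennreal (1 / k)"
    using nn_integral_real_affine[of ?h "-1" 0] h by simp
  have "(\<integral>\<^sup>+s. ennreal (exp (- (k * \<bar>s\<bar>))) \<partial>lborel) = (\<integral>\<^sup>+s. ?h s + ?h (- s) \<partial>lborel)"
  proof (rule nn_integral_cong_AE)
    show "AE s in lborel. ennreal (exp (- (k * \<bar>s\<bar>))) = ?h s + ?h (- s)"
      using AE_lborel_singleton[of 0]
    proof eventually_elim
      case (elim s)
      then show ?case by (cases "s < 0") (auto simp: indicator_def)
    qed
  qed
  also have "\<dots> = ennreal (1 / k) + ennreal (1 / k)"
    by (subst nn_integral_add, simp, simp, simp only: h h')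
  also have "\<dots> = ennreal (2 / k)" using k by (simp add: ennreal_plus[symmetric] del: ennreal_plus)
  finally show ?thesis .
qed

text \<open>For fixed slope \<open>a\<close>, the vertical translates of one hyperplane fill the
  space, and a vertical shift preserves measure. The result is applied to the body, and to its
  frontier to see that almost all sections of it are null.\<close>

lemma emeasure_eq_slices:
  fixes B :: "('b::euclidean_space \<times> real) set"
  assumes [measurable]: "B \<in> sets borel"
  shows "(\<integral>\<^sup>+t. \<integral>\<^sup>+x. indicator B (x, a \<bullet> x + t) \<partial>lborel \<partial>lborel) = emeasure lborel B"
proof -
  have "(\<integral>\<^sup>+t. \<integral>\<^sup>+x. indicator B (x, a \<bullet> x + t) \<partial>lborel \<partial>lborel) =
     (\<integral>\<^sup>+x. \<integral>\<^sup>+t. indicator B (x, a \<bullet> x + t) \<partial>lborel \<partial>lborel)"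
    by (rule nn_integral_lborel_swap) measurable
  also have "\<dots> = (\<integral>\<^sup>+x. \<integral>\<^sup>+t. indicator B (x, t) \<partial>lborel \<partial>lborel)"
  proof (rule nn_integral_cong)
    fix x :: 'b
    have "(\<lambda>t. indicator B (x, t) :: ennreal) \<in> borel_measurable borel" by measurable
    from nn_integral_real_affine[OF this, of 1 "a \<bullet> x"]
    show "(\<integral>\<^sup>+t. indicator B (x, a \<bullet> x + t) \<partial>lborel) = (\<integral>\<^sup>+t. indicator B (x, t) \<partial>lborel)" by simp
  qed
  also have "\<dots> = (\<integral>\<^sup>+w. indicator B w \<partial>lborel)" by (rule nn_integral_lborel_pair[symmetric]) simp
  finally show ?thesis by simp
qed

subsection \<open>The limit of the hole integrals\<close>

text \<open>The body in coordinates of base times height. A pair \<open>c = (a, t)\<close> stands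
  for the hyperplane over the base with slope \<open>a\<close> and offset \<open>t\<close>.\<close>

locale sliced_body =
  fixes C :: "('b::euclidean_space \<times> real) set" and T :: "'b \<times> real \<Rightarrow> (real, 'o::{finite,wellorder}) vec"
  assumes compact_C: "compact C" and convex_C: "convex C"
    and lin_T: "linear T" and bij_T: "bij_betw T Basis Basis" and card_o: "CARD('o) = DIM('b) + 1"
begin

text \<open>The \<open>\<bar>L\<bar>\<close> of the overview. The section is measured after vertical
  projection, so its own volume is larger by the factor
  \<open>sqrt (1 + (norm a)^2)\<close>.\<close>

definition slice :: "'b \<times> real \<Rightarrow> ennreal" where
  "slice c = (\<integral>\<^sup>+x. indicator C (x, fst c \<bullet> x + snd c) \<partial>lborel)"

definition on_slice :: "('b, 'o) vec \<Rightarrow> 'b \<times> real \<Rightarrow> ennreal" where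
  "on_slice y c = (\<Prod>i\<in>UNIV. indicator C (y $ i, fst c \<bullet> y $ i + snd c))"

abbreviation (input) empty_prob :: "nat \<Rightarrow> ('b, 'o) vec \<Rightarrow> 'b \<times> real \<Rightarrow> 'b \<times> real \<Rightarrow> ennreal" where
  "empty_prob r y c p \<equiv> ennreal (max 0 (1 - height_det T y * \<bar>snd p - (fst c \<bullet> fst p + snd c)\<bar> / fact (DIM('b) + 1)) ^ r)"

abbreviation (input) avoid :: "nat \<Rightarrow> ('b, 'o) vec \<Rightarrow> 'b \<times> real \<Rightarrow> ennreal" where
  "avoid r y c \<equiv> \<integral>\<^sup>+p. indicator C p * empty_prob r y c p \<partial>lborel"

text \<open>The right-hand side of \<open>hole_integral_eq\<close>, with \<open>C\<close> for the
  preimage of the body; \<open>r\<close> counts the points that are not vertices.\<close>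

definition hole_integral :: "nat \<Rightarrow> ennreal" where
  "hole_integral r = (\<integral>\<^sup>+y. ennreal (height_det T y) * (\<integral>\<^sup>+c. on_slice y c *
     avoid r y c \<partial>lborel) \<partial>lborel)"

lemma C_borel [measurable]: "C \<in> sets borel" using compact_C by (simp add: borel_compact)

lemma D_measurable [measurable]: "height_det T \<in> borel_measurable borel"
  by (rule borel_measurable_height_det[OF lin_T])

lemma slice_measurable [measurable]: "slice \<in> borel_measurable borel"
  unfolding slice_def[abs_def] by measurable

lemma on_slice_measurable [measurable (raw)]:
  assumes [measurable]: "f \<in> borel_measurable M" "h \<in> borel_measurable M"
  shows "(\<lambda>w. on_slice (f w) (h w)) \<in> borel_measurable M"
  unfolding on_slice_def by measurable

lemma on_slice_le_1: "on_slice y c \<le> 1"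
  unfolding on_slice_def by (intro prod_le_1) (auto simp: indicator_def)

lemma nn_integral_on_slice: "(\<integral>\<^sup>+y. on_slice y c \<partial>lborel) = slice c ^ (DIM('b) + 1)"
proof -
  have "(\<lambda>x. indicator C (x, fst c \<bullet> x + snd c) :: ennreal) \<in> borel_measurable borel" by measurable
  from nn_integral_lborel_vec_prod[OF this, where 'o='o]
  show ?thesis by (simp add: on_slice_def slice_def card_o)
qed

lemma slice_integral: "(\<integral>\<^sup>+t. slice (a, t) \<partial>lborel) = emeasure lborel C"
  using emeasure_eq_slices[OF C_borel, of a] by (simp add: slice_def)

lemma bounded_C: obtains R where "R > 0" "\<And>x z b. (x, z) \<in> C \<Longrightarrow> b \<in> Basis \<Longrightarrow> \<bar>x \<bullet> b\<bar> \<le> R" "\<And>x z. (x, z) \<in> C \<Longrightarrow> \<bar>z\<bar> \<le> R"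
proof -
  obtain R where R: "R > 0" "\<And>w. w \<in> C \<Longrightarrow> norm w \<le> R"
    using compact_imp_bounded[OF compact_C] by (auto simp: bounded_pos)
  show ?thesis
  proof (rule that[OF R(1)])
    fix x z and b :: 'b assume "(x, z) \<in> C"
    then have n: "norm x \<le> R" "\<bar>z\<bar> \<le> R"
      using R(2)[of "(x, z)"] norm_fst_le[of x z] norm_snd_le[of z x] by auto
    show "\<bar>z\<bar> \<le> R" by (rule n(2))
    assume "b \<in> Basis"
    then show "\<bar>x \<bullet> b\<bar> \<le> R" using Basis_le_norm[of b x] n(1) by linarith
  qed
qed

text \<open>The frontier of \<open>C\<close> is null, so almost every hyperplane meets it in a set
  with null projection. Off the frontier the indicator of \<open>C\<close> is locally constant, and
  a bounding box dominates. One null set of hyperplanes serves all \<open>s\<close>.\<close>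

lemma slice_tendsto:
  "AE c in lborel. \<forall>s. (\<lambda>r. slice (fst c, snd c + s / real r)) \<longlonglongrightarrow> slice c"
proof -
  let ?N = "frontier C"
  have "?N \<in> null_sets lebesgue" using negligible_convex_frontier[OF convex_C] by (simp add: negligible_iff_null_sets)
  then have N0: "emeasure lborel ?N = 0" by (simp add: null_sets_def)
  have Nm [measurable]: "?N \<in> sets borel" by simp
  have im: "(\<lambda>c. \<integral>\<^sup>+x. indicator ?N (x, fst c \<bullet> x + snd c) \<partial>lborel) \<in> borel_measurable (lborel :: ('b \<times> real) measure)"
    by measurable
  have "(\<integral>\<^sup>+c. \<integral>\<^sup>+x. indicator ?N (x, fst c \<bullet> x + snd c) \<partial>lborel \<partial>(lborel :: ('b \<times> real) measure)) =
     (\<integral>\<^sup>+a. \<integral>\<^sup>+t. \<integral>\<^sup>+x. indicator ?N (x, a \<bullet> x + t) \<partial>lborel \<partial>lborel \<partial>(lborel :: 'b measure))"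
    using im by (subst nn_integral_lborel_pair) simp_all
  also have "\<dots> = 0" unfolding emeasure_eq_slices[OF Nm] N0 by simp
  finally have "AE c in (lborel :: ('b \<times> real) measure). (\<integral>\<^sup>+x. indicator ?N (x, fst c \<bullet> x + snd c) \<partial>lborel) = 0"
    using im by (subst (asm) nn_integral_0_iff_AE)
  then show ?thesis
  proof eventually_elim
    case (elim c)
    have "AE x in lborel. indicator ?N (x, fst c \<bullet> x + snd c) = (0 :: ennreal)"
      using elim by (subst (asm) nn_integral_0_iff_AE) auto
    then have nf: "AE x in lborel. (x, fst c \<bullet> x + snd c) \<notin> ?N" by (auto elim!: eventually_mono simp: indicator_def)
    obtain R where R: "R > 0" "\<And>x z b. (x, z) \<in> C \<Longrightarrow> b \<in> Basis \<Longrightarrow> \<bar>x \<bullet> b\<bar> \<le> R"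
      using bounded_C by metis
    let ?B = "cbox (\<Sum>b\<in>Basis. (- R) *\<^sub>R b) (\<Sum>b\<in>Basis. R *\<^sub>R b) :: 'b set"
    have sub: "x \<in> ?B" if "(x, z) \<in> C" for x z
    proof -
      have e: "(\<Sum>b\<in>Basis. u *\<^sub>R b) \<bullet> b' = u" if "b' \<in> Basis" for u and b' :: 'b
        using that by (simp add: inner_sum_left inner_Basis if_distrib cong: if_cong)
      have b: "- R \<le> x \<bullet> b" "x \<bullet> b \<le> R" if "b \<in> Basis" for b
        using R(2)[OF \<open>(x, z) \<in> C\<close> that] by (auto simp: abs_le_iff)
      show ?thesis unfolding mem_box
      proof (intro ballI conjI)
        fix i :: 'b assume i: "i \<in> Basis"
        show "(\<Sum>b\<in>Basis. - R *\<^sub>R b) \<bullet> i \<le> x \<bullet> i" unfolding e[OF i] by (rule b(1)[OF i])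
        show "x \<bullet> i \<le> (\<Sum>b\<in>Basis. R *\<^sub>R b) \<bullet> i" unfolding e[OF i] by (rule b(2)[OF i])
      qed
    qed
    show ?case
    proof
      fix s
      show "(\<lambda>r. slice (fst c, snd c + s / real r)) \<longlonglongrightarrow> slice c"
        unfolding slice_def fst_conv snd_conv
      proof (rule nn_integral_dominated_convergence[where w = "indicator ?B"])
        show "(\<lambda>x. indicator C (x, fst c \<bullet> x + (snd c + s / real r)) :: ennreal) \<in> borel_measurable lborel" for r
          by measurable
        show "(\<lambda>x. indicator C (x, fst c \<bullet> x + snd c) :: ennreal) \<in> borel_measurable lborel"
          by measurable
        show "indicator ?B \<in> borel_measurable lborel" by (rule borel_measurable_indicator) simp
        show "AE x in lborel. indicator C (x, fst c \<bullet> x + (snd c + s / real r)) \<le> (indicator ?B x :: ennreal)" for r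
          using sub by (auto simp: indicator_def)
        show "(\<integral>\<^sup>+x. indicator ?B x \<partial>lborel) < \<infinity>" using emeasure_compact_finite[of ?B] by simp
        show "AE x in lborel. (\<lambda>r. indicator C (x, fst c \<bullet> x + (snd c + s / real r)) :: ennreal) \<longlonglongrightarrow> indicator C (x, fst c \<bullet> x + snd c)"
          using nf
        proof eventually_elim
          case (elim x)
          have lim: "(\<lambda>r. (x, fst c \<bullet> x + (snd c + s / real r))) \<longlonglongrightarrow> (x, fst c \<bullet> x + (snd c + 0))"
            by (intro tendsto_intros lim_const_over_n)
          show ?case
          proof (cases "(x, fst c \<bullet> x + snd c) \<in> C")
            case True
            then have "(x, fst c \<bullet> x + snd c) \<in> interior C"
              using elim closure_closed[OF compact_imp_closed[OF compact_C]] by (auto simp: frontier_def)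
            then have "\<forall>\<^sub>F r in sequentially. (x, fst c \<bullet> x + (snd c + s / real r)) \<in> interior C"
              using topological_tendstoD[OF lim open_interior, of C] by simp
            then have "\<forall>\<^sub>F r in sequentially. indicator C (x, fst c \<bullet> x + (snd c + s / real r)) = (indicator C (x, fst c \<bullet> x + snd c) :: ennreal)"
              by eventually_elim (use True interior_subset[of C] in \<open>auto simp: indicator_def\<close>)
            then show ?thesis by (rule tendsto_eventually)
          next
            case False
            have "\<forall>\<^sub>F r in sequentially. (x, fst c \<bullet> x + (snd c + s / real r)) \<in> - C"
              using topological_tendstoD[OF lim, of "- C"] False compact_imp_closed[OF compact_C] by auto
            then have "\<forall>\<^sub>F r in sequentially. indicator C (x, fst c \<bullet> x + (snd c + s / real r)) = (indicator C (x, fst c \<bullet> x + snd c) :: ennreal)"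
              by eventually_elim (use False in \<open>auto simp: indicator_def\<close>)
            then show ?thesis by (rule tendsto_eventually)
          qed
        qed
      qed
    qed
  qed
qed

text \<open>The height is written as \<open>a \<bullet> x + t + s / r\<close>. The Jacobian
  \<open>1 / r\<close> cancels the factor \<open>of_nat r\<close>, and integrating over
  \<open>x\<close> first turns the indicator into a nearby slice.\<close>

lemma slab_rescale:
  assumes [measurable]: "q \<in> borel_measurable borel" and r: "r > 0"
  shows "of_nat r * (\<integral>\<^sup>+p. indicator C p * q (\<bar>snd p - (a \<bullet> fst p + t)\<bar>) \<partial>lborel) =
    (\<integral>\<^sup>+s. q (\<bar>s\<bar> / real r) * slice (a, t + s / real r) \<partial>lborel)"
proof -
  have "(\<integral>\<^sup>+p. indicator C p * q (\<bar>snd p - (a \<bullet> fst p + t)\<bar>) \<partial>lborel) =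
     (\<integral>\<^sup>+x. \<integral>\<^sup>+z. indicator C (x, z) * q (\<bar>z - (a \<bullet> x + t)\<bar>) \<partial>lborel \<partial>lborel)"
    by (subst nn_integral_lborel_pair) simp_all
  also have "\<dots> = (\<integral>\<^sup>+x. \<integral>\<^sup>+s. ennreal (1 / r) * (indicator C (x, a \<bullet> x + (t + s / r)) * q (\<bar>s\<bar> / r)) \<partial>lborel \<partial>lborel)"
  proof (rule nn_integral_cong)
    fix x :: 'b
    have m: "(\<lambda>z. indicator C (x, z) * q (\<bar>z - (a \<bullet> x + t)\<bar>)) \<in> borel_measurable borel"
      by measurable
    have "(\<integral>\<^sup>+z. indicator C (x, z) * q (\<bar>z - (a \<bullet> x + t)\<bar>) \<partial>lborel) =
      ennreal \<bar>1 / real r\<bar> * (\<integral>\<^sup>+s. indicator C (x, (a \<bullet> x + t) + 1 / real r * s) * q (\<bar>(a \<bullet> x + t) + 1 / real r * s - (a \<bullet> x + t)\<bar>) \<partial>lborel)"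
      by (rule nn_integral_real_affine[OF m]) (use r in simp)
    also have "\<dots> = ennreal (1 / r) * (\<integral>\<^sup>+s. indicator C (x, a \<bullet> x + (t + s / r)) * q (\<bar>s\<bar> / r) \<partial>lborel)"
      by (simp add: abs_divide add.assoc)
    also have "\<dots> = (\<integral>\<^sup>+s. ennreal (1 / r) * (indicator C (x, a \<bullet> x + (t + s / r)) * q (\<bar>s\<bar> / r)) \<partial>lborel)"
      by (rule nn_integral_cmult[symmetric]) measurable
    finally show "(\<integral>\<^sup>+z. indicator C (x, z) * q (\<bar>z - (a \<bullet> x + t)\<bar>) \<partial>lborel) =
      (\<integral>\<^sup>+s. ennreal (1 / r) * (indicator C (x, a \<bullet> x + (t + s / r)) * q (\<bar>s\<bar> / r)) \<partial>lborel)" .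
  qed
  also have "\<dots> = (\<integral>\<^sup>+s. \<integral>\<^sup>+x. ennreal (1 / r) * (indicator C (x, a \<bullet> x + (t + s / r)) * q (\<bar>s\<bar> / r)) \<partial>lborel \<partial>lborel)"
    by (rule nn_integral_lborel_swap) measurable
  also have "\<dots> = (\<integral>\<^sup>+s. ennreal (1 / r) * (q (\<bar>s\<bar> / r) * slice (a, t + s / r)) \<partial>lborel)"
  proof (rule nn_integral_cong)
    fix s
    have "(\<integral>\<^sup>+x. ennreal (1 / r) * (indicator C (x, a \<bullet> x + (t + s / r)) * q (\<bar>s\<bar> / r)) \<partial>lborel) =
      (\<integral>\<^sup>+x. (ennreal (1 / r) * q (\<bar>s\<bar> / r)) * indicator C (x, a \<bullet> x + (t + s / r)) \<partial>lborel)"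
      by (simp add: mult_ac)
    also have "\<dots> = (ennreal (1 / r) * q (\<bar>s\<bar> / r)) * slice (a, t + s / r)"
      unfolding slice_def fst_conv snd_conv by (rule nn_integral_cmult) measurable
    finally show "(\<integral>\<^sup>+x. ennreal (1 / r) * (indicator C (x, a \<bullet> x + (t + s / r)) * q (\<bar>s\<bar> / r)) \<partial>lborel) =
      ennreal (1 / r) * (q (\<bar>s\<bar> / r) * slice (a, t + s / r))" by (simp add: mult.assoc)
  qed
  also have "\<dots> = ennreal (1 / r) * (\<integral>\<^sup>+s. q (\<bar>s\<bar> / r) * slice (a, t + s / r) \<partial>lborel)"
    by (rule nn_integral_cmult) measurable
  finally have eq: "(\<integral>\<^sup>+p. indicator C p * q (\<bar>snd p - (a \<bullet> fst p + t)\<bar>) \<partial>lborel) =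
    ennreal (1 / r) * (\<integral>\<^sup>+s. q (\<bar>s\<bar> / r) * slice (a, t + s / r) \<partial>lborel)" .
  have "of_nat r * ennreal (1 / r) = 1"
    using r by (simp add: ennreal_of_nat_eq_real_of_nat ennreal_mult'[symmetric])
  then show ?thesis unfolding eq mult.assoc[symmetric] by simp
qed

end

lemma AE_lborel_fst_snd:
  fixes P :: "'a::euclidean_space \<Rightarrow> bool"
  assumes "AE x in lborel. P x"
  shows "AE w in (lborel :: ('a \<times> 'b::euclidean_space) measure). P (fst w)"
    and "AE w in (lborel :: ('b \<times> 'a) measure). P (snd w)"
proof -
  from assms obtain N where N: "{x \<in> space lborel. \<not> P x} \<subseteq> N" "emeasure lborel N = 0" "N \<in> sets lborel"
    by (rule AE_E)
  have N1: "N \<times> (UNIV :: 'b set) \<in> null_sets lborel"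
    using N unfolding lborel_prod[symmetric] by (simp add: null_sets_def lborel.emeasure_pair_measure_Times)
  have N2: "(UNIV :: 'b set) \<times> N \<in> null_sets lborel"
    using N unfolding lborel_prod[symmetric] by (simp add: null_sets_def lborel.emeasure_pair_measure_Times)
  show "AE w in (lborel :: ('a \<times> 'b) measure). P (fst w)" by (rule AE_I'[OF N1]) (use N(1) in auto)
  show "AE w in (lborel :: ('b \<times> 'a) measure). P (snd w)" by (rule AE_I'[OF N2]) (use N(1) in auto)
qed

context sliced_body
begin

text \<open>All variables, including the rescaled height, are gathered into one product space, so
  that a single application of dominated convergence suffices.\<close>

lemma scaled_hole_integral_eq:
  assumes r: "r > 0"
  shows "of_nat r * hole_integral r =
    (\<integral>\<^sup>+w. ennreal (height_det T (fst w)) * (on_slice (fst w) (fst (snd w)) *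
      (ennreal (max 0 (1 - height_det T (fst w) * \<bar>snd (snd w)\<bar> / fact (DIM('b) + 1) / real r) ^ r) *
        slice (fst (fst (snd w)), snd (fst (snd w)) + snd (snd w) / real r)))
      \<partial>(lborel :: (('b, 'o) vec \<times> ('b \<times> real) \<times> real) measure))"
    and "(\<lambda>w. ennreal (height_det T (fst w)) * (on_slice (fst w) (fst (snd w)) *
      (ennreal (max 0 (1 - height_det T (fst w) * \<bar>snd (snd w)\<bar> / fact (DIM('b) + 1) / real r) ^ r) *
        slice (fst (fst (snd w)), snd (fst (snd w)) + snd (snd w) / real r)))) \<in>
      borel_measurable (borel :: (('b, 'o) vec \<times> ('b \<times> real) \<times> real) measure)" (is "?u \<in> _")
proof -
  show um: "?u \<in> borel_measurable borel" by measurable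
  have inner: "of_nat r * avoid r y c =
      (\<integral>\<^sup>+s. ennreal (max 0 (1 - height_det T y * \<bar>s\<bar> / fact (DIM('b) + 1) / real r) ^ r) * slice (fst c, snd c + s / real r) \<partial>lborel)" for y c
    using slab_rescale[of "\<lambda>t. ennreal (max 0 (1 - height_det T y * t / fact (DIM('b) + 1)) ^ r)" r "fst c" "snd c"] r
    by (simp add: mult.commute)
  have "(\<integral>\<^sup>+w. ?u w \<partial>lborel) = (\<integral>\<^sup>+y. \<integral>\<^sup>+v. ?u (y, v) \<partial>lborel \<partial>lborel)"
    by (rule nn_integral_lborel_pair[OF um])
  also have "\<dots> = (\<integral>\<^sup>+y. of_nat r * (ennreal (height_det T y) * (\<integral>\<^sup>+c. on_slice y c *
     avoid r y c \<partial>lborel)) \<partial>lborel)"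
  proof (rule nn_integral_cong)
    fix y :: "('b, 'o) vec"
    have "(\<integral>\<^sup>+v. ?u (y, v) \<partial>lborel) = (\<integral>\<^sup>+c. \<integral>\<^sup>+s. ?u (y, (c, s)) \<partial>lborel \<partial>lborel)"
      by (rule nn_integral_lborel_pair) measurable
    also have "\<dots> = (\<integral>\<^sup>+c. (of_nat r * ennreal (height_det T y)) * (on_slice y c * avoid r y c) \<partial>lborel)"
    proof (rule nn_integral_cong)
      fix c :: "'b \<times> real"
      have "(\<integral>\<^sup>+s. ?u (y, (c, s)) \<partial>lborel) = (\<integral>\<^sup>+s. (ennreal (height_det T y) * on_slice y c) * (ennreal (max 0 (1 - height_det T y * \<bar>s\<bar> / fact (DIM('b) + 1) / real r) ^ r) * slice (fst c, snd c + s / real r)) \<partial>lborel)"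
        by (simp add: mult.assoc)
      also have "\<dots> = (ennreal (height_det T y) * on_slice y c) * (\<integral>\<^sup>+s. ennreal (max 0 (1 - height_det T y * \<bar>s\<bar> / fact (DIM('b) + 1) / real r) ^ r) * slice (fst c, snd c + s / real r) \<partial>lborel)"
        by (rule nn_integral_cmult) measurable
      finally show "(\<integral>\<^sup>+s. ?u (y, (c, s)) \<partial>lborel) = (of_nat r * ennreal (height_det T y)) * (on_slice y c * avoid r y c)"
        unfolding inner[symmetric] by (simp only: mult_ac)
    qed
    also have "\<dots> = (of_nat r * ennreal (height_det T y)) * (\<integral>\<^sup>+c. on_slice y c * avoid r y c \<partial>lborel)"
      by (rule nn_integral_cmult) measurable
    finally show "(\<integral>\<^sup>+v. ?u (y, v) \<partial>lborel) = of_nat r * (ennreal (height_det T y) * (\<integral>\<^sup>+c. on_slice y c *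
     avoid r y c \<partial>lborel))"
      by (simp only: mult.assoc)
  qed
  also have "\<dots> = of_nat r * hole_integral r"
    unfolding hole_integral_def
    by (rule nn_integral_cmult) measurable
  finally show "of_nat r * hole_integral r = (\<integral>\<^sup>+w. ?u w \<partial>lborel)" by simp
qed

text \<open>The integral over \<open>s\<close> is inversely proportional to
  \<open>height_det T y\<close>, which cancels the Jacobian; what remains of the base points is the
  power of the slice. \<open>h\<close> is \<open>slice\<close> for the limit and the slope bound for
  the dominating function.\<close>

lemma nn_integral_exp_height:
  assumes [measurable]: "h \<in> borel_measurable borel"
  shows "(\<integral>\<^sup>+w. ennreal (height_det T (fst w)) * (on_slice (fst w) (fst (snd w)) *
      (ennreal (exp (- (height_det T (fst w) * \<bar>snd (snd w)\<bar> / fact (DIM('b) + 1)))) * h (fst (snd w))))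
      \<partial>(lborel :: (('b, 'o) vec \<times> ('b \<times> real) \<times> real) measure)) =
    ennreal (2 * fact (DIM('b) + 1)) * (\<integral>\<^sup>+c. h c * slice c ^ (DIM('b) + 1) \<partial>lborel)"
    and "(\<lambda>w. ennreal (height_det T (fst w)) * (on_slice (fst w) (fst (snd w)) *
      (ennreal (exp (- (height_det T (fst w) * \<bar>snd (snd w)\<bar> / fact (DIM('b) + 1)))) * h (fst (snd w))))) \<in>
      borel_measurable (borel :: (('b, 'o) vec \<times> ('b \<times> real) \<times> real) measure)" (is "?u \<in> _")
proof -
  show um: "?u \<in> borel_measurable borel" by measurable
  have "(\<integral>\<^sup>+w. ?u w \<partial>lborel) = (\<integral>\<^sup>+y. \<integral>\<^sup>+v. ?u (y, v) \<partial>lborel \<partial>lborel)"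
    by (rule nn_integral_lborel_pair[OF um])
  also have "\<dots> = (\<integral>\<^sup>+y. \<integral>\<^sup>+c. ennreal (2 * fact (DIM('b) + 1)) * (h c * on_slice y c) \<partial>lborel \<partial>lborel)"
  proof (rule nn_integral_cong_AE)
    show "AE y in lborel. (\<integral>\<^sup>+v. ?u (y, v) \<partial>lborel) = (\<integral>\<^sup>+c. ennreal (2 * fact (DIM('b) + 1)) * (h c * on_slice y c) \<partial>lborel)"
      using AE_height_det_pos[OF lin_T bij_T card_o]
    proof eventually_elim
      case (elim y)
      have "(\<integral>\<^sup>+v. ?u (y, v) \<partial>lborel) = (\<integral>\<^sup>+c. \<integral>\<^sup>+s. ?u (y, (c, s)) \<partial>lborel \<partial>lborel)"
        by (rule nn_integral_lborel_pair) measurable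
      also have "\<dots> = (\<integral>\<^sup>+c. ennreal (2 * fact (DIM('b) + 1)) * (h c * on_slice y c) \<partial>lborel)"
      proof (rule nn_integral_cong)
        fix c :: "'b \<times> real"
        have "(\<integral>\<^sup>+s. ?u (y, (c, s)) \<partial>lborel) =
          (\<integral>\<^sup>+s. (ennreal (height_det T y) * (h c * on_slice y c)) * ennreal (exp (- (height_det T y / fact (DIM('b) + 1) * \<bar>s\<bar>))) \<partial>lborel)"
          by (simp add: mult_ac)
        also have "\<dots> = (ennreal (height_det T y) * (h c * on_slice y c)) * (\<integral>\<^sup>+s. ennreal (exp (- (height_det T y / fact (DIM('b) + 1) * \<bar>s\<bar>))) \<partial>lborel)"
          by (rule nn_integral_cmult) measurable
        also have "(\<integral>\<^sup>+s. ennreal (exp (- (height_det T y / fact (DIM('b) + 1) * \<bar>s\<bar>))) \<partial>lborel) = ennreal (2 / (height_det T y / fact (DIM('b) + 1)))"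
          using elim by (intro nn_integral_exp_abs) simp
        also have "(ennreal (height_det T y) * (h c * on_slice y c)) * ennreal (2 / (height_det T y / fact (DIM('b) + 1))) =
           (ennreal (height_det T y) * ennreal (2 / (height_det T y / fact (DIM('b) + 1)))) * (h c * on_slice y c)"
          by (simp only: mult_ac)
        also have "ennreal (height_det T y) * ennreal (2 / (height_det T y / fact (DIM('b) + 1))) = ennreal (2 * fact (DIM('b) + 1))"
          using elim by (simp add: ennreal_mult'[symmetric])
        finally show "(\<integral>\<^sup>+s. ?u (y, (c, s)) \<partial>lborel) = ennreal (2 * fact (DIM('b) + 1)) * (h c * on_slice y c)" .
      qed
      finally show ?case .
    qed
  qed
  also have "\<dots> = (\<integral>\<^sup>+c. \<integral>\<^sup>+y. ennreal (2 * fact (DIM('b) + 1)) * (h c * on_slice y c) \<partial>lborel \<partial>lborel)"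
    by (rule nn_integral_lborel_swap) measurable
  also have "\<dots> = (\<integral>\<^sup>+c. ennreal (2 * fact (DIM('b) + 1)) * (h c * slice c ^ (DIM('b) + 1)) \<partial>lborel)"
  proof (rule nn_integral_cong)
    fix c :: "'b \<times> real"
    have m: "(\<lambda>y. on_slice y c) \<in> borel_measurable lborel" by measurable
    have "(\<integral>\<^sup>+y. ennreal (2 * fact (DIM('b) + 1)) * (h c * on_slice y c) \<partial>lborel) = (\<integral>\<^sup>+y. (ennreal (2 * fact (DIM('b) + 1)) * h c) * on_slice y c \<partial>lborel)"
      by (simp only: mult.assoc)
    also have "\<dots> = (ennreal (2 * fact (DIM('b) + 1)) * h c) * slice c ^ (DIM('b) + 1)"
      unfolding nn_integral_on_slice[symmetric] by (rule nn_integral_cmult[OF m])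
    finally show "(\<integral>\<^sup>+y. ennreal (2 * fact (DIM('b) + 1)) * (h c * on_slice y c) \<partial>lborel) = ennreal (2 * fact (DIM('b) + 1)) * (h c * slice c ^ (DIM('b) + 1))"
      by (simp only: mult.assoc)
  qed
  also have "\<dots> = ennreal (2 * fact (DIM('b) + 1)) * (\<integral>\<^sup>+c. h c * slice c ^ (DIM('b) + 1) \<partial>lborel)"
    by (rule nn_integral_cmult) measurable
  finally show "(\<integral>\<^sup>+w. ?u w \<partial>lborel) = ennreal (2 * fact (DIM('b) + 1)) * (\<integral>\<^sup>+c. h c * slice c ^ (DIM('b) + 1) \<partial>lborel)" .
qed

text \<open>All but one of the factors \<open>slice c\<close> are replaced by a bound in the slope
  alone, whose power \<open>DIM('b) + 1\<close> is integrable. The factor that is kept integrates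
  over the offset to the volume of \<open>C\<close>, for every slope.\<close>

lemma slice_bound_obtain:
  obtains R where "R > 0" "\<And>c. slice c \<le> ennreal (slice_bound R (fst c))"
    "(\<integral>\<^sup>+c. ennreal (slice_bound R (fst c)) * slice c ^ (DIM('b) + 1) \<partial>lborel) < \<infinity>"
proof -
  obtain R where R: "R > 0" "\<And>x z b. (x, z) \<in> C \<Longrightarrow> b \<in> Basis \<Longrightarrow> \<bar>x \<bullet> b\<bar> \<le> R" "\<And>x z. (x, z) \<in> C \<Longrightarrow> \<bar>z\<bar> \<le> R"
    using bounded_C by metis
  have le: "slice c \<le> ennreal (slice_bound R (fst c))" for c
    unfolding slice_def by (rule slice_le_slice_bound[OF R])
  have "(\<integral>\<^sup>+c. ennreal (slice_bound R (fst c)) * slice c ^ (DIM('b) + 1) \<partial>lborel) \<le>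
     (\<integral>\<^sup>+c. ennreal (slice_bound R (fst c)) ^ (DIM('b) + 1) * slice c \<partial>lborel)"
  proof (rule nn_integral_mono)
    fix c :: "'b \<times> real"
    have "ennreal (slice_bound R (fst c)) * slice c ^ (DIM('b) + 1) = ennreal (slice_bound R (fst c)) * slice c ^ DIM('b) * slice c"
      by (simp add: mult_ac)
    also have "\<dots> \<le> ennreal (slice_bound R (fst c)) * ennreal (slice_bound R (fst c)) ^ DIM('b) * slice c"
      by (intro mult_right_mono mult_left_mono power_mono le) auto
    finally show "ennreal (slice_bound R (fst c)) * slice c ^ (DIM('b) + 1) \<le> ennreal (slice_bound R (fst c)) ^ (DIM('b) + 1) * slice c"
      by simp
  qed
  also have "\<dots> = (\<integral>\<^sup>+a. \<integral>\<^sup>+t. ennreal (slice_bound R a) ^ (DIM('b) + 1) * slice (a, t) \<partial>lborel \<partial>lborel)"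
    by (subst nn_integral_lborel_pair) simp_all
  also have "\<dots> = (\<integral>\<^sup>+a. ennreal (slice_bound R a) ^ (DIM('b) + 1) * emeasure lborel C \<partial>(lborel :: 'b measure))"
  proof (rule nn_integral_cong)
    fix a :: 'b
    show "(\<integral>\<^sup>+t. ennreal (slice_bound R a) ^ (DIM('b) + 1) * slice (a, t) \<partial>lborel) = ennreal (slice_bound R a) ^ (DIM('b) + 1) * emeasure lborel C"
      unfolding slice_integral[of a, symmetric] by (rule nn_integral_cmult) measurable
  qed
  also have "\<dots> = (\<integral>\<^sup>+a. ennreal (slice_bound R a) ^ (DIM('b) + 1) \<partial>(lborel :: 'b measure)) * emeasure lborel C"
    by (rule nn_integral_multc) measurable
  also have "\<dots> < \<infinity>"
    using nn_integral_slice_bound_finite[OF R(1), where 'b='b] emeasure_compact_finite[OF compact_C]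
    by (simp only: ennreal_mult_less_top infinity_ennreal_def) simp
  finally show ?thesis using that[OF R(1) le] by blast
qed

lemma slice_power_integral_finite: "(\<integral>\<^sup>+c. slice c * slice c ^ (DIM('b) + 1) \<partial>lborel) < \<infinity>"
proof -
  obtain R where R: "R > 0" "\<And>c. slice c \<le> ennreal (slice_bound R (fst c))"
    "(\<integral>\<^sup>+c. ennreal (slice_bound R (fst c)) * slice c ^ (DIM('b) + 1) \<partial>lborel) < \<infinity>"
    by (rule slice_bound_obtain) blast
  have "(\<integral>\<^sup>+c. slice c * slice c ^ (DIM('b) + 1) \<partial>lborel) \<le> (\<integral>\<^sup>+c. ennreal (slice_bound R (fst c)) * slice c ^ (DIM('b) + 1) \<partial>lborel)"
    by (intro nn_integral_mono mult_right_mono R(2)) auto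
  then show ?thesis using R(3) by (rule le_less_trans)
qed

lemma truncated_power_le_exp:
  fixes t :: real
  assumes "t \<ge> 0" "r > 0"
  shows "max 0 (1 - t / real r) ^ r \<le> exp (- t)"
proof -
  have "max 0 (1 - t / real r) \<le> exp (- t / real r)"
    using exp_ge_add_one_self[of "- t / real r"] by simp
  then have "max 0 (1 - t / real r) ^ r \<le> exp (- t / real r) ^ r" by (intro power_mono) auto
  also have "\<dots> = exp (- t)" using assms by (simp add: exp_of_nat_mult[symmetric])
  finally show ?thesis .
qed

lemma truncated_power_tendsto_exp:
  fixes t :: real
  shows "(\<lambda>r. max 0 (1 - t / real r) ^ r) \<longlonglongrightarrow> exp (- t)"
proof (rule Lim_transform_eventually)
  show "(\<lambda>r. (1 + (- t) / real r) ^ r) \<longlonglongrightarrow> exp (- t)" by (rule tendsto_exp_limit_sequentially)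
  have "(\<lambda>r. 1 - t / real r) \<longlonglongrightarrow> 1 - 0" by (intro tendsto_intros lim_const_over_n)
  then have "\<forall>\<^sub>F r in sequentially. 1 - t / real r > 0" by (intro order_tendstoD) auto
  then show "\<forall>\<^sub>F r in sequentially. (1 + (- t) / real r) ^ r = max 0 (1 - t / real r) ^ r"
    by eventually_elim (simp add: max_def)
qed

lemma hole_integral_tendsto:
  "(\<lambda>r. of_nat r * hole_integral r) \<longlonglongrightarrow> ennreal (2 * fact (DIM('b) + 1)) * (\<integral>\<^sup>+c. slice c * slice c ^ (DIM('b) + 1) \<partial>lborel)"
proof -
  obtain R where R: "R > 0" "\<And>c. slice c \<le> ennreal (slice_bound R (fst c))"
    "(\<integral>\<^sup>+c. ennreal (slice_bound R (fst c)) * slice c ^ (DIM('b) + 1) \<partial>lborel) < \<infinity>"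
    by (rule slice_bound_obtain) blast
  \<comment> \<open>The index is shifted because at \<open>r = 0\<close> the truncated power is 1
    and is not dominated by the exponential.\<close>
  let ?u = "\<lambda>r w. ennreal (height_det T (fst w)) * (on_slice (fst w) (fst (snd w)) *
      (ennreal (max 0 (1 - height_det T (fst w) * \<bar>snd (snd w)\<bar> / fact (DIM('b) + 1) / real (Suc r)) ^ Suc r) *
        slice (fst (fst (snd w)), snd (fst (snd w)) + snd (snd w) / real (Suc r))))"
  let ?v = "\<lambda>h w. ennreal (height_det T (fst w)) * (on_slice (fst w) (fst (snd w)) *
      (ennreal (exp (- (height_det T (fst w) * \<bar>snd (snd w)\<bar> / fact (DIM('b) + 1)))) * h (fst (snd w))))"
  let ?b = "\<lambda>c :: 'b \<times> real. ennreal (slice_bound R (fst c))"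
  have bm: "?b \<in> borel_measurable borel" by measurable
  let ?M = "lborel :: (('b, 'o) vec \<times> ('b \<times> real) \<times> real) measure"
  have "(\<lambda>r. \<integral>\<^sup>+w. ?u r w \<partial>?M) \<longlonglongrightarrow> (\<integral>\<^sup>+w. ?v slice w \<partial>?M)"
  proof (rule nn_integral_dominated_convergence[where w = "?v ?b"])
    show "?u r \<in> borel_measurable ?M" for r using scaled_hole_integral_eq(2)[of "Suc r"] by simp
    show "?v slice \<in> borel_measurable ?M" using nn_integral_exp_height(2)[OF slice_measurable] by simp
    show "?v ?b \<in> borel_measurable ?M" using nn_integral_exp_height(2)[OF bm] by simp
    show "AE w in ?M. ?u r w \<le> ?v ?b w" for r
    proof (rule AE_I2)
      fix w :: "('b, 'o) vec \<times> ('b \<times> real) \<times> real"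
      have "max 0 (1 - height_det T (fst w) * \<bar>snd (snd w)\<bar> / fact (DIM('b) + 1) / real (Suc r)) ^ Suc r \<le> exp (- (height_det T (fst w) * \<bar>snd (snd w)\<bar> / fact (DIM('b) + 1)))"
        by (intro truncated_power_le_exp) auto
      moreover have "slice (fst (fst (snd w)), snd (fst (snd w)) + snd (snd w) / real (Suc r)) \<le> ?b (fst (snd w))"
        using R(2)[of "(fst (fst (snd w)), snd (fst (snd w)) + snd (snd w) / real (Suc r))"] by simp
      ultimately show "?u r w \<le> ?v ?b w"
        by (intro mult_left_mono mult_mono ennreal_leI) auto
    qed
    show "(\<integral>\<^sup>+w. ?v ?b w \<partial>?M) < \<infinity>"
      unfolding nn_integral_exp_height(1)[OF bm] using R(3) by (simp only: ennreal_mult_less_top infinity_ennreal_def) simp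
    have "AE v in (lborel :: (('b \<times> real) \<times> real) measure). \<forall>s. (\<lambda>r. slice (fst (fst v), snd (fst v) + s / real r)) \<longlonglongrightarrow> slice (fst v)"
      by (rule AE_lborel_fst_snd(1)) (rule slice_tendsto)
    then have "AE w in ?M. \<forall>s. (\<lambda>r. slice (fst (fst (snd w)), snd (fst (snd w)) + s / real r)) \<longlonglongrightarrow> slice (fst (snd w))"
      by (rule AE_lborel_fst_snd(2))
    then show "AE w in ?M. (\<lambda>r. ?u r w) \<longlonglongrightarrow> ?v slice w"
    proof eventually_elim
      case (elim w)
      have 1: "(\<lambda>r. slice (fst (fst (snd w)), snd (fst (snd w)) + snd (snd w) / real (Suc r))) \<longlonglongrightarrow> slice (fst (snd w))"
        using LIMSEQ_Suc[OF elim[rule_format, of "snd (snd w)"]] .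
      have 2: "(\<lambda>r. ennreal (max 0 (1 - height_det T (fst w) * \<bar>snd (snd w)\<bar> / fact (DIM('b) + 1) / real (Suc r)) ^ Suc r)) \<longlonglongrightarrow>
         ennreal (exp (- (height_det T (fst w) * \<bar>snd (snd w)\<bar> / fact (DIM('b) + 1))))"
        using LIMSEQ_Suc[OF truncated_power_tendsto_exp[of "height_det T (fst w) * \<bar>snd (snd w)\<bar> / fact (DIM('b) + 1)"]]
        by (rule tendsto_ennrealI)
      have fin: "slice (fst (snd w)) < \<top>" using R(2)[of "fst (snd w)"] by (rule le_less_trans) simp
      have o: "on_slice (fst w) (fst (snd w)) < \<top>" using on_slice_le_1 by (rule le_less_trans) simp
      show ?case
        by (intro tendsto_mult_ennreal tendsto_const 1 2) (use fin o in \<open>auto simp: ennreal_mult_eq_top_iff\<close>)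
    qed
  qed
  then have "(\<lambda>r. of_nat (Suc r) * hole_integral (Suc r)) \<longlonglongrightarrow> (\<integral>\<^sup>+w. ?v slice w \<partial>?M)"
    by (simp only: scaled_hole_integral_eq(1)[OF zero_less_Suc])
  then show ?thesis
    unfolding nn_integral_exp_height(1)[OF slice_measurable] by (rule LIMSEQ_imp_Suc)
qed

text \<open>Exchanging the integrals over base points and hyperplanes leaves, for each hyperplane,
  the moment of the Jacobian over one convex set, where the maximal simplex probability
  applies.\<close>

lemma mass_le:
  "emeasure lborel C ^ (DIM('b) + 1) \<le> ennreal (fact DIM('b) * max_simplex_prob TYPE('b) / (DIM('b) + 2)) *
     (\<integral>\<^sup>+c. slice c * slice c ^ (DIM('b) + 1) \<partial>lborel)"
proof -
  let ?k = "ennreal (fact DIM('b) * max_simplex_prob TYPE('b) / (DIM('b) + 2))"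
  let ?f = "\<lambda>X :: ('b \<times> real, 'o) vec. \<Prod>i\<in>UNIV. indicator C (X $ i) :: ennreal"
  have fm: "?f \<in> borel_measurable borel" by measurable
  have "emeasure lborel C ^ (DIM('b) + 1) = (\<integral>\<^sup>+X. ?f X \<partial>lborel)"
    using nn_integral_lborel_vec_prod[OF borel_measurable_indicator[OF C_borel], where 'o='o] by (simp add: card_o)
  also have "\<dots> = (\<integral>\<^sup>+y. \<integral>\<^sup>+z. ?f (\<chi> i. (y $ i, z $ i)) \<partial>(lborel :: (real, 'o) vec measure) \<partial>(lborel :: ('b, 'o) vec measure))"
    by (rule nn_integral_lborel_vec_Pair[OF fm])
  also have "\<dots> = (\<integral>\<^sup>+y. \<integral>\<^sup>+c. ennreal (height_det T y) * on_slice y c \<partial>lborel \<partial>lborel)"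
  proof (rule nn_integral_cong_AE)
    show "AE y in (lborel :: ('b, 'o) vec measure). (\<integral>\<^sup>+z. ?f (\<chi> i. (y $ i, z $ i)) \<partial>(lborel :: (real, 'o) vec measure)) =
      (\<integral>\<^sup>+c. ennreal (height_det T y) * on_slice y c \<partial>lborel)"
      using AE_height_det_pos[OF lin_T bij_T card_o]
    proof eventually_elim
      case (elim y)
      have det: "det (\<chi> i. T (y $ i, 1)) \<noteq> 0" using elim by (auto simp: height_det_def)
      have m: "(\<lambda>z::(real, 'o) vec. ?f (\<chi> i. (y $ i, z $ i))) \<in> borel_measurable borel" by measurable
      have om: "on_slice y \<in> borel_measurable lborel" by measurable
      have "(\<integral>\<^sup>+z. ?f (\<chi> i. (y $ i, z $ i)) \<partial>(lborel :: (real, 'o) vec measure)) = ennreal (height_det T y) * (\<integral>\<^sup>+c. on_slice y c \<partial>lborel)"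
        unfolding nn_integral_heights_eq_hyperplanes[OF lin_T bij_T det m] height_det_def on_slice_def
        by (simp only: vec_lambda_beta)
      also have "\<dots> = (\<integral>\<^sup>+c. ennreal (height_det T y) * on_slice y c \<partial>lborel)"
        by (rule nn_integral_cmult[OF om, symmetric])
      finally show ?case .
    qed
  qed
  also have "\<dots> = (\<integral>\<^sup>+c. \<integral>\<^sup>+y. ennreal (height_det T y) * on_slice y c \<partial>lborel \<partial>lborel)"
    by (rule nn_integral_lborel_swap) measurable
  also have "\<dots> \<le> (\<integral>\<^sup>+c. ?k * slice c ^ (DIM('b) + 2) \<partial>lborel)"
  proof (rule nn_integral_mono)
    fix c :: "'b \<times> real"
    \<comment> \<open>The projected section is a preimage under the graph map, closed by continuity,
      bounded as part of the shadow of \<open>C\<close>, and convex because the graph map is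
      affine.\<close>
    let ?L = "(\<lambda>x. (x, fst c \<bullet> x + snd c)) -` C"
    have cl: "closed ?L" using compact_imp_closed[OF compact_C] by (intro closed_vimage continuous_intros)
    have "bounded (fst ` C)" using compact_imp_bounded[OF compact_C] by (rule bounded_fst)
    moreover have "?L \<subseteq> fst ` C" by force
    ultimately have comp: "compact ?L" using cl bounded_subset compact_eq_bounded_closed by blast
    have conv: "convex ?L"
    proof (rule convexI)
      fix x y and u v :: real assume *: "x \<in> ?L" "y \<in> ?L" "0 \<le> u" "0 \<le> v" "u + v = 1"
      then have "u *\<^sub>R (x, fst c \<bullet> x + snd c) + v *\<^sub>R (y, fst c \<bullet> y + snd c) \<in> C"
        using convex_C unfolding convex_def by blast
      moreover have "u * (fst c \<bullet> x + snd c) + v * (fst c \<bullet> y + snd c) = fst c \<bullet> (u *\<^sub>R x + v *\<^sub>R y) + (u + v) * snd c"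
        by (simp add: inner_add_right algebra_simps)
      ultimately show "u *\<^sub>R x + v *\<^sub>R y \<in> ?L" using *(5) by simp
    qed
    have ind: "indicator C (x, fst c \<bullet> x + snd c) = (indicator ?L x :: ennreal)" for x by (simp add: indicator_def)
    have "slice c = emeasure lborel ?L" using cl unfolding slice_def ind by (simp add: borel_closed)
    moreover have "(\<integral>\<^sup>+y. ennreal (height_det T y) * on_slice y c \<partial>lborel) \<le> ?k * emeasure lborel ?L ^ (DIM('b) + 2)"
      using height_det_moment_le[OF lin_T bij_T card_o comp conv] unfolding on_slice_def ind .
    ultimately show "(\<integral>\<^sup>+y. ennreal (height_det T y) * on_slice y c \<partial>lborel) \<le> ?k * slice c ^ (DIM('b) + 2)" by simp
  qed
  also have "\<dots> = (\<integral>\<^sup>+c. ?k * (slice c * slice c ^ (DIM('b) + 1)) \<partial>lborel)" by (simp add: mult_ac)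
  also have "\<dots> = ?k * (\<integral>\<^sup>+c. slice c * slice c ^ (DIM('b) + 1) \<partial>lborel)"
    by (rule nn_integral_cmult) measurable
  finally show ?thesis .
qed

end

text \<open>The change of variables theorem of the library needs a well-ordered index type; this one has
  one element more than \<open>'m\<close>.\<close>

typedef 'm ix = "{..CARD('m::finite)}" by auto

instantiation ix :: (finite) linorder
begin
definition less_eq_ix :: "'a ix \<Rightarrow> 'a ix \<Rightarrow> bool" where "less_eq_ix a b \<longleftrightarrow> Rep_ix a \<le> Rep_ix b"
definition less_ix :: "'a ix \<Rightarrow> 'a ix \<Rightarrow> bool" where "less_ix a b \<longleftrightarrow> Rep_ix a < Rep_ix b"
instance by standard (auto simp: less_eq_ix_def less_ix_def Rep_ix_inject)
end

instance ix :: (finite) wellorder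
proof
  fix P :: "'a ix \<Rightarrow> bool" and a :: "'a ix"
  assume H: "\<And>x. (\<And>y. y < x \<Longrightarrow> P y) \<Longrightarrow> P x"
  show "P a" by (induct a rule: measure_induct_rule[of Rep_ix]) (auto simp: less_ix_def intro: H)
qed

lemma UNIV_ix: "(UNIV :: 'm::finite ix set) = Abs_ix ` {..CARD('m)}"
  using type_definition.univ[OF type_definition_ix] .

instance ix :: (finite) finite
  by standard (simp add: UNIV_ix)

lemma card_ix: "CARD('m::finite ix) = CARD('m) + 1"
  by (simp add: type_definition.card[OF type_definition_ix])

section \<open>Transfer to the given body and the final limit\<close>

lemma compact_convex_vimage_Basis_bij:
  fixes S :: "'a::euclidean_space \<Rightarrow> 'b::euclidean_space"
  assumes S: "linear S" "bij_betw S Basis Basis" and K: "compact K" "convex K"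
  shows "compact (S -` K)" "convex (S -` K)" "emeasure lborel (S -` K) = emeasure lborel K"
proof -
  have bl: "bounded_linear S" using S(1) by (simp add: linear_conv_bounded_linear)
  have nrm: "norm (S x) = norm x" for x by (simp add: norm_eq_sqrt_inner inner_Basis_bij[OF S])
  obtain B where "\<And>x. x \<in> K \<Longrightarrow> norm x \<le> B" using compact_imp_bounded[OF K(1)] by (auto simp: bounded_iff)
  then have "bounded (S -` K)" by (auto simp: bounded_iff nrm[symmetric] intro!: exI[of _ B])
  moreover have "closed (S -` K)"
    using K(1) bl by (intro closed_vimage compact_imp_closed linear_continuous_on)
  ultimately show "compact (S -` K)" by (simp add: compact_eq_bounded_closed)
  show "convex (S -` K)" using convex_linear_vimage[OF S(1) K(2)] .
  have "S \<in> borel_measurable borel" by (rule linear_borel_measurable[OF S(1)])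
  then have "emeasure (distr lborel borel S) K = emeasure lborel (S -` K)"
    using K(1) by (subst emeasure_distr) (simp_all add: borel_compact)
  then show "emeasure lborel (S -` K) = emeasure lborel K" by (simp add: lborel_distr_Basis_bij[OF S])
qed

text \<open>Here \<open>n = r + d + 1\<close>. Of the \<open>d + 1\<close> powers of
  \<open>n\<close> in the binomial coefficient, \<open>d\<close> meet the normalisation and the last
  meets the factor \<open>r\<close> by which the hole integral is scaled.\<close>

lemma binomial_quotient_tendsto:
  "(\<lambda>r. real ((r + d + 1) choose (d + 1)) / (real (r + d + 1) ^ d * real r)) \<longlonglongrightarrow> 1 / fact (d + 1)"
proof -
  have eq: "real ((r + d + 1) choose (d + 1)) / (real (r + d + 1) ^ d * real r) =
     (\<Prod>i<d. (real (r + d + 1) - real i) / real (r + d + 1)) * ((real r + 1) / real r) / fact (d + 1)" for r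
  proof -
    have "real ((r + d + 1) choose (d + 1)) = (\<Prod>i<d+1. real (r + d + 1) - real i) / fact (d + 1)"
      unfolding binomial_gbinomial gbinomial_prod_rev by (simp add: atLeast0LessThan)
    also have "(\<Prod>i<d+1. real (r + d + 1) - real i) = (\<Prod>i<d. real (r + d + 1) - real i) * (real r + 1)" by simp
    finally show ?thesis by (simp only: prod_dividef prod_constant card_lessThan) (simp add: field_simps)
  qed
  have "(\<lambda>r. (\<Prod>i<d. (real (r + d + 1) - real i) / real (r + d + 1)) * ((real r + 1) / real r) / fact (d + 1))
    \<longlonglongrightarrow> (\<Prod>i<d. 1) * 1 / fact (d + 1)"
  proof (intro tendsto_intros)
    show "(\<lambda>r. (real (r + d + 1) - real i) / real (r + d + 1)) \<longlonglongrightarrow> 1" for i by real_asymp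
    show "(\<lambda>r. (real r + 1) / real r) \<longlonglongrightarrow> 1" by real_asymp
  qed simp
  then show ?thesis unfolding eq by simp
qed

text \<open>The limit is computed exactly, as \<open>2 * J / (d + 1)\<close>, so its existence comes
  with its value. Convergence is part of the conclusion because \<open>lim\<close> alone is
  uninformative for a divergent sequence.\<close>

theorem theorem2:
  fixes K :: "(real ^ 'n) set" and d :: nat
  assumes "d \<ge> 2"
    and "CARD('n::finite) = d"
    and "CARD('m::finite) = d - 1"
    and "convex_body K"
    and "emeasure lborel K = 1"
  shows "convergent (\<lambda>n. expected_holes K (d + 1) n / real n ^ d) \<and>
    lim (\<lambda>n. expected_holes K (d + 1) n / real n ^ d)
      \<ge> 2 / (fact (d - 1) * max_simplex_prob TYPE(real ^ 'm))"
proof -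
  let ?p = "max_simplex_prob TYPE(real ^ 'm)"
  have dn: "DIM(real ^ 'n) = d" and dm: "DIM(real ^ 'm) + 1 = d" and co: "CARD('m ix) = DIM(real ^ 'm) + 1"
    using assms(1-3) by (simp_all add: card_ix)
  obtain S :: "(real ^ 'm) \<times> real \<Rightarrow> real ^ 'n" where S: "linear S" "bij_betw S Basis Basis"
    using ex_linear_Basis_bij[where 'a = "(real ^ 'm) \<times> real" and 'b = "real ^ 'n"] dn dm by auto
  obtain T :: "(real ^ 'm) \<times> real \<Rightarrow> (real, 'm ix) vec" where T: "linear T" "bij_betw T Basis Basis"
    using ex_linear_Basis_bij[where 'a = "(real ^ 'm) \<times> real" and 'b = "(real, 'm ix) vec"] co by auto
  have K: "compact K" "convex K" using assms(4) by (auto simp: convex_body_def)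
  interpret uniform_body K using K assms(5) by unfold_locales auto
  note C = compact_convex_vimage_Basis_bij[OF S K]
  interpret sliced_body "S -` K" T using C(1,2) T co by (intro sliced_body.intro)
  have cn: "CARD('m ix) = DIM(real ^ 'n)" using co dm dn by simp
  define J where "J = enn2real (\<integral>\<^sup>+c. slice c * slice c ^ (DIM(real ^ 'm) + 1) \<partial>lborel)"
  have J: "(\<integral>\<^sup>+c. slice c * slice c ^ (DIM(real ^ 'm) + 1) \<partial>lborel) = ennreal J"
    unfolding J_def using slice_power_integral_finite by (intro ennreal_enn2real[symmetric]) (simp only: infinity_ennreal_def)
  have J0: "0 \<le> J" by (simp add: J_def)
  have E: "ennreal (expected_holes K (d + 1) n) = of_nat (n choose (d + 1)) * hole_integral (n - (d + 1))" for n
    using expected_holes_eq[OF cn, of n]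
    unfolding hole_integral_eq[OF S T co assms(5)] hole_integral_def on_slice_def dn .
  let ?a = "\<lambda>n. expected_holes K (d + 1) n / real n ^ d"
  have a0: "0 \<le> ?a n" for n unfolding expected_holes_def by (intro divide_nonneg_nonneg integral_nonneg_AE) auto
  have "(\<lambda>r. ennreal (real ((r + d + 1) choose (d + 1)) / (real (r + d + 1) ^ d * real r)) * (of_nat r * hole_integral r))
     \<longlonglongrightarrow> ennreal (1 / fact (d + 1)) * (ennreal (2 * fact (DIM(real ^ 'm) + 1)) * ennreal J)"
    by (rule tendsto_mult_ennreal[OF tendsto_ennrealI[OF binomial_quotient_tendsto] hole_integral_tendsto[unfolded J]])
      (auto simp: ennreal_mult_eq_top_iff)
  \<comment> \<open>The factorials leave \<open>d! / (d + 1)! = 1 / (d + 1)\<close>.\<close>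
  also have "ennreal (1 / fact (d + 1)) * (ennreal (2 * fact (DIM(real ^ 'm) + 1)) * ennreal J) = ennreal (2 * J / (d + 1))"
    unfolding dm using J0 by (simp add: ennreal_mult'[symmetric] del: of_nat_Suc)
  finally have "(\<lambda>r. ennreal (real ((r + d + 1) choose (d + 1)) / (real (r + d + 1) ^ d * real r)) * (of_nat r * hole_integral r))
     \<longlonglongrightarrow> ennreal (2 * J / (d + 1))" .
  \<comment> \<open>For \<open>r > 0\<close> the factor \<open>of_nat r\<close> of the scaled hole
    integral cancels the \<open>real r\<close> in the quotient.\<close>
  moreover have "\<forall>\<^sub>F r in sequentially. ennreal (real ((r + d + 1) choose (d + 1)) / (real (r + d + 1) ^ d * real r)) * (of_nat r * hole_integral r) = ennreal (?a (r + (d + 1)))"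
    using eventually_gt_at_top[of 0]
  proof eventually_elim
    case (elim r)
    let ?n = "r + (d + 1)"
    have "ennreal (?a ?n) = ennreal (1 / real ?n ^ d) * ennreal (expected_holes K (d + 1) ?n)"
      by (simp add: ennreal_mult'[symmetric])
    also have "\<dots> = ennreal (1 / real ?n ^ d) * (of_nat (?n choose (d + 1)) * hole_integral r)"
      unfolding E by simp
    also have "\<dots> = (ennreal (1 / real ?n ^ d) * ennreal (real (?n choose (d + 1)))) * hole_integral r"
      by (simp add: ennreal_of_nat_eq_real_of_nat mult.assoc)
    also have "ennreal (1 / real ?n ^ d) * ennreal (real (?n choose (d + 1))) = ennreal (real (?n choose (d + 1)) / (real ?n ^ d * real r)) * ennreal (real r)"
      using elim by (simp add: ennreal_mult''[symmetric] del: binomial_Suc_Suc)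
    finally show ?case by (simp add: ennreal_of_nat_eq_real_of_nat mult.assoc add.assoc del: binomial_Suc_Suc)
  qed
  ultimately have "(\<lambda>r. ennreal (?a (r + (d + 1)))) \<longlonglongrightarrow> ennreal (2 * J / (d + 1))"
    by (rule Lim_transform_eventually)
  then have "(\<lambda>r. ?a (r + (d + 1))) \<longlonglongrightarrow> 2 * J / (d + 1)"
    by (rule tendsto_ennrealD) (rule always_eventually, rule allI, rule a0, use J0 in simp)
  then have lim: "?a \<longlonglongrightarrow> 2 * J / (d + 1)" by (rule LIMSEQ_offset)
  \<comment> \<open>Unit volume makes the left-hand side of \<open>mass_le\<close> equal to 1,
    whatever the power.\<close>
  have "1 \<le> ennreal (fact DIM(real ^ 'm) * ?p / (DIM(real ^ 'm) + 2)) * ennreal J"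
    using mass_le unfolding J C(3) assms(5) by simp
  also have "\<dots> = ennreal (fact DIM(real ^ 'm) * ?p / (DIM(real ^ 'm) + 2) * J)"
    using J0 by (rule ennreal_mult''[symmetric])
  also have "fact DIM(real ^ 'm) * ?p / (DIM(real ^ 'm) + 2) * J = fact (d - 1) * ?p * J / (d + 1)"
    using dm by (metis (no_types, lifting) add.commute add_diff_cancel_right' nat_1_add_1 of_nat_add group_cancel.add1 times_divide_eq_left of_nat_1 one_add_one of_nat_numeral)
  finally have ge: "1 \<le> fact (d - 1) * ?p * J / (d + 1)" by simp
  \<comment> \<open>Needed for the division by \<open>?p\<close>; with \<open>?p\<close> nonpositive
    the product in \<open>ge\<close> could not reach 1.\<close>
  have "0 < ?p"
  proof (rule ccontr)
    assume "\<not> 0 < ?p"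
    then have "fact (d - 1) * ?p * J / (d + 1) \<le> 0"
      using J0 by (simp add: mult_nonneg_nonpos mult_nonpos_nonneg divide_nonpos_pos)
    then show False using ge by linarith
  qed
  then have "2 / (fact (d - 1) * ?p) \<le> 2 * J / (d + 1)"
    using ge by (simp add: field_simps)
  then show ?thesis using lim by (auto simp: convergent_def limI)
qed

end
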